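(* In the setting described in the context, let $Z=(X,Y,N)=\{(X_t,Y_t,N_t)\}_{t\ge0}$ be the unique strong solution to $$X_t=X_0+\int_{0+}^t\int_{\mathbb{R}}h_\Lambda(X_{u-},Y_{u-},N_{u-},v)\,\wp(du,dv),$$ $$Y_t=Y_0+t-\int_{0+}^t (Y_{u-})\int_{\mathbb{R}}g_\Lambda(X_{u-},Y_{u-},N_{u-},v)\,\wp(du,dv),$$ $$N_t=\int_{0+}^t\int_{\mathbb{R}}g_\Lambda(X_{u-},Y_{u-},N_{u-},v)\,\wp(du,dv),\qquad t\ge0,$$ and let $T_0:=-Y_0$ and $T_1<T_2<\cdots$ be the successive jump times of $X$. Then the following hold. (i) The process $\{X_t\}_{t\ge0}$ is a pure semi-Markov process. (ii) The embedded chain $\{X_{T_n}\}_{n\ge1}$ is a discrete time Markov chain.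
   Context: Definition. A process $X=\{X_t\}_{t\ge0}$ defined on a complete probability space is a semi-Markov process with state space $\mathcal{X}$ if (1) $X$ is a piecewise constant r.c.l.l. process with discontinuities at $T_1<T_2<\cdots<T_n<\cdots$, and (2) for each $n\ge1$, $j\in\mathcal{X}$ and $y>0$, $$P[X_{T_{n+1}}=j,\,T_{n+1}-T_n\le y\mid (X_0,T_0),(X_{T_k},T_k)\ \forall 1\le k\le n]=P[X_{T_{n+1}}=j,\,T_{n+1}-T_n\le y\mid X_{T_n}],$$ where $T_0\le0<T_1$. It is pure if $T_n\to\infty$ almost surely as $n\to\infty$. (The right-hand side is allowed to depend on $n$.) Setting. $(\Omega,\mathcal{F},\{\mathcal{F}_t\}_{t\ge0},P)$ is a filtered probability space satisfying the usual hypothesis; $\mathcal{X}=\{1,2,\dots\}$ is the state space, embedded in $\mathbb{R}$; $\mathbb{N}_0=\{0,1,2,\dots\}$, $\mathbb{R}_+=[0,\infty)$; $m_d$ is Lebesgue measure on $\mathbb{R}^d$. $\mathcal{X}$ is endowed with a total order $\prec_1$, which induces a total order $\prec_2$ on $\mathcal{X}_2:=\{(i,j)\in\mathcal{X}^2: i\ne j\}$ by the lexicographic order. For each $(i,j)\in\mathcal{X}_2$, $\lambda_{ij}:\mathbb{R}_+\times\mathbb{N}_0\to\mathbb{R}_+$ is a bounded measurable function; $\lambda_i(y,n):=\sum_{j\in\mathcal{X}\setminus\{i\}}\lambda_{ij}(y,n)$. These satisfy: (A1) with $c_i:=\sum_{j\in\mathcal{X}\setminus\{i\}}\|\lambda_{ij}\|_{L^\infty(\mathbb{R}_+\times\mathbb{N}_0)}$,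 one has $c:=\sup_i c_i<\infty$; (A2) for each $n\in\mathbb{N}_0$ and $i\in\mathcal{X}$, $\lim_{y\to\infty}\gamma_i(y,n)=\infty$, where $\gamma_i(y,n):=\int_0^y\lambda_i(y',n)\,dy'$. For each $(i,j)\in\mathcal{X}_2$, $\tilde\lambda_{ij}:\mathbb{R}_+\times\mathbb{N}_0\to\mathbb{R}_+$ is a measurable function such that $\lambda_{ij}(y,n)\le\tilde\lambda_{ij}(y,n)$ for each $y\in\mathbb{R}_+$, $n\in\mathbb{N}_0$, and $\tilde\lambda_{ij}(y,n)\le\|\lambda_{ij}\|_{L^\infty(\mathbb{R}_+\times\mathbb{N}_0)}$ for almost every $y\in\mathbb{R}_+$ and $n\in\mathbb{N}_0$. For each $y,n$ a disjoint collection of intervals is defined by $$\Lambda_{ij}(y,n)=\Big(\sum_{(i',j')\prec_2(i,j)}\tilde\lambda_{i'j'}(y,n)\Big)+[0,\lambda_{ij}(y,n)),\qquad (i,j)\in\mathcal{X}_2,$$ where $a+B=\{a+b: b\in B\}$. The functions $h_\Lambda,g_\Lambda:\mathcal{X}\times\mathbb{R}_+\times\mathbb{N}_0\times\mathbb{R}\to\mathbb{R}$ are $$h_\Lambda(i,y,n,v):=\sum_{j\in\mathcal{X}\setminus\{i\}}(j-i)\mathbf{1}_{\Lambda_{ij}(y,n)}(v),\qquad g_\Lambda(i,y,n,v):=\sum_{j\in\mathcal{X}\setminus\{i\}}\mathbf{1}_{\Lambda_{ij}(y,n)}(v).$$ $\wp(du,dv)$ is a Poisson random measure on $\mathbb{R}_+\times\mathbb{R}$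 with intensity $m_2(du,dv)$, defined on $(\Omega,\mathcal{F},P)$, and $\{\wp((0,t]\times dv)\}_{t\ge0}$ is adapted to $\{\mathcal{F}_t\}_{t\ge0}$. The initial values are $X_0\in\mathcal{X}$, $Y_0\in\mathbb{R}_+$, $N_0=0$. $\int_{0+}^t$ denotes integration over $(0,t]$. *)

theory Defs
  imports "HOL-Probability.Probability"
begin

section \<open>Filtrations, path regularity and Poisson random measures\<close>

text \<open>A family indexed by all reals serves as a filtration over \<open>t \<ge> 0\<close>; its values at negative
  indices are irrelevant.\<close>

definition usual_filtration :: "'a measure \<Rightarrow> (real \<Rightarrow> 'a measure) \<Rightarrow> bool" where
  "usual_filtration M F \<longleftrightarrow>
     complete_measure M \<and>
     (\<forall>t\<ge>0. subalgebra M (F t)) \<and>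
     (\<forall>s\<ge>0. \<forall>t\<ge>s. sets (F s) \<subseteq> sets (F t)) \<and>
     null_sets M \<subseteq> sets (F 0) \<and>
     (\<forall>t\<ge>0. sets (F t) = (\<Inter>s\<in>{t<..}. sets (F s)))"

definition rcll :: "(real \<Rightarrow> 's::topological_space) \<Rightarrow> bool" where
  "rcll x \<longleftrightarrow> (\<forall>t\<ge>0. (x \<longlongrightarrow> x t) (at_right t)) \<and> (\<forall>t>0. \<exists>l. (x \<longlongrightarrow> l) (at_left t))"

definition left_lim :: "(real \<Rightarrow> 's::t2_space) \<Rightarrow> real \<Rightarrow> 's" where
  "left_lim x u = Lim (at_left u) x"

text \<open>\<open>I\<close> is the intensity measure. Sets of infinite intensity have infinitely many points almost
  surely. The Poisson probabilities are written out because the library's \<open>poisson_pmf\<close> is only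
  specified for a strictly positive rate.\<close>

definition poisson_random_measure :: "'a measure \<Rightarrow> 'b measure \<Rightarrow> ('a \<Rightarrow> 'b measure) \<Rightarrow> bool" where
  "poisson_random_measure M I p \<longleftrightarrow>
     (\<forall>\<omega>\<in>space M. sets (p \<omega>) = sets I) \<and>
     (\<forall>A\<in>sets I. (\<lambda>\<omega>. emeasure (p \<omega>) A) \<in> borel_measurable M) \<and>
     (\<forall>A\<in>sets I. emeasure I A < \<infinity> \<longrightarrow>
        (\<forall>k::nat. measure M {\<omega>\<in>space M. emeasure (p \<omega>) A = of_nat k} =
           exp (- measure I A) * measure I A ^ k / fact k)) \<and>
     (\<forall>A\<in>sets I. emeasure I A = \<infinity> \<longrightarrow> (AE \<omega> in M. emeasure (p \<omega>) A = \<infinity>)) \<and>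
     (\<forall>A::nat \<Rightarrow> 'b set. range A \<subseteq> sets I \<longrightarrow> disjoint_family A \<longrightarrow>
        prob_space.indep_vars M (\<lambda>_. borel) (\<lambda>k \<omega>. emeasure (p \<omega>) (A k)) UNIV)"

definition sigma_of_random_measure ::
    "'a measure \<Rightarrow> 'b measure \<Rightarrow> ('a \<Rightarrow> 'b measure) \<Rightarrow> 'a measure" where
  "sigma_of_random_measure M I p =
     vimage_algebra (space M) (\<lambda>\<omega>. \<lambda>A\<in>sets I. emeasure (p \<omega>) A) (PiM (sets I) (\<lambda>_. borel))"

section \<open>Semi-Markov processes and Markov chains\<close>

definition cond_prob_given :: "'a measure \<Rightarrow> ('a \<Rightarrow> 'b) \<Rightarrow> 'b measure \<Rightarrow> 'a set \<Rightarrow> 'a \<Rightarrow> real" where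
  "cond_prob_given M f N A = real_cond_exp M (vimage_algebra (space M) f N) (indicator A)"

text \<open>Here \<open>T 0 = T\<^sub>0 \<le> 0\<close> is not a jump time, and the state attached to index \<open>0\<close> is \<open>X\<^sub>0\<close>, not the
  value of the process at the time \<open>T\<^sub>0\<close>.\<close>

definition embedded :: "(real \<Rightarrow> 'a \<Rightarrow> 's) \<Rightarrow> (nat \<Rightarrow> 'a \<Rightarrow> real) \<Rightarrow> nat \<Rightarrow> 'a \<Rightarrow> 's" where
  "embedded X T n \<omega> = (if n = 0 then X 0 \<omega> else X (T n \<omega>) \<omega>)"

definition piecewise_constant_with_jumps ::
    "(real \<Rightarrow> 's::topological_space) \<Rightarrow> (nat \<Rightarrow> real) \<Rightarrow> bool" where
  "piecewise_constant_with_jumps x \<tau> \<longleftrightarrow>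
     0 < \<tau> 1 \<and> (\<forall>n\<ge>1. \<tau> n < \<tau> (Suc n)) \<and>
     {t. 0 < t \<and> \<not> isCont x t} = \<tau> ` {1..} \<and>
     (\<forall>t. 0 \<le> t \<and> t < \<tau> 1 \<longrightarrow> x t = x 0) \<and>
     (\<forall>n\<ge>1. \<forall>t. \<tau> n \<le> t \<and> t < \<tau> (Suc n) \<longrightarrow> x t = x (\<tau> n))"

text \<open>The state space \<open>S\<close> is discrete.\<close>

definition semi_Markov ::
    "'a measure \<Rightarrow> 's::topological_space set \<Rightarrow> (real \<Rightarrow> 'a \<Rightarrow> 's) \<Rightarrow> (nat \<Rightarrow> 'a \<Rightarrow> real) \<Rightarrow> bool" where
  "semi_Markov M S X T \<longleftrightarrow>
     prob_space M \<and> complete_measure M \<and>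
     (\<forall>t\<ge>0. X t \<in> measurable M (count_space UNIV)) \<and>
     (\<forall>n. T n \<in> borel_measurable M) \<and>
     (\<forall>n. embedded X T n \<in> measurable M (count_space UNIV)) \<and>
     (AE \<omega> in M. (\<forall>t\<ge>0. X t \<omega> \<in> S) \<and> rcll (\<lambda>t. X t \<omega>) \<and> T 0 \<omega> \<le> 0 \<and>
        piecewise_constant_with_jumps (\<lambda>t. X t \<omega>) (\<lambda>n. T n \<omega>)) \<and>
     (\<forall>n\<ge>1. \<forall>j\<in>S. \<forall>y>0.
        let A = {\<omega>\<in>space M. embedded X T (Suc n) \<omega> = j \<and> T (Suc n) \<omega> - T n \<omega> \<le> y} in
        AE \<omega> in M.
          cond_prob_given M (\<lambda>\<omega>. \<lambda>k\<in>{..n}. (embedded X T k \<omega>, T k \<omega>))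
            (PiM {..n} (\<lambda>_. count_space UNIV \<Otimes>\<^sub>M borel)) A \<omega> =
          cond_prob_given M (embedded X T n) (count_space UNIV) A \<omega>)"

definition pure_semi_Markov ::
    "'a measure \<Rightarrow> 's::topological_space set \<Rightarrow> (real \<Rightarrow> 'a \<Rightarrow> 's) \<Rightarrow> (nat \<Rightarrow> 'a \<Rightarrow> real) \<Rightarrow> bool" where
  "pure_semi_Markov M S X T \<longleftrightarrow>
     semi_Markov M S X T \<and> (AE \<omega> in M. filterlim (\<lambda>n. T n \<omega>) at_top sequentially)"

text \<open>Time-homogeneity is not part of the definition.\<close>

definition markov_chain :: "'a measure \<Rightarrow> 's set \<Rightarrow> (nat \<Rightarrow> 'a \<Rightarrow> 's) \<Rightarrow> bool" where
  "markov_chain M S Z \<longleftrightarrow>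
     prob_space M \<and>
     (\<forall>n. Z n \<in> measurable M (count_space UNIV)) \<and>
     (AE \<omega> in M. \<forall>n. Z n \<omega> \<in> S) \<and>
     (\<forall>n. \<forall>j\<in>S.
        let A = {\<omega>\<in>space M. Z (Suc n) \<omega> = j} in
        AE \<omega> in M.
          cond_prob_given M (\<lambda>\<omega>. \<lambda>k\<in>{..n}. Z k \<omega>) (PiM {..n} (\<lambda>_. count_space UNIV)) A \<omega> =
          cond_prob_given M (Z n) (count_space UNIV) A \<omega>)"

text \<open>Successive discontinuities of a path in \<open>(0, \<infinity>)\<close>; the value is arbitrary as soon as there is
  no further discontinuity.\<close>

primrec jump_time :: "(real \<Rightarrow> 's::topological_space) \<Rightarrow> nat \<Rightarrow> real" where
  "jump_time x 0 = 0"
| "jump_time x (Suc n) = Inf {t. jump_time x n < t \<and> \<not> isCont x t}"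

definition transition_time ::
    "('a \<Rightarrow> real) \<Rightarrow> (real \<Rightarrow> 'a \<Rightarrow> 's::topological_space) \<Rightarrow> nat \<Rightarrow> 'a \<Rightarrow> real" where
  "transition_time T0 X n \<omega> = (if n = 0 then T0 \<omega> else jump_time (\<lambda>t. X t \<omega>) n)"

section \<open>Transition rates\<close>

text \<open>A family of rates \<open>lam i j y n\<close> is meaningful for \<open>(i, j) \<in> state_pairs\<close> and \<open>y \<ge> 0\<close>.\<close>

type_synonym rates = "nat \<Rightarrow> nat \<Rightarrow> real \<Rightarrow> nat \<Rightarrow> real"

definition states :: "nat set" where
  "states = {1..}"

definition state_pairs :: "(nat \<times> nat) set" where
  "state_pairs = {(i, j). i \<in> states \<and> j \<in> states \<and> i \<noteq> j}"

definition age_count_measure :: "(real \<times> nat) measure" where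
  "age_count_measure = restrict_space lborel {0..} \<Otimes>\<^sub>M count_space UNIV"

definition Linf_norm :: "(real \<Rightarrow> nat \<Rightarrow> real) \<Rightarrow> ennreal" where
  "Linf_norm f = esssup age_count_measure (\<lambda>(y, n). ennreal \<bar>f y n\<bar>)"

definition rate_bound :: "rates \<Rightarrow> nat \<Rightarrow> ennreal" where
  "rate_bound lam i = (\<Sum>\<^sub>\<infinity>j\<in>states - {i}. Linf_norm (lam i j))"

definition total_rate :: "rates \<Rightarrow> nat \<Rightarrow> real \<Rightarrow> nat \<Rightarrow> ennreal" where
  "total_rate lam i y n = (\<Sum>\<^sub>\<infinity>j\<in>states - {i}. ennreal (lam i j y n))"

definition cumulative_rate :: "rates \<Rightarrow> nat \<Rightarrow> real \<Rightarrow> nat \<Rightarrow> ennreal" where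
  "cumulative_rate lam i y n = (\<integral>\<^sup>+ y'\<in>{0..y}. total_rate lam i y' n \<partial>lborel)"

text \<open>\<open>r\<close> is the strict order on the states; pairs are ordered lexicographically.\<close>

definition pairs_before :: "(nat \<times> nat) set \<Rightarrow> nat \<Rightarrow> nat \<Rightarrow> (nat \<times> nat) set" where
  "pairs_before r i j = {q \<in> state_pairs. (q, (i, j)) \<in> r <*lex*> r}"

definition Lam :: "(nat \<times> nat) set \<Rightarrow> rates \<Rightarrow> rates \<Rightarrow> nat \<Rightarrow> nat \<Rightarrow> real \<Rightarrow> nat \<Rightarrow> real set" where
  "Lam r lam lamt i j y n =
     (+) (\<Sum>\<^sub>\<infinity>(i', j')\<in>pairs_before r i j. lamt i' j' y n) ` {0..<lam i j y n}"

definition hLam :: "(nat \<times> nat) set \<Rightarrow> rates \<Rightarrow> rates \<Rightarrow> nat \<Rightarrow> real \<Rightarrow> nat \<Rightarrow> real \<Rightarrow> real" where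
  "hLam r lam lamt i y n v =
     (\<Sum>\<^sub>\<infinity>j\<in>states - {i}. (real j - real i) * indicator (Lam r lam lamt i j y n) v)"

definition gLam :: "(nat \<times> nat) set \<Rightarrow> rates \<Rightarrow> rates \<Rightarrow> nat \<Rightarrow> real \<Rightarrow> nat \<Rightarrow> real \<Rightarrow> real" where
  "gLam r lam lamt i y n v = (\<Sum>\<^sub>\<infinity>j\<in>states - {i}. indicator (Lam r lam lamt i j y n) v)"

section \<open>The stochastic differential equation\<close>

definition half_plane :: "(real \<times> real) measure" where
  "half_plane = restrict_space lborel ({0..} \<times> UNIV)"

text \<open>Integrability is required explicitly because the Bochner integral of a non-integrable function
  is \<open>0\<close> by convention.\<close>

definition strong_solution ::
    "'a measure \<Rightarrow> (real \<Rightarrow> 'a measure) \<Rightarrow> ('a \<Rightarrow> (real \<times> real) measure) \<Rightarrow>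
     (nat \<times> nat) set \<Rightarrow> rates \<Rightarrow> rates \<Rightarrow>
     (real \<Rightarrow> 'a \<Rightarrow> nat) \<Rightarrow> (real \<Rightarrow> 'a \<Rightarrow> real) \<Rightarrow> (real \<Rightarrow> 'a \<Rightarrow> nat) \<Rightarrow> bool" where
  "strong_solution M F p r lam lamt X Y N \<longleftrightarrow>
     (\<forall>t\<ge>0. X t \<in> measurable (F t) (count_space UNIV) \<and> Y t \<in> borel_measurable (F t) \<and>
        N t \<in> measurable (F t) (count_space UNIV)) \<and>
     (\<forall>t\<ge>0. \<forall>\<omega>\<in>space M. X t \<omega> \<in> states \<and> 0 \<le> Y t \<omega>) \<and>
     (AE \<omega> in M. rcll (\<lambda>t. X t \<omega>) \<and> rcll (\<lambda>t. Y t \<omega>) \<and> rcll (\<lambda>t. N t \<omega>)) \<and>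
     (AE \<omega> in M. \<forall>t\<ge>0.
        let D = {0<..t} \<times> UNIV;
            Xm = left_lim (\<lambda>s. X s \<omega>); Ym = left_lim (\<lambda>s. Y s \<omega>); Nm = left_lim (\<lambda>s. N s \<omega>);
            h = (\<lambda>(u, v). hLam r lam lamt (Xm u) (Ym u) (Nm u) v);
            g = (\<lambda>(u, v). gLam r lam lamt (Xm u) (Ym u) (Nm u) v);
            k = (\<lambda>(u, v). Ym u * gLam r lam lamt (Xm u) (Ym u) (Nm u) v)
        in set_integrable (p \<omega>) D h \<and> set_integrable (p \<omega>) D g \<and> set_integrable (p \<omega>) D k \<and>
           real (X t \<omega>) = real (X 0 \<omega>) + set_lebesgue_integral (p \<omega>) D h \<and>
           Y t \<omega> = Y 0 \<omega> + t - set_lebesgue_integral (p \<omega>) D k \<and>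
           real (N t \<omega>) = set_lebesgue_integral (p \<omega>) D g)"

end

theory Submission
  imports Defs
begin

text \<open>
The solution moves only at atoms of the Poisson random measure: while \<open>N = n\<close> and \<open>X = i\<close> and the
current sojourn started at time \<open>a\<close>, the next jump occurs at the first atom \<open>(u, v)\<close> with
\<open>v \<in> \<Lambda>\<^sub>i\<^sub>j(u - a, n)\<close> for some \<open>j\<close>, and this \<open>j\<close> is the new state. Instead of the strong Markov
property of the random measure, the proof uses its compensation (Campbell's) formula for sets that are
predictable with respect to the filtration of the past of the random measure and the initial values.
Applied to the atom that causes the next jump, the formula first shows with (A2) that there are almost
surely infinitely many jumps. It then yields, for every event \<open>E\<close> of the history up to \<open>T\<^sub>n\<close> on which
\<open>X\<close> is in \<open>i\<close>, a Volterra equation for \<open>P(E, T\<^sub>n\<^sub>+\<^sub>1 - T\<^sub>n \<ge> y)\<close> whose kernel depends only on \<open>i\<close> and \<open>n\<close>. By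
uniqueness the solutions for different \<open>E\<close> are proportional, which is the conditional independence
required by both claims.
\<close>

section \<open>Null sets, series and conditioning on a discrete variable\<close>

text \<open>The filtration \<open>F\<close> is only required to see the random measure; nothing
  makes the atoms after time s independent of \<open>F s\<close>. Compensation is therefore set up
  with a filtration built for the purpose: the initial values, which are independent of the random
  measure, the masses observed up to s, and all null sets. The null sets matter because paths are
  described only almost surely.

  A second obstacle is that the existence of the next jump has to be proved, while Campbell's
  formula already needs predictable sets. The time up to which a sojourn lasts is therefore encoded
  by the absence of atoms in the exit region so far, which makes sense on every path.

  The kernel of the Volterra equation depends on i and n alone because for n \<ge> 1 the age
  restarts at 0 at the jump; rates bounded by (A1) make its solution unique. For n = 0 the sojourn
  starts at the random age \<open>Y 0\<close>, and neither claim speaks of the conditional law of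
  that step.\<close>

lemma (in complete_measure) measurable_AE_cong_subalgebra:
  assumes G: "subalgebra M G" "null_sets M \<subseteq> sets G"
    and g: "g \<in> measurable G N" and f: "\<And>x. x \<in> space M \<Longrightarrow> f x \<in> space N"
    and ae: "AE x in M. f x = g x"
  shows "f \<in> measurable G N"
proof (rule measurableI)
  have sp: "space G = space M" using G by (simp add: subalgebra_def)
  show "f x \<in> space N" if "x \<in> space G" for x using f that sp by simp
  fix A assume A: "A \<in> sets N"
  from ae obtain Z where Z: "Z \<in> null_sets M" "{x\<in>space M. f x \<noteq> g x} \<subseteq> Z"
    by (auto elim!: AE_E simp: null_sets_def)
  \<comment> \<open>Completeness enters here: a subset of a null set is null, whatever its shape,
    and hence belongs to \<open>G\<close>.\<close>
  have "f -` A \<inter> Z \<in> null_sets M" by (rule complete2[OF _ Z(1)]) auto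
  then have "(g -` A \<inter> space G - Z) \<union> (f -` A \<inter> Z) \<in> sets G"
    using measurable_sets[OF g A] G(2) Z(1) by (intro sets.Un sets.Diff) auto
  also have "(g -` A \<inter> space G - Z) \<union> (f -` A \<inter> Z) = f -` A \<inter> space G"
    using Z sets.sets_into_space[of Z M] by (auto simp: sp null_sets_def)
  finally show "f -` A \<inter> space G \<in> sets G" .
qed

text \<open>Unordered sums over the states are turned into series, for which measurability and
  countable additivity are available.\<close>

lemma infsum_nat_eq_suminf:
  fixes f :: "nat \<Rightarrow> ennreal"
  shows "infsum f S = (\<Sum>j. if j \<in> S then f j else 0)"
proof -
  have "infsum f S = infsum (\<lambda>j. if j \<in> S then f j else 0) UNIV"
    by (rule infsum_cong_neutral) auto
  also have "\<dots> = (\<Sum>j. if j \<in> S then f j else 0)"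
    by (rule sums_unique, rule has_sum_imp_sums, rule has_sum_infsum)
       (rule nonneg_summable_on_complete, auto)
  finally show ?thesis .
qed

lemma infsum_pair_eq_suminf:
  fixes f :: "nat \<times> nat \<Rightarrow> real"
  assumes "f summable_on S"
  shows "infsum f S = (\<Sum>k. if prod_decode k \<in> S then f (prod_decode k) else 0)"
proof -
  let ?g = "\<lambda>x. if x \<in> S then f x else 0"
  have "(f has_sum infsum f S) S" using assms by (rule has_sum_infsum)
  then have "(?g has_sum infsum f S) UNIV"
    by (subst has_sum_cong_neutral[where T=S and g=f]) auto
  then have "((\<lambda>k. ?g (prod_decode k)) has_sum infsum f S) UNIV"
    by (subst has_sum_reindex_bij_betw[OF bij_prod_decode]) 
  then show ?thesis by (rule sums_unique[OF has_sum_imp_sums])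
qed

text \<open>The hypothesis \<open>indep\<close> is conditional independence of \<open>A\<close> and
  \<open>G\<close> given \<open>Z\<close>, cleared of denominators so that values of probability 0
  cause no trouble. The right-hand side does not mention \<open>G\<close>: two sub-sigma-algebras
  that satisfy the hypothesis give the same conditional probability, and this is how both Markov
  properties will be obtained.\<close>

lemma (in prob_space) real_cond_exp_eq_of_discrete:
  fixes Z :: "'a \<Rightarrow> nat"
  assumes G: "subalgebra M G" and Z: "Z \<in> measurable G (count_space UNIV)"
    and A: "A \<in> events"
    and indep: "\<And>B i. B \<in> sets G \<Longrightarrow>
      prob (B \<inter> A \<inter> {\<omega>\<in>space M. Z \<omega> = i}) * prob {\<omega>\<in>space M. Z \<omega> = i} =
      prob (B \<inter> {\<omega>\<in>space M. Z \<omega> = i}) * prob (A \<inter> {\<omega>\<in>space M. Z \<omega> = i})"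
  shows "AE \<omega> in M. real_cond_exp M G (indicator A) \<omega> =
     prob (A \<inter> {\<omega>'\<in>space M. Z \<omega>' = Z \<omega>}) / prob {\<omega>'\<in>space M. Z \<omega>' = Z \<omega>}"
proof -
  interpret sigma_finite_subalgebra M G
    using G by (rule finite_measure_subalgebra_is_sigma_finite[unfolded finite_measure_subalgebra_def finite_measure_subalgebra_axioms_def, OF conjI, OF finite_measure_axioms])
  have sp: "space G = space M" and sub: "sets G \<subseteq> events" using G by (auto simp: subalgebra_def)
  define Q where "Q i = {\<omega>\<in>space M. Z \<omega> = i}" for i
  have QG: "Q i \<in> sets G" for i
    using measurable_sets[OF Z, of "{i}"] by (simp add: Q_def vimage_def Int_def sp conj_commute)
  then have Q: "Q i \<in> events" for i using sub by auto
  define h where "h i = prob (A \<inter> Q i) / prob (Q i)" for i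
  have h: "0 \<le> h i" "h i \<le> 1" for i
    using Q A by (auto simp: h_def divide_le_eq_1 intro!: finite_measure_mono order_antisym_conv zero_less_measure_iff[THEN iffD2])
  have hZ[measurable]: "(\<lambda>\<omega>. h (Z \<omega>)) \<in> borel_measurable G"
    using Z by (rule measurable_compose) simp
  have hZM[measurable]: "(\<lambda>\<omega>. h (Z \<omega>)) \<in> borel_measurable M"
    using hZ G by (rule measurable_from_subalg[rotated])
  \<comment> \<open>For a value of probability 0 the quotient \<open>h i\<close> is 0 by convention,
    and both sides vanish.\<close>
  have hh: "h i * prob (B \<inter> Q i) = prob (B \<inter> A \<inter> Q i)" if "B \<in> sets G" for B i
  proof (cases "prob (Q i) = 0")
    case True
    have "prob (B \<inter> Q i) \<le> prob (Q i)" "prob (B \<inter> A \<inter> Q i) \<le> prob (Q i)"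
      using Q that sub A by (auto intro!: finite_measure_mono)
    with True show ?thesis by (simp add: measure_le_0_iff)
  next
    case False
    then show ?thesis using indep[OF that, of i] by (simp add: h_def Q_def field_simps)
  qed
  have "AE \<omega> in M. real_cond_exp M G (indicator A) \<omega> = h (Z \<omega>)"
  proof (rule real_cond_exp_charact)
    fix B assume B: "B \<in> sets G"
    then have BM: "B \<in> events" using sub by auto
    have "ennreal (\<integral>\<omega>\<in>B. h (Z \<omega>) \<partial>M) = (\<integral>\<^sup>+\<omega>. ennreal (indicator B \<omega> * h (Z \<omega>)) \<partial>M)"
      unfolding set_lebesgue_integral_def
      by (subst nn_integral_eq_integral)
         (use BM h in \<open>auto intro!: integrable_const_bound[where B=1] simp: indicator_def split: if_splits\<close>)
    \<comment> \<open>Split along the countably many values of \<open>Z\<close>, on each of which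
      \<open>h (Z \<omega>)\<close> is constant.\<close>
    also have "\<dots> = (\<integral>\<^sup>+\<omega>. (\<Sum>i. ennreal (h i) * indicator (B \<inter> Q i) \<omega>) \<partial>M)"
    proof (rule nn_integral_cong)
      fix \<omega> assume "\<omega> \<in> space M"
      then have "(\<lambda>i. ennreal (h i) * indicator (B \<inter> Q i) \<omega>) = (\<lambda>i. if i = Z \<omega> then ennreal (h i) * indicator B \<omega> else 0)"
        by (auto simp: Q_def indicator_def fun_eq_iff)
      then have "(\<lambda>i. ennreal (h i) * indicator (B \<inter> Q i) \<omega>) sums (ennreal (h (Z \<omega>)) * indicator B \<omega>)"
        using sums_single[of "Z \<omega>" "\<lambda>i. ennreal (h i) * indicator B \<omega>"] by simp
      from sums_unique[OF this] show "ennreal (indicator B \<omega> * h (Z \<omega>)) = (\<Sum>i. ennreal (h i) * indicator (B \<inter> Q i) \<omega>)"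
        by (cases "\<omega> \<in> B") (simp_all add: mult.commute)
    qed
    also have "\<dots> = (\<Sum>i. ennreal (h i) * emeasure M (B \<inter> Q i))"
      using BM Q by (subst nn_integral_suminf) (auto simp: nn_integral_cmult_indicator)
    also have "\<dots> = (\<Sum>i. emeasure M (B \<inter> A \<inter> Q i))"
      using h by (intro suminf_cong) (simp add: emeasure_eq_measure hh[OF B, symmetric] ennreal_mult)
    also have "\<dots> = emeasure M (\<Union>i. B \<inter> A \<inter> Q i)"
      using BM A Q by (intro suminf_emeasure) (auto simp: disjoint_family_on_def Q_def)
    also have "(\<Union>i. B \<inter> A \<inter> Q i) = B \<inter> A"
      using sets.sets_into_space[OF A] by (auto simp: Q_def)
    finally have "ennreal (\<integral>\<omega>\<in>B. h (Z \<omega>) \<partial>M) = ennreal (prob (B \<inter> A))" by (simp add: emeasure_eq_measure)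
    moreover have "0 \<le> (\<integral>\<omega>\<in>B. h (Z \<omega>) \<partial>M)"
      unfolding set_lebesgue_integral_def by (rule integral_nonneg_AE) (auto simp: h indicator_def)
    moreover have "(\<integral>\<omega>\<in>B. indicator A \<omega> \<partial>M) = prob (B \<inter> A)"
      using BM A by (simp add: set_lebesgue_integral_def indicator_inter_arith[symmetric] Int_assoc)
    ultimately show "(\<integral>\<omega>\<in>B. indicator A \<omega> \<partial>M) = (\<integral>\<omega>\<in>B. h (Z \<omega>) \<partial>M)"
      by (metis ennreal_inj measure_nonneg)
  next
    show "integrable M (indicator A :: 'a \<Rightarrow> real)" using A by (auto simp: emeasure_eq_measure)
    show "integrable M (\<lambda>\<omega>. h (Z \<omega>))"
      using h by (intro integrable_const_bound[where B=1]) auto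
  qed fact
  then show ?thesis by (simp add: h_def Q_def)
qed

section \<open>Random measures compensated by Lebesgue measure\<close>

text \<open>Windows exhaust the open right half-plane and have finite mass both for Lebesgue measure
  and for \<open>q\<close>. Finiteness is what the complement step of an induction over generated
  sets needs, where masses are subtracted.\<close>

definition window :: "nat \<Rightarrow> (real \<times> real) set" where
  "window K = {0<..real K} \<times> {- real K..real K}"

lemma window_borel[measurable, simp]: "window K \<in> sets borel"
  unfolding window_def borel_prod[symmetric] by (intro pair_measureI) auto

lemma incseq_window: "incseq window"
  by (auto simp: incseq_def window_def)

lemma UN_window: "(\<Union>K. window K) = {0<..} \<times> UNIV"
proof -
  have "\<exists>K. (u, v) \<in> window K" if "0 < u" for u v :: real
  proof -
    obtain K where "max u \<bar>v\<bar> \<le> real K" using real_arch_simple by blast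
    with that have "(u, v) \<in> window K" by (auto simp: window_def)
    then show ?thesis ..
  qed
  then show ?thesis by (force simp: window_def)
qed

lemma emeasure_lborel_window: "emeasure lborel (window K) < \<infinity>"
proof -
  have "emeasure lborel (window K) \<le> emeasure lborel (cbox (0, - real K) (real K, real K))"
    by (intro emeasure_mono) (simp_all, auto simp: window_def cbox_Pair_eq)
  also have "\<dots> < \<infinity>" by (rule emeasure_lborel_cbox_finite)
  finally show ?thesis .
qed

lemma emeasure_eq_SUP_window:
  assumes "sets m = sets borel" "D \<in> sets borel" "D \<subseteq> {0<..} \<times> UNIV"
  shows "emeasure m D = (SUP K. emeasure m (D \<inter> window K))"
proof -
  have "(SUP K. emeasure m (D \<inter> window K)) = emeasure m (\<Union>K. D \<inter> window K)"
    using assms incseq_window by (intro SUP_emeasure_incseq) (auto simp: incseq_def, blast)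
  also have "(\<Union>K. D \<inter> window K) = D" using assms UN_window by auto
  finally show ?thesis ..
qed

lemma strip_borel[measurable]:
  fixes S :: "real set"
  assumes "S \<in> sets borel"
  shows "S \<times> (UNIV :: real set) \<in> sets borel"
  unfolding borel_prod[symmetric] using assms by auto

lemma half_plane_setsI: "A \<in> sets borel \<Longrightarrow> A \<subseteq> {0..} \<times> UNIV \<Longrightarrow> A \<in> sets half_plane"
  unfolding half_plane_def by (subst sets_restrict_space_iff) (auto simp: strip_borel)

text \<open>\<open>q\<close> is a random measure on \<open>(0, \<infinity>) \<times> \<real>\<close> whose compensator with respect to the filtration \<open>G\<close>
  is Lebesgue measure; by Watanabe's theorem this characterises Poisson random measures.\<close>

locale unit_intensity = prob_space M for M :: "'a measure" +
  fixes G :: "real \<Rightarrow> 'a measure" and q :: "'a \<Rightarrow> (real \<times> real) measure"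
  assumes complete: "complete_measure M"
    and subalg: "0 \<le> s \<Longrightarrow> subalgebra M (G s)"
    and G_mono: "0 \<le> s \<Longrightarrow> s \<le> t \<Longrightarrow> sets (G s) \<subseteq> sets (G t)"
    and null_G: "null_sets M \<subseteq> sets (G 0)"
    and sets_q[measurable_cong, simp]: "sets (q \<omega>) = sets borel"
    and q_window: "emeasure (q \<omega>) (window K) < \<infinity>"
    and adapted: "0 \<le> u \<Longrightarrow> D \<in> sets borel \<Longrightarrow> D \<subseteq> {0<..u} \<times> UNIV \<Longrightarrow>
        (\<lambda>\<omega>. emeasure (q \<omega>) D) \<in> borel_measurable (G u)"
    and intensity: "0 \<le> s \<Longrightarrow> E \<in> sets (G s) \<Longrightarrow> D \<in> sets borel \<Longrightarrow> D \<subseteq> {s<..} \<times> UNIV \<Longrightarrow>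
        emeasure lborel D < \<infinity> \<Longrightarrow>
        (\<integral>\<^sup>+\<omega>. indicator E \<omega> * emeasure (q \<omega>) D \<partial>M) = emeasure M E * emeasure lborel D"
begin

section \<open>The predictable sigma-algebra\<close>

definition pred_gen :: "('a \<times> real \<times> real) set set" where
  "pred_gen = {E \<times> D | s E D. 0 \<le> s \<and> E \<in> sets (G s) \<and> D \<in> sets borel \<and> D \<subseteq> {s<..} \<times> UNIV}"

text \<open>The predictable sigma-algebra with marks \<open>v\<close> in the real line. A generator
  pairs an event known at time s with a planar set lying strictly after s; the planar set need not
  be a product of times and marks.\<close>

definition pred :: "('a \<times> real \<times> real) measure" where
  "pred = sigma (space M \<times> ({0<..} \<times> UNIV)) pred_gen"

lemma space_G: "0 \<le> s \<Longrightarrow> space (G s) = space M"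
  using subalg by (auto simp: subalgebra_def)

lemma sets_G_M: "0 \<le> s \<Longrightarrow> E \<in> sets (G s) \<Longrightarrow> E \<in> sets M"
  using subalg by (auto simp: subalgebra_def)

lemma pred_gen_Pow: "pred_gen \<subseteq> Pow (space M \<times> ({0<..} \<times> UNIV))"
proof
  fix A assume "A \<in> pred_gen"
  then obtain s E D where A: "A = E \<times> D" "0 \<le> s" "E \<in> sets (G s)" "D \<subseteq> {s<..} \<times> UNIV"
    by (auto simp: pred_gen_def)
  have "E \<subseteq> space M" using sets.sets_into_space[OF A(3)] space_G[OF A(2)] by simp
  then show "A \<in> Pow (space M \<times> ({0<..} \<times> UNIV))" using A by fastforce
qed

lemma sets_pred: "sets pred = sigma_sets (space M \<times> ({0<..} \<times> UNIV)) pred_gen"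
  and space_pred: "space pred = space M \<times> ({0<..} \<times> UNIV)"
  using pred_gen_Pow by (auto simp: pred_def)

lemma pred_basic:
  "0 \<le> s \<Longrightarrow> E \<in> sets (G s) \<Longrightarrow> D \<in> sets borel \<Longrightarrow> D \<subseteq> {s<..} \<times> UNIV \<Longrightarrow> E \<times> D \<in> sets pred"
  unfolding sets_pred by (rule sigma_sets.Basic) (auto simp: pred_gen_def)

lemma Int_stable_pred_gen: "Int_stable pred_gen"
proof (rule Int_stableI)
  fix A B assume "A \<in> pred_gen" "B \<in> pred_gen"
  then obtain s E D s' E' D' where
    A: "A = E \<times> D" "0 \<le> s" "E \<in> sets (G s)" "D \<in> sets borel" "D \<subseteq> {s<..} \<times> UNIV" and
    B: "B = E' \<times> D'" "0 \<le> s'" "E' \<in> sets (G s')" "D' \<in> sets borel" "D' \<subseteq> {s'<..} \<times> UNIV"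
    unfolding pred_gen_def by blast
  let ?t = "max s s'"
  have "E \<in> sets (G ?t)" "E' \<in> sets (G ?t)"
    using A(2,3) B(2,3) G_mono[of s ?t] G_mono[of s' ?t] by auto
  moreover have "D \<inter> D' \<subseteq> {?t<..} \<times> UNIV" using A(5) B(5) by fastforce
  ultimately show "A \<inter> B \<in> pred_gen"
    unfolding pred_gen_def using A B
    by (intro CollectI exI[of _ ?t] exI[of _ "E \<inter> E'"] exI[of _ "D \<inter> D'"]) auto
qed

lemma sets_pred_subset: "A \<in> sets pred \<Longrightarrow> A \<in> sets (M \<Otimes>\<^sub>M (borel :: (real \<times> real) measure))"
proof -
  have "sigma_sets (space M \<times> ({0<..} \<times> UNIV)) pred_gen \<subseteq> sets (M \<Otimes>\<^sub>M (borel :: (real \<times> real) measure))"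
  proof (rule sets.sigma_sets_subset')
    show "space M \<times> ({0<..} \<times> UNIV) \<in> sets (M \<Otimes>\<^sub>M (borel :: (real \<times> real) measure))"
      by (intro pair_measureI) auto
    show "pred_gen \<subseteq> sets (M \<Otimes>\<^sub>M (borel :: (real \<times> real) measure))"
      unfolding pred_gen_def using sets_G_M by (auto intro!: pair_measureI)
  qed
  then show "A \<in> sets pred \<Longrightarrow> ?thesis" by (auto simp: sets_pred)
qed

lemma pred_section[measurable]: "A \<in> sets pred \<Longrightarrow> Pair \<omega> -` A \<in> sets borel"
  using sets_Pair1[OF sets_pred_subset] .

lemma pred_section_subset: "A \<in> sets pred \<Longrightarrow> Pair \<omega> -` A \<subseteq> {0<..} \<times> UNIV"
  using sets.sets_into_space[of A pred] by (auto simp: space_pred)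

text \<open>Induction over the predictable sets: a rectangle that has started by time u has its
  event in \<open>G u\<close>, and one that starts later contributes nothing. The window keeps
  masses finite, so that complements become differences.\<close>

lemma section_adapted_window:
  assumes A: "A \<in> sets pred" and u: "0 \<le> u"
  shows "(\<lambda>\<omega>. emeasure (q \<omega>) (Pair \<omega> -` A \<inter> ({0<..u} \<times> UNIV) \<inter> window K)) \<in> borel_measurable (G u)"
  using Int_stable_pred_gen pred_gen_Pow A[unfolded sets_pred]
proof (induction A rule: sigma_sets_induct_disjoint)
  case (basic A)
  then obtain s E D where A: "A = E \<times> D" "0 \<le> s" "E \<in> sets (G s)" "D \<in> sets borel" "D \<subseteq> {s<..} \<times> UNIV"
    unfolding pred_gen_def by blast
  show ?case
  proof (cases "s \<le> u")
    case True
    then have E[measurable]: "E \<in> sets (G u)" using A G_mono by blast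
    have [measurable]: "(\<lambda>\<omega>. emeasure (q \<omega>) (D \<inter> ({0<..u} \<times> UNIV) \<inter> window K)) \<in> borel_measurable (G u)"
      using A u by (intro adapted) auto
    have "(\<lambda>\<omega>. emeasure (q \<omega>) (Pair \<omega> -` A \<inter> ({0<..u} \<times> UNIV) \<inter> window K)) =
          (\<lambda>\<omega>. indicator E \<omega> * emeasure (q \<omega>) (D \<inter> ({0<..u} \<times> UNIV) \<inter> window K))"
      by (auto simp: A indicator_def)
    then show ?thesis by simp
  next
    case False
    then have "Pair \<omega> -` A \<inter> ({0<..u} \<times> UNIV) \<inter> window K = {}" for \<omega>
      using A by fastforce
    then show ?thesis by simp
  qed
next
  case (compl A)
  then have A: "A \<in> sets pred" by (simp add: sets_pred)
  let ?B = "({0<..u} \<times> UNIV) \<inter> window K"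
  have [measurable]: "?B \<in> sets borel" by auto
  have "emeasure (q \<omega>) (Pair \<omega> -` (space pred - A) \<inter> ({0<..u} \<times> UNIV) \<inter> window K) =
        emeasure (q \<omega>) ?B - emeasure (q \<omega>) (Pair \<omega> -` A \<inter> ({0<..u} \<times> UNIV) \<inter> window K)"
    if "\<omega> \<in> space (G u)" for \<omega>
  proof -
    have "Pair \<omega> -` (space pred - A) \<inter> ({0<..u} \<times> UNIV) \<inter> window K =
      ?B - (Pair \<omega> -` A \<inter> ({0<..u} \<times> UNIV) \<inter> window K)"
      using that u by (auto simp: space_pred space_G)
    moreover have "emeasure (q \<omega>) (Pair \<omega> -` A \<inter> ({0<..u} \<times> UNIV) \<inter> window K) \<noteq> \<infinity>"
      using q_window[of \<omega> K] A by (metis Int_lower2 window_borel emeasure_mono infinity_ennreal_def less_top neq_top_trans sets_q)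
    ultimately show ?thesis
      using A by (subst emeasure_Diff[symmetric]) (auto intro!: sets.Int)
  qed
  moreover have "(\<lambda>\<omega>. emeasure (q \<omega>) ?B) \<in> borel_measurable (G u)"
    using u by (intro adapted) auto
  ultimately show ?case
    using compl(2) unfolding space_pred[symmetric] by (subst measurable_cong) (assumption, rule borel_measurable_minus_ennreal)
next
  case (union A)
  then have A: "A i \<in> sets pred" for i by (auto simp: sets_pred)
  have "emeasure (q \<omega>) (Pair \<omega> -` (\<Union>i. A i) \<inter> ({0<..u} \<times> UNIV) \<inter> window K) =
     (\<Sum>i. emeasure (q \<omega>) (Pair \<omega> -` A i \<inter> ({0<..u} \<times> UNIV) \<inter> window K))" for \<omega>
    using A union(1)
    by (subst suminf_emeasure) (auto simp: disjoint_family_on_def intro!: arg_cong[where f="emeasure (q \<omega>)"] sets.Int)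
  then show ?case using union(3) by simp
qed auto

lemma section_adapted:
  assumes A: "A \<in> sets pred" and u: "0 \<le> u"
  shows "(\<lambda>\<omega>. emeasure (q \<omega>) (Pair \<omega> -` A \<inter> ({0<..u} \<times> UNIV))) \<in> borel_measurable (G u)"
proof -
  have "emeasure (q \<omega>) (Pair \<omega> -` A \<inter> ({0<..u} \<times> UNIV)) =
     (SUP K. emeasure (q \<omega>) (Pair \<omega> -` A \<inter> ({0<..u} \<times> UNIV) \<inter> window K))" for \<omega>
    using A by (intro emeasure_eq_SUP_window) auto
  then show ?thesis using section_adapted_window[OF A u] by simp
qed

lemma section_measurable_window:
  assumes A: "A \<in> sets pred"
  shows "(\<lambda>\<omega>. emeasure (q \<omega>) (Pair \<omega> -` A \<inter> window K)) \<in> borel_measurable M"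
proof -
  have "Pair \<omega> -` A \<inter> ({0<..real K} \<times> UNIV) \<inter> window K = Pair \<omega> -` A \<inter> window K" for \<omega>
    by (auto simp: window_def)
  then show ?thesis
    using measurable_from_subalg[OF subalg section_adapted_window[OF A, of "real K" K]] by simp
qed

lemma section_measurable:
  assumes A: "A \<in> sets pred"
  shows "(\<lambda>\<omega>. emeasure (q \<omega>) (Pair \<omega> -` A)) \<in> borel_measurable M"
proof -
  have "emeasure (q \<omega>) (Pair \<omega> -` A) = (SUP K. emeasure (q \<omega>) (Pair \<omega> -` A \<inter> window K))" for \<omega>
    using A pred_section_subset by (intro emeasure_eq_SUP_window) auto
  then show ?thesis using section_measurable_window[OF A] by simp
qed

section \<open>Campbell's formula\<close>

lemma lborel_section_measurable:
  assumes A: "A \<in> sets pred"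
  shows "(\<lambda>\<omega>. emeasure lborel (Pair \<omega> -` A \<inter> window K)) \<in> borel_measurable M"
proof -
  have "A \<inter> (space M \<times> window K) \<in> sets (M \<Otimes>\<^sub>M lborel)"
    using sets_pred_subset[OF A] by (intro sets.Int) (auto cong: sets_pair_measure_cong)
  from lborel.measurable_emeasure_Pair[OF this]
  have "(\<lambda>\<omega>. emeasure lborel (Pair \<omega> -` (A \<inter> (space M \<times> window K)))) \<in> borel_measurable M" .
  then show ?thesis by (rule measurable_cong[THEN iffD1, rotated]) (auto intro!: arg_cong[where f="emeasure lborel"])
qed

text \<open>For a rectangle this is the assumption \<open>intensity\<close>. Complements and
  disjoint unions preserve the equality, because both sides are countably additive and finite on a
  window.\<close>

lemma campbell_window:
  assumes A: "A \<in> sets pred"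
  shows "(\<integral>\<^sup>+\<omega>. emeasure (q \<omega>) (Pair \<omega> -` A \<inter> window K) \<partial>M) = (\<integral>\<^sup>+\<omega>. emeasure lborel (Pair \<omega> -` A \<inter> window K) \<partial>M)"
  using Int_stable_pred_gen pred_gen_Pow A[unfolded sets_pred]
proof (induction A rule: sigma_sets_induct_disjoint)
  case (basic A)
  then obtain s E D where A: "A = E \<times> D" "0 \<le> s" "E \<in> sets (G s)" "D \<in> sets borel" "D \<subseteq> {s<..} \<times> UNIV"
    unfolding pred_gen_def by blast
  have 1: "emeasure m (Pair \<omega> -` A \<inter> window K) = indicator E \<omega> * emeasure m (D \<inter> window K)" for \<omega> and m :: "(real \<times> real) measure"
    by (auto simp: A indicator_def)
  have "emeasure lborel (D \<inter> window K) < \<infinity>"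
    by (rule order.strict_trans1[OF emeasure_mono emeasure_lborel_window]) auto
  moreover have "E \<in> sets M" using A sets_G_M by blast
  ultimately show ?case unfolding 1 using A
    by (subst intensity[of s]) (auto simp: nn_integral_multc)
next
  case (compl A)
  then have A: "A \<in> sets pred" by (simp add: sets_pred)
  have eq: "emeasure m (Pair \<omega> -` (space pred - A) \<inter> window K) = emeasure m (window K) - emeasure m (Pair \<omega> -` A \<inter> window K)"
    and fin: "emeasure m (Pair \<omega> -` A \<inter> window K) \<le> emeasure m (window K)"
    if "\<omega> \<in> space M" "sets m = sets borel" "emeasure m (window K) < \<infinity>" for \<omega> m
  proof -
    have "Pair \<omega> -` (space pred - A) \<inter> window K = window K - (Pair \<omega> -` A \<inter> window K)"
      using that by (auto simp: space_pred window_def)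
    moreover show "emeasure m (Pair \<omega> -` A \<inter> window K) \<le> emeasure m (window K)"
      using that by (intro emeasure_mono) auto
    ultimately show "emeasure m (Pair \<omega> -` (space pred - A) \<inter> window K) = emeasure m (window K) - emeasure m (Pair \<omega> -` A \<inter> window K)"
      using A that by (subst emeasure_Diff[symmetric]) (auto intro!: sets.Int simp: less_top[symmetric] top_unique)
  qed
  have box_meas: "(\<lambda>\<omega>. emeasure (q \<omega>) (window K)) \<in> borel_measurable M"
    by (rule measurable_from_subalg[OF subalg[of "real K"] adapted]) (auto simp: window_def[symmetric], auto simp: window_def)
  have box_int: "(\<integral>\<^sup>+\<omega>. emeasure (q \<omega>) (window K) \<partial>M) = emeasure lborel (window K)"
  proof -
    have "(\<integral>\<^sup>+\<omega>. emeasure (q \<omega>) (window K) \<partial>M) = (\<integral>\<^sup>+\<omega>. indicator (space M) \<omega> * emeasure (q \<omega>) (window K) \<partial>M)"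
      by (intro nn_integral_cong) auto
    also have "\<dots> = emeasure M (space M) * emeasure lborel (window K)"
      using emeasure_lborel_window space_G[of 0] sets.top[of "G 0"] by (intro intensity[of 0]) (auto, auto simp: window_def)
    finally show ?thesis by (simp add: emeasure_space_1)
  qed
  \<comment> \<open>Integrals may be subtracted only if the subtrahend is finite; here its mean is
    at most the area of the window.\<close>
  have fin2: "(\<integral>\<^sup>+\<omega>. emeasure (q \<omega>) (Pair \<omega> -` A \<inter> window K) \<partial>M) \<noteq> \<infinity>"
  proof -
    have "(\<integral>\<^sup>+\<omega>. emeasure (q \<omega>) (Pair \<omega> -` A \<inter> window K) \<partial>M) \<le> (\<integral>\<^sup>+\<omega>. emeasure (q \<omega>) (window K) \<partial>M)"
      using fin q_window by (intro nn_integral_mono) auto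
    then show ?thesis using box_int emeasure_lborel_window[of K] by (auto simp: top_unique)
  qed
  have "(\<integral>\<^sup>+\<omega>. emeasure (q \<omega>) (Pair \<omega> -` (space pred - A) \<inter> window K) \<partial>M) =
    (\<integral>\<^sup>+\<omega>. emeasure (q \<omega>) (window K) - emeasure (q \<omega>) (Pair \<omega> -` A \<inter> window K) \<partial>M)"
    using q_window by (intro nn_integral_cong eq) auto
  also have "\<dots> = (\<integral>\<^sup>+\<omega>. emeasure (q \<omega>) (window K) \<partial>M) - (\<integral>\<^sup>+\<omega>. emeasure (q \<omega>) (Pair \<omega> -` A \<inter> window K) \<partial>M)"
    using q_window fin fin2 by (intro nn_integral_diff box_meas section_measurable_window[OF A] AE_I2) auto
  also have "\<dots> = (\<integral>\<^sup>+\<omega>. emeasure lborel (window K) \<partial>M) - (\<integral>\<^sup>+\<omega>. emeasure lborel (Pair \<omega> -` A \<inter> window K) \<partial>M)"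
    using compl(2) by (simp add: box_int emeasure_space_1)
  also have "\<dots> = (\<integral>\<^sup>+\<omega>. emeasure lborel (window K) - emeasure lborel (Pair \<omega> -` A \<inter> window K) \<partial>M)"
    using emeasure_lborel_window[of K] fin fin2 compl(2)
    by (intro nn_integral_diff[symmetric] lborel_section_measurable[OF A] AE_I2) auto
  also have "\<dots> = (\<integral>\<^sup>+\<omega>. emeasure lborel (Pair \<omega> -` (space pred - A) \<inter> window K) \<partial>M)"
    using emeasure_lborel_window[of K] by (intro nn_integral_cong eq[symmetric]) auto
  finally show ?case by (simp only: space_pred)
next
  case (union A)
  then have A: "A i \<in> sets pred" for i by (auto simp: sets_pred)
  have eq: "emeasure m (Pair \<omega> -` (\<Union>i. A i) \<inter> window K) = (\<Sum>i. emeasure m (Pair \<omega> -` A i \<inter> window K))"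
    if "sets m = sets borel" for \<omega> m
    using A union(1) that
    by (subst suminf_emeasure) (auto simp: disjoint_family_on_def intro!: arg_cong[where f="emeasure m"] sets.Int)
  show ?case
    using union(3) by (simp add: eq nn_integral_suminf section_measurable_window lborel_section_measurable A)
qed auto

text \<open>Monotone convergence removes the windows. No finiteness is left in the statement, so it
  applies to regions of infinite area.\<close>

theorem campbell:
  assumes A: "A \<in> sets pred"
  shows "(\<integral>\<^sup>+\<omega>. emeasure (q \<omega>) (Pair \<omega> -` A) \<partial>M) = (\<integral>\<^sup>+\<omega>. emeasure lborel (Pair \<omega> -` A) \<partial>M)"
proof -
  have SUP: "emeasure m (Pair \<omega> -` A) = (SUP K. emeasure m (Pair \<omega> -` A \<inter> window K))"
    if "sets m = sets borel" for \<omega> m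
    using A pred_section_subset that by (intro emeasure_eq_SUP_window) auto
  have inc: "incseq (\<lambda>K \<omega>. emeasure m (Pair \<omega> -` A \<inter> window K))" if "sets m = sets borel" for m :: "(real \<times> real) measure"
    using incseq_window that A by (auto simp: incseq_def le_fun_def intro!: emeasure_mono)
  have inc': "incseq (\<lambda>K \<omega>. emeasure (q \<omega>) (Pair \<omega> -` A \<inter> window K))"
    using incseq_window A by (auto simp: incseq_def le_fun_def intro!: emeasure_mono)
  show ?thesis
    using inc[of lborel] inc'
    by (simp add: SUP nn_integral_monotone_convergence_SUP section_measurable_window lborel_section_measurable A campbell_window)
qed

text \<open>The open stochastic interval after a stopping time: a rational r between
  \<open>b \<omega>\<close> and u puts the point into a rectangle whose event is known at time r.
  Only the restriction of \<open>b\<close> to \<open>E\<close> has to behave like a stopping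
  time.\<close>

lemma pred_left_open:
  assumes E: "\<And>r. 0 \<le> r \<Longrightarrow> {\<omega>\<in>E. b \<omega> \<le> r} \<in> sets (G r)"
  shows "{(\<omega>, u, v :: real). \<omega> \<in> E \<and> b \<omega> < u \<and> 0 < u} \<in> sets pred"
proof -
  let ?S = "\<lambda>r. {\<omega>\<in>E. b \<omega> \<le> r} \<times> ({r<..} \<times> (UNIV :: real set))"
  have "{(\<omega>, u, v :: real). \<omega> \<in> E \<and> b \<omega> < u \<and> 0 < u} = (\<Union>r\<in>{r\<in>\<rat>. 0 \<le> r}. ?S r)"
  proof (intro set_eqI iffI)
    fix x assume "x \<in> {(\<omega>, u, v :: real). \<omega> \<in> E \<and> b \<omega> < u \<and> 0 < u}"
    then obtain \<omega> u v where x: "x = (\<omega>, u, v)" "\<omega> \<in> E" "max 0 (b \<omega>) < u" by auto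
    from Rats_dense_in_real[OF x(3)] obtain r where "r \<in> \<rat>" "max 0 (b \<omega>) < r" "r < u" by blast
    with x show "x \<in> (\<Union>r\<in>{r\<in>\<rat>. 0 \<le> r}. ?S r)" by auto
  qed auto
  also have "\<dots> \<in> sets pred"
  proof (rule sets.countable_UN'')
    show "countable {r\<in>\<rat>. 0 \<le> (r::real)}" using countable_rat by (rule countable_subset[rotated]) auto
  qed (auto intro!: pred_basic E)
  finally show ?thesis .
qed

text \<open>The complement is a countable union of rectangles: an atom strictly before u has been
  seen by some rational time before u. The interval is open at u because a predictable set may use
  only the strict past.\<close>

lemma pred_no_points_before:
  assumes A: "A \<in> sets pred"
  shows "{(\<omega>, u, v). \<omega> \<in> space M \<and> 0 < u \<and> emeasure (q \<omega>) (Pair \<omega> -` A \<inter> ({0<..<u} \<times> UNIV)) = 0} \<in> sets pred"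
    (is "?L \<in> _")
proof -
  let ?E = "\<lambda>r. {\<omega>\<in>space M. emeasure (q \<omega>) (Pair \<omega> -` A \<inter> ({0<..r} \<times> UNIV)) \<noteq> 0}"
  have "?E r \<in> sets (G r)" if "0 \<le> r" for r
    using measurable_sets[OF section_adapted[OF A that], of "- {0}"] space_G[OF that]
    by (simp add: vimage_def Int_def conj_commute)
  then have *: "(\<Union>r\<in>{r\<in>\<rat>. 0 \<le> r}. ?E r \<times> ({r<..} \<times> (UNIV :: real set))) \<in> sets pred" (is "?U \<in> _")
    using countable_rat by (intro sets.countable_UN'' pred_basic) (auto intro: countable_subset)
  have "?L = space pred - ?U"
  proof (intro set_eqI iffI)
    fix x assume x: "x \<in> ?L"
    then obtain \<omega> u v where x': "x = (\<omega>, u, v)" "0 < u" "\<omega> \<in> space M" "emeasure (q \<omega>) (Pair \<omega> -` A \<inter> ({0<..<u} \<times> UNIV)) = 0"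
      by auto
    have "emeasure (q \<omega>) (Pair \<omega> -` A \<inter> ({0<..r} \<times> UNIV)) = 0" if "r < u" for r
    proof -
      have "emeasure (q \<omega>) (Pair \<omega> -` A \<inter> ({0<..r} \<times> UNIV)) \<le> emeasure (q \<omega>) (Pair \<omega> -` A \<inter> ({0<..<u} \<times> UNIV))"
        using that A by (intro emeasure_mono) auto
      then show ?thesis using x' by simp
    qed
    then show "x \<in> space pred - ?U" using x' by (auto simp: space_pred)
  next
    fix x assume x: "x \<in> space pred - ?U"
    then obtain \<omega> u v where x': "x = (\<omega>, u, v)" "0 < u" "\<omega> \<in> space M" by (auto simp: space_pred)
    have 0: "emeasure (q \<omega>) (Pair \<omega> -` A \<inter> ({0<..r} \<times> UNIV)) = 0" if "r \<in> \<rat>" "0 \<le> r" "r < u" for r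
      using x x' that by auto
    have "Pair \<omega> -` A \<inter> ({0<..<u} \<times> UNIV) \<subseteq> (\<Union>r\<in>{r\<in>\<rat>. 0 \<le> r \<and> r < u}. Pair \<omega> -` A \<inter> ({0<..r} \<times> UNIV))"
    proof
      fix z assume "z \<in> Pair \<omega> -` A \<inter> ({0<..<u} \<times> UNIV)"
      then obtain w y where z: "z = (w, y)" "(\<omega>, w, y) \<in> A" "0 < w" "w < u" by auto
      from Rats_dense_in_real[OF z(4)] obtain r where "r \<in> \<rat>" "w < r" "r < u" by blast
      with z show "z \<in> (\<Union>r\<in>{r\<in>\<rat>. 0 \<le> r \<and> r < u}. Pair \<omega> -` A \<inter> ({0<..r} \<times> UNIV))"
        by (auto intro!: bexI[of _ r])
    qed
    moreover have "(\<Union>r\<in>{r\<in>\<rat>. 0 \<le> r \<and> r < u}. Pair \<omega> -` A \<inter> ({0<..r} \<times> UNIV)) \<in> null_sets (q \<omega>)"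
    proof (rule null_sets_UN')
      show "countable {r\<in>\<rat>. 0 \<le> r \<and> r < u}" using countable_rat by (rule countable_subset[rotated]) auto
      show "Pair \<omega> -` A \<inter> ({0<..r} \<times> UNIV) \<in> null_sets (q \<omega>)" if "r \<in> {r\<in>\<rat>. 0 \<le> r \<and> r < u}" for r
        using 0[of r] that A by (auto simp: null_sets_def)
    qed
    ultimately have "emeasure (q \<omega>) (Pair \<omega> -` A \<inter> ({0<..<u} \<times> UNIV)) = 0"
      using A emeasure_mono[of _ _ "q \<omega>"] by (metis (no_types, lifting) null_setsD1 null_setsD2 le_zero_eq)
    then show "x \<in> ?L" using x' by auto
  qed
  with * show ?thesis by auto
qed

end

section \<open>Transition rates\<close>

text \<open>\<open>Lam_defined\<close> asks for summability at every age: \<open>lamt_le\<close>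
  controls the rates only at almost every age, and a divergent infinite sum has the value 0 by
  convention, which could destroy the order of the intervals.\<close>

locale transition_rates =
  fixes r :: "(nat \<times> nat) set" and lam lamt :: rates
  assumes order: "strict_linear_order_on states r"
    and lam_meas: "\<And>i j. (i, j) \<in> state_pairs \<Longrightarrow>
        (\<lambda>(y, n). lam i j y n) \<in> borel_measurable age_count_measure"
    and lam_nonneg: "\<And>i j y n. (i, j) \<in> state_pairs \<Longrightarrow> 0 \<le> y \<Longrightarrow> 0 \<le> lam i j y n"
    and A1: "(SUP i\<in>states. rate_bound lam i) < \<infinity>"
    and A2: "\<And>i n. i \<in> states \<Longrightarrow> ((\<lambda>y. cumulative_rate lam i y n) \<longlongrightarrow> \<infinity>) at_top"
    and lamt_meas: "\<And>i j. (i, j) \<in> state_pairs \<Longrightarrow>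
        (\<lambda>(y, n). lamt i j y n) \<in> borel_measurable age_count_measure"
    and lam_le_lamt: "\<And>i j y n. (i, j) \<in> state_pairs \<Longrightarrow> 0 \<le> y \<Longrightarrow> lam i j y n \<le> lamt i j y n"
    and lamt_le: "\<And>i j. (i, j) \<in> state_pairs \<Longrightarrow>
        AE (y, n) in age_count_measure. ennreal (lamt i j y n) \<le> Linf_norm (lam i j)"
    and Lam_defined: "\<And>i j y n. (i, j) \<in> state_pairs \<Longrightarrow> 0 \<le> y \<Longrightarrow>
        (\<lambda>(i', j'). lamt i' j' y n) summable_on pairs_before r i j"
begin

abbreviation "\<Lambda> \<equiv> Lam r lam lamt"

definition base :: "nat \<Rightarrow> nat \<Rightarrow> real \<Rightarrow> nat \<Rightarrow> real" where
  "base i j y n = (\<Sum>\<^sub>\<infinity>(i', j')\<in>pairs_before r i j. lamt i' j' y n)"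

definition rate_sup :: real where
  "rate_sup = enn2real (SUP i\<in>states. rate_bound lam i)"

section \<open>Geometry of the intervals\<close>

lemma mem_Lam_iff: "v \<in> \<Lambda> i j y n \<longleftrightarrow> base i j y n \<le> v \<and> v < base i j y n + lam i j y n"
proof -
  have "\<Lambda> i j y n = {base i j y n..<base i j y n + lam i j y n}"
    unfolding Lam_def base_def image_add_atLeastLessThan by (simp add: add.commute)
  then show ?thesis by simp
qed

lemma lamt_nonneg: "(i, j) \<in> state_pairs \<Longrightarrow> 0 \<le> y \<Longrightarrow> 0 \<le> lamt i j y n"
  using lam_nonneg lam_le_lamt order_trans by blast

text \<open>Rates are meaningful only at nonnegative ages; extended by 0 they become Borel functions
  on the whole line, to which the usual substitution rules apply.\<close>

lemma age_section_measurable: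
  assumes "(\<lambda>(y, n). f y n) \<in> borel_measurable age_count_measure"
  shows "(\<lambda>y. if 0 \<le> y then f y n else (0 :: real)) \<in> borel_measurable borel"
proof -
  have "(\<lambda>y. (y, n)) \<in> measurable (restrict_space lborel {0..}) age_count_measure"
    unfolding age_count_measure_def by measurable
  from measurable_compose[OF this assms]
  have "(\<lambda>y. f y n) \<in> borel_measurable (restrict_space borel {0..})"
    by (simp cong: measurable_cong_sets sets_restrict_space_cong)
  then have "(\<lambda>y. f y n * indicator {0..} y) \<in> borel_measurable borel"
    by (subst (asm) borel_measurable_restrict_space_iff) (simp_all add: mult.commute)
  moreover have "(\<lambda>y. if 0 \<le> y then f y n else 0) = (\<lambda>y. f y n * indicator {0..} y)" by auto
  ultimately show ?thesis by simp
qed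

lemma lam_borel: "(i, j) \<in> state_pairs \<Longrightarrow> (\<lambda>y. if 0 \<le> y then lam i j y n else 0) \<in> borel_measurable borel"
  by (rule age_section_measurable[OF lam_meas])

lemma base_borel:
  assumes ij: "(i, j) \<in> state_pairs"
  shows "(\<lambda>y. if 0 \<le> y then base i j y n else 0) \<in> borel_measurable borel"
proof -
  let ?f = "\<lambda>k y. case prod_decode k of (i', j') \<Rightarrow> if prod_decode k \<in> pairs_before r i j then if 0 \<le> y then lamt i' j' y n else 0 else 0"
  have eq: "(if 0 \<le> y then base i j y n else 0) = (\<Sum>k. ?f k y)" for y
  proof (cases "0 \<le> y")
    case True
    then show ?thesis
      by (simp add: base_def infsum_pair_eq_suminf[OF Lam_defined[OF ij True]] case_prod_beta cong: if_cong)
  next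
    case False
    then show ?thesis by (simp add: case_prod_beta cong: if_cong)
  qed
  have "?f k \<in> borel_measurable borel" for k
  proof (cases "prod_decode k \<in> pairs_before r i j")
    case True
    obtain i' j' where k: "prod_decode k = (i', j')" by fastforce
    with True have "(i', j') \<in> state_pairs" by (auto simp: pairs_before_def)
    from age_section_measurable[OF lamt_meas[OF this]] True show ?thesis by (simp add: k)
  qed (simp add: split_beta)
  then show ?thesis unfolding eq by (rule borel_measurable_suminf)
qed

lemma cell_borel:
  assumes ij: "(i, j) \<in> state_pairs"
  shows "{(y, v). 0 \<le> y \<and> v \<in> \<Lambda> i j y n} \<in> sets borel"
proof -
  define b where "b = (\<lambda>y. if 0 \<le> y then base i j y n else 0)"
  define l where "l = (\<lambda>y. if 0 \<le> y then lam i j y n else 0)"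
  have [measurable]: "b \<in> borel_measurable borel" "l \<in> borel_measurable borel"
    unfolding b_def l_def by (rule base_borel[OF ij], rule lam_borel[OF ij])
  have "{x \<in> space (borel \<Otimes>\<^sub>M borel). 0 \<le> fst x \<and> b (fst x) \<le> snd x \<and> snd x < b (fst x) + l (fst x)} \<in> sets (borel \<Otimes>\<^sub>M borel)"
    by measurable
  also have "{x \<in> space (borel \<Otimes>\<^sub>M borel). 0 \<le> fst x \<and> b (fst x) \<le> snd x \<and> snd x < b (fst x) + l (fst x)}
     = {(y, v). 0 \<le> y \<and> v \<in> \<Lambda> i j y n}"
    by (auto simp: mem_Lam_iff b_def l_def space_pair_measure)
  finally show ?thesis unfolding borel_prod[symmetric] .
qed

lemma emeasure_Lam: "(i, j) \<in> state_pairs \<Longrightarrow> 0 \<le> y \<Longrightarrow> emeasure lborel (\<Lambda> i j y n) = ennreal (lam i j y n)"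
proof -
  assume "(i, j) \<in> state_pairs" "0 \<le> y"
  moreover have "\<Lambda> i j y n = {base i j y n..<base i j y n + lam i j y n}" by (auto simp: mem_Lam_iff)
  ultimately show ?thesis using lam_nonneg by simp
qed

lemma Lam_borel: "\<Lambda> i j y n \<in> sets borel"
proof -
  have "\<Lambda> i j y n = {base i j y n..<base i j y n + lam i j y n}" by (auto simp: mem_Lam_iff)
  then show ?thesis by simp
qed

text \<open>The left end of the later interval sums \<open>lamt\<close> over all preceding pairs. By
  transitivity these include (i, j') and everything before it, so the sum is at least
  \<open>base i j'\<close> plus \<open>lamt i j'\<close>, and the latter dominates the length
  \<open>lam i j'\<close>.\<close>

lemma Lam_ordered:
  assumes ij: "(i, j) \<in> state_pairs" "(i, j') \<in> state_pairs" and jj: "(j', j) \<in> r" and y: "0 \<le> y"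
  shows "base i j' y n + lam i j' y n \<le> base i j y n"
proof -
  have "trans r" "irrefl r" using order by (auto simp: strict_linear_order_on_def)
  let ?f = "\<lambda>(i', j'). lamt i' j' y n" and ?B = "insert (i, j') (pairs_before r i j')"
  have nin: "(i, j') \<notin> pairs_before r i j'" using \<open>irrefl r\<close> by (auto simp: pairs_before_def irrefl_def)
  have sum': "?f summable_on ?B" by (rule summable_on_insert_iff[THEN iffD2, OF Lam_defined[OF ij(2) y]])
  have "base i j' y n + lamt i j' y n = infsum ?f ?B"
    using infsum_insert[OF Lam_defined[OF ij(2) y] nin] by (simp add: base_def add.commute)
  also have "\<dots> \<le> base i j y n"
    unfolding base_def
  proof (rule infsum_mono_neutral[OF sum' Lam_defined[OF ij(1) y]])
    have "?B \<subseteq> pairs_before r i j"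
      using \<open>trans r\<close> jj ij by (auto simp: pairs_before_def dest: transD)
    then show "?f x \<le> 0" if "x \<in> ?B - pairs_before r i j" for x using that by blast
    show "0 \<le> ?f x" if "x \<in> pairs_before r i j - ?B" for x
      using that lamt_nonneg y by (cases x) (auto simp: pairs_before_def)
  qed auto
  finally show ?thesis using lam_le_lamt[OF ij(2) y, of n] by simp
qed

lemma Lam_disjoint:
  assumes ij: "(i, j) \<in> state_pairs" "(i, j') \<in> state_pairs" and y: "0 \<le> y"
    and v: "v \<in> \<Lambda> i j y n" "v \<in> \<Lambda> i j' y n"
  shows "j = j'"
proof (rule ccontr)
  assume "j \<noteq> j'"
  moreover have "total_on states r" using order by (auto simp: strict_linear_order_on_def)
  ultimately have "(j', j) \<in> r \<or> (j, j') \<in> r"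
    using ij by (auto simp: state_pairs_def total_on_def)
  then show False
    using v Lam_ordered[OF ij(1,2) _ y, of n] Lam_ordered[OF ij(2,1) _ y, of n] by (auto simp: mem_Lam_iff)
qed

lemma state_pairsI: "i \<in> states \<Longrightarrow> j \<in> states - {i} \<Longrightarrow> (i, j) \<in> state_pairs"
  by (auto simp: state_pairs_def)

text \<open>At most one summand is nonzero, because intervals with the same first index are
  disjoint.\<close>

lemma infsum_Lam:
  fixes c :: "nat \<Rightarrow> real"
  assumes i: "i \<in> states" and y: "0 \<le> y" and j: "j \<in> states - {i}" and v: "v \<in> \<Lambda> i j y n"
  shows "(\<Sum>\<^sub>\<infinity>j\<in>states - {i}. c j * indicator (\<Lambda> i j y n) v) = c j"
proof -
  have "(\<Sum>\<^sub>\<infinity>j\<in>states - {i}. c j * indicator (\<Lambda> i j y n) v) = (\<Sum>\<^sub>\<infinity>j\<in>{j}. c j * indicator (\<Lambda> i j y n) v)"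
  proof (intro infsum_cong_neutral)
    fix k assume k: "k \<in> states - {i} - {j}"
    then have "v \<notin> \<Lambda> i k y n"
      using Lam_disjoint[OF state_pairsI[OF i, of k] state_pairsI[OF i j] y _ v] by blast
    then show "c k * indicator (\<Lambda> i k y n) v = 0" by simp
  qed (use j in auto)
  then show ?thesis using v by simp
qed

lemma gLam_eq:
  assumes "i \<in> states" "0 \<le> y"
  shows "gLam r lam lamt i y n v = (if \<exists>j\<in>states - {i}. v \<in> \<Lambda> i j y n then 1 else 0)"
proof (cases "\<exists>j\<in>states - {i}. v \<in> \<Lambda> i j y n")
  case True
  then obtain j where "j \<in> states - {i}" "v \<in> \<Lambda> i j y n" by blast
  from infsum_Lam[OF assms this, of "\<lambda>_. 1"] True show ?thesis by (simp add: gLam_def)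
next
  case False
  have "gLam r lam lamt i y n v = 0"
    unfolding gLam_def by (rule infsum_0) (use False in \<open>simp add: indicator_def\<close>)
  with False show ?thesis by simp
qed

lemma hLam_eq:
  assumes "i \<in> states" "0 \<le> y" "j \<in> states - {i}" "v \<in> \<Lambda> i j y n"
  shows "hLam r lam lamt i y n v = real j - real i"
  unfolding hLam_def using infsum_Lam[OF assms] .

lemma hLam_eq_0: "\<not> (\<exists>j\<in>states - {i}. v \<in> \<Lambda> i j y n) \<Longrightarrow> hLam r lam lamt i y n v = 0"
  unfolding hLam_def by (rule infsum_0) auto

lemma gLam_nonneg: "0 \<le> gLam r lam lamt i y n v"
  unfolding gLam_def by (rule infsum_nonneg) auto

definition exit_set :: "nat \<Rightarrow> real \<Rightarrow> nat \<Rightarrow> real set" where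
  "exit_set i y n = (\<Union>j\<in>states - {i}. \<Lambda> i j y n)"

lemma emeasure_exit_set:
  assumes "i \<in> states" "0 \<le> y"
  shows "emeasure lborel (exit_set i y n) = total_rate lam i y n"
proof -
  let ?A = "\<lambda>j. if j \<in> states - {i} then \<Lambda> i j y n else {}"
  have "emeasure lborel (exit_set i y n) = emeasure lborel (\<Union>j. ?A j)"
    by (auto simp: exit_set_def intro!: arg_cong[where f="emeasure lborel"] split: if_splits)
  also have "\<dots> = (\<Sum>j. emeasure lborel (?A j))"
  proof (intro suminf_emeasure[symmetric])
    show "disjoint_family ?A"
      unfolding disjoint_family_on_def
    proof (intro ballI impI equals0I)
      fix j k v assume jk: "j \<noteq> k" and v: "v \<in> ?A j \<inter> ?A k"
      then have "j \<in> states - {i}" "k \<in> states - {i}" "v \<in> \<Lambda> i j y n" "v \<in> \<Lambda> i k y n"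
        by (auto split: if_splits)
      with Lam_disjoint[OF state_pairsI[OF assms(1)] state_pairsI[OF assms(1)] assms(2)] jk show False by blast
    qed
  qed (use Lam_borel in auto)
  also have "\<dots> = total_rate lam i y n"
    unfolding total_rate_def infsum_nat_eq_suminf
    by (intro suminf_cong) (use assms emeasure_Lam[OF state_pairsI[OF assms(1)] assms(2)] in simp)
  finally show ?thesis .
qed

section \<open>Bounds and divergence of the total rate\<close>

lemma total_rate_borel:
  assumes "i \<in> states"
  shows "(\<lambda>y. if 0 \<le> y then total_rate lam i y n else 0) \<in> borel_measurable borel"
proof -
  have eq: "(if 0 \<le> y then total_rate lam i y n else 0) =
    (\<Sum>j. if j \<in> states - {i} then ennreal (if 0 \<le> y then lam i j y n else 0) else 0)" for y
    unfolding total_rate_def infsum_nat_eq_suminf by (cases "0 \<le> y") (simp_all cong: if_cong)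
  have "(\<lambda>y. if j \<in> states - {i} then ennreal (if 0 \<le> y then lam i j y n else 0) else 0) \<in> borel_measurable borel" for j
    using lam_borel[OF state_pairsI[OF assms], of j n] by (cases "j \<in> states - {i}") auto
  then show ?thesis unfolding eq by measurable
qed

text \<open>The bound passes through \<open>lamt\<close>, which almost everywhere is at most the
  essential supremum of \<open>lam\<close>. A null set for the product with counting measure has a
  null section for every n, and the countably many targets j share one exceptional set of
  ages.\<close>

lemma total_rate_le:
  assumes i: "i \<in> states"
  shows "AE y in lborel. 0 \<le> y \<longrightarrow> total_rate lam i y n \<le> ennreal rate_sup"
proof -
  have sf: "sigma_finite_measure (restrict_space lborel {0 :: real..})"
    by (rule sigma_finite_measure_restrict_space) (auto intro: lborel.sigma_finite_measure_axioms)
  interpret pair_sigma_finite "restrict_space lborel {0 :: real..}" "count_space (UNIV :: nat set)"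
    using sf by (intro pair_sigma_finite.intro sigma_finite_measure_count_space)
  have 1: "AE y in lborel. 0 \<le> y \<longrightarrow> ennreal (lam i j y n) \<le> Linf_norm (lam i j)" if j: "j \<in> states - {i}" for j
  proof -
    note ij = state_pairsI[OF i j]
    from AE_pair[OF lamt_le[OF ij, unfolded age_count_measure_def]]
    have "AE y in lborel. 0 \<le> y \<longrightarrow> (AE n in count_space UNIV. ennreal (lamt i j y n) \<le> Linf_norm (lam i j))"
      by (subst (asm) AE_restrict_space_iff) auto
    then show ?thesis
    proof eventually_elim
      case (elim y)
      show ?case
      proof
        assume "0 \<le> y"
        then have "ennreal (lamt i j y n) \<le> Linf_norm (lam i j)" using elim by (simp add: AE_count_space)
        then show "ennreal (lam i j y n) \<le> Linf_norm (lam i j)"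
          using lam_le_lamt[OF ij \<open>0 \<le> y\<close>, of n] by (meson ennreal_leI order_trans)
      qed
    qed
  qed
  have "AE y in lborel. \<forall>j\<in>states - {i}. 0 \<le> y \<longrightarrow> ennreal (lam i j y n) \<le> Linf_norm (lam i j)"
    using 1 by (subst AE_ball_countable) auto
  then show ?thesis
  proof eventually_elim
    case (elim y)
    show ?case
    proof
      assume "0 \<le> y"
      then have "total_rate lam i y n \<le> rate_bound lam i"
        unfolding total_rate_def rate_bound_def using elim
        by (intro infsum_mono nonneg_summable_on_complete) auto
      also have "\<dots> \<le> (SUP i\<in>states. rate_bound lam i)" using i by (rule SUP_upper)
      also have "\<dots> = ennreal rate_sup" using A1 by (simp add: rate_sup_def)
      finally show "total_rate lam i y n \<le> ennreal rate_sup" .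
    qed
  qed
qed

text \<open>Removing the ages up to a costs only a finite amount, since the rate is essentially
  bounded. The divergence demanded by \<open>A2\<close> thus survives for a sojourn that starts at
  age a.\<close>

lemma total_rate_integral_infinite:
  assumes i: "i \<in> states" and a: "0 \<le> a"
  shows "(\<integral>\<^sup>+y\<in>{a<..}. total_rate lam i y n \<partial>lborel) = \<infinity>"
proof -
  let ?f = "\<lambda>y. if 0 \<le> y then total_rate lam i y n else 0"
  note [measurable] = total_rate_borel[OF i, of n]
  have "(\<integral>\<^sup>+y\<in>{0..a}. total_rate lam i y n \<partial>lborel) \<le> (\<integral>\<^sup>+y\<in>{0..a}. ennreal rate_sup \<partial>lborel)"
    using total_rate_le[OF i, of n] by (intro nn_integral_mono_AE) (auto simp: indicator_def)
  also have "\<dots> < \<infinity>" using a by (simp add: nn_integral_cmult_indicator ennreal_mult_less_top)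
  finally have fin: "(\<integral>\<^sup>+y\<in>{0..a}. total_rate lam i y n \<partial>lborel) < \<infinity>" .
  let ?R = "(\<integral>\<^sup>+y\<in>{a<..}. total_rate lam i y n \<partial>lborel)"
  have le: "cumulative_rate lam i y n \<le> (\<integral>\<^sup>+y\<in>{0..a}. total_rate lam i y n \<partial>lborel) + ?R" for y
  proof -
    have "cumulative_rate lam i y n \<le> (\<integral>\<^sup>+y. ?f y * indicator {0..a} y + ?f y * indicator {a<..} y \<partial>lborel)"
      unfolding cumulative_rate_def using a by (intro nn_integral_mono) (auto simp: indicator_def)
    also have "\<dots> = (\<integral>\<^sup>+y. ?f y * indicator {0..a} y \<partial>lborel) + (\<integral>\<^sup>+y. ?f y * indicator {a<..} y \<partial>lborel)"
      by (rule nn_integral_add) auto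
    also have "\<dots> = (\<integral>\<^sup>+y\<in>{0..a}. total_rate lam i y n \<partial>lborel) + ?R"
      using a by (intro arg_cong2[where f="(+)"] nn_integral_cong) (auto simp: indicator_def)
    finally show ?thesis .
  qed
  have "\<infinity> \<le> (\<integral>\<^sup>+y\<in>{0..a}. total_rate lam i y n \<partial>lborel) + ?R"
    using le by (intro tendsto_upperbound[OF A2[OF i, of n]]) auto
  then show ?thesis using fin by (auto simp: top_unique ennreal_add_eq_top)
qed

end

section \<open>Paths of the equation\<close>

lemma left_lim_eqI:
  fixes x :: "real \<Rightarrow> 's :: t2_space"
  assumes "b < u" "(f \<longlongrightarrow> l) (at_left u)" "\<And>s. b < s \<Longrightarrow> s < u \<Longrightarrow> x s = f s"
  shows "left_lim x u = l"
proof -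
  have "eventually (\<lambda>s. x s = f s) (at_left u)"
    using assms unfolding eventually_at_left[OF assms(1)] by blast
  then have "(x \<longlongrightarrow> l) (at_left u)" using assms(2) by (simp add: tendsto_cong)
  then show ?thesis unfolding left_lim_def by (intro tendsto_Lim) auto
qed

lemma rcll_left_lim: "rcll x \<Longrightarrow> 0 < u \<Longrightarrow> (x \<longlongrightarrow> left_lim x u) (at_left u)"
  unfolding rcll_def left_lim_def by (metis tendsto_Lim trivial_limit_at_left_real)

lemma set_integral_Ioc_split:
  fixes f :: "real \<times> real \<Rightarrow> real"
  assumes m: "sets m = sets half_plane" and st: "0 \<le> s" "s \<le> t"
    and f: "set_integrable m ({0<..t} \<times> UNIV) f"
  shows "set_lebesgue_integral m ({0<..t} \<times> UNIV) f =
      set_lebesgue_integral m ({0<..s} \<times> UNIV) f + set_lebesgue_integral m ({s<..t} \<times> UNIV) f"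
    and "set_integrable m ({s<..t} \<times> UNIV) f"
proof -
  have "{0<..s} \<times> UNIV \<in> sets m" "{s<..t} \<times> UNIV \<in> sets m"
    using st unfolding m by (auto intro!: half_plane_setsI strip_borel)
  then have *: "set_integrable m ({0<..s} \<times> UNIV) f" "set_integrable m ({s<..t} \<times> UNIV) f"
    using st by (auto intro!: set_integrable_subset[OF f])
  then show "set_integrable m ({s<..t} \<times> UNIV) f" by simp
  have "{0<..t} \<times> (UNIV :: real set) = {0<..s} \<times> UNIV \<union> {s<..t} \<times> UNIV" using st by auto
  then show "set_lebesgue_integral m ({0<..t} \<times> UNIV) f =
      set_lebesgue_integral m ({0<..s} \<times> UNIV) f + set_lebesgue_integral m ({s<..t} \<times> UNIV) f"
    using * by (auto intro!: set_integral_Un)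
qed

text \<open>One fixed path, with all almost sure properties turned into assumptions; no probability
  is left. \<open>m\<close> is the realised random measure, and \<open>atoms\<close> keeps of the
  Poisson property that a vertical line at a positive time carries at most one atom.\<close>

locale solution_path = transition_rates +
  fixes m :: "(real \<times> real) measure" and X :: "real \<Rightarrow> nat" and Y :: "real \<Rightarrow> real" and N :: "real \<Rightarrow> nat"
  assumes sets_m: "sets m = sets half_plane"
    and rcll_X: "rcll X" and rcll_Y: "rcll Y" and rcll_N: "rcll N"
    and X_states: "0 \<le> t \<Longrightarrow> X t \<in> states" and Y_nonneg: "0 \<le> t \<Longrightarrow> 0 \<le> Y t"
    and equations: "\<forall>t\<ge>0.
        let D = {0<..t} \<times> UNIV;
            Xm = left_lim X; Ym = left_lim Y; Nm = left_lim N;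
            h = (\<lambda>(u, v). hLam r lam lamt (Xm u) (Ym u) (Nm u) v);
            g = (\<lambda>(u, v). gLam r lam lamt (Xm u) (Ym u) (Nm u) v);
            k = (\<lambda>(u, v). Ym u * gLam r lam lamt (Xm u) (Ym u) (Nm u) v)
        in set_integrable m D h \<and> set_integrable m D g \<and> set_integrable m D k \<and>
           real (X t) = real (X 0) + set_lebesgue_integral m D h \<and>
           Y t = Y 0 + t - set_lebesgue_integral m D k \<and>
           real (N t) = set_lebesgue_integral m D g"
    and atoms: "0 < u \<Longrightarrow> C \<in> sets borel \<Longrightarrow> emeasure m ({u} \<times> C) \<in> {0, 1}"
begin

abbreviation "hm \<equiv> \<lambda>(u, v). hLam r lam lamt (left_lim X u) (left_lim Y u) (left_lim N u) v"
abbreviation "gm \<equiv> \<lambda>(u, v). gLam r lam lamt (left_lim X u) (left_lim Y u) (left_lim N u) v"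
abbreviation "km \<equiv> \<lambda>(u, v). left_lim Y u * gLam r lam lamt (left_lim X u) (left_lim Y u) (left_lim N u) v"

lemma left_lim_X: "0 < u \<Longrightarrow> left_lim X u \<in> states"
proof -
  assume u: "0 < u"
  have "eventually (\<lambda>s. X s = left_lim X u) (at_left u)"
    using rcll_left_lim[OF rcll_X u] by (simp add: tendsto_discrete)
  moreover have "eventually (\<lambda>s. 0 < s) (at_left u)"
    unfolding eventually_at_left[OF u] using u by auto
  ultimately have "eventually (\<lambda>s. left_lim X u \<in> states) (at_left u)"
    by eventually_elim (metis X_states less_imp_le)
  then show ?thesis by simp
qed

lemma left_lim_Y: "0 < u \<Longrightarrow> 0 \<le> left_lim Y u"
proof -
  assume u: "0 < u"
  have "eventually (\<lambda>s. 0 \<le> Y s) (at_left u)"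
    unfolding eventually_at_left[OF u] using u Y_nonneg by (intro exI[of _ 0]) auto
  then show ?thesis by (intro tendsto_lowerbound[OF rcll_left_lim[OF rcll_Y u]]) auto
qed

lemma N_0: "N 0 = 0"
  using equations[rule_format, of 0] by (simp add: Let_def set_lebesgue_integral_def)

lemma
  assumes st: "0 \<le> s" "s \<le> t"
  shows increment_X: "real (X t) = real (X s) + set_lebesgue_integral m ({s<..t} \<times> UNIV) hm"
    and increment_Y: "Y t = Y s + (t - s) - set_lebesgue_integral m ({s<..t} \<times> UNIV) km"
    and increment_N: "real (N t) = real (N s) + set_lebesgue_integral m ({s<..t} \<times> UNIV) gm"
    and integrable_gm: "set_integrable m ({s<..t} \<times> UNIV) gm"
    and integrable_hm: "set_integrable m ({s<..t} \<times> UNIV) hm"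
    and integrable_km: "set_integrable m ({s<..t} \<times> UNIV) km"
proof -
  have t: "0 \<le> t" using st by simp
  note eq_t = equations[rule_format, OF t, unfolded Let_def]
    and eq_s = equations[rule_format, OF st(1), unfolded Let_def]
  note split = set_integral_Ioc_split[OF sets_m st]
  show "real (X t) = real (X s) + set_lebesgue_integral m ({s<..t} \<times> UNIV) hm"
    using eq_t eq_s split(1)[of hm] by linarith
  show "Y t = Y s + (t - s) - set_lebesgue_integral m ({s<..t} \<times> UNIV) km"
    using eq_t eq_s split(1)[of km] by linarith
  show "real (N t) = real (N s) + set_lebesgue_integral m ({s<..t} \<times> UNIV) gm"
    using eq_t eq_s split(1)[of gm] by linarith
  show "set_integrable m ({s<..t} \<times> UNIV) gm"
    using eq_t split(2)[of gm] by blast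
  show "set_integrable m ({s<..t} \<times> UNIV) hm"
    using eq_t split(2)[of hm] by blast
  show "set_integrable m ({s<..t} \<times> UNIV) km"
    using eq_t split(2)[of km] by blast
qed

section \<open>Behaviour between jumps\<close>

lemma N_mono: "0 \<le> s \<Longrightarrow> s \<le> t \<Longrightarrow> N s \<le> N t"
proof -
  assume "0 \<le> s" "s \<le> t"
  moreover have "0 \<le> set_lebesgue_integral m ({s<..t} \<times> UNIV) gm"
    unfolding set_lebesgue_integral_def by (rule integral_nonneg_AE) (auto simp: gLam_nonneg indicator_def)
  ultimately show ?thesis using increment_N[of s t] by linarith
qed

text \<open>If \<open>N\<close> does not grow, the nonnegative integrand \<open>gm\<close> has
  integral 0 and vanishes almost everywhere. Then no interval is hit, and the integrands of
  \<open>X\<close> and \<open>Y\<close> vanish as well, leaving only the drift of the age.\<close>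

lemma constant_while_N_constant:
  assumes st: "0 \<le> s" "s \<le> t" and N: "N t = N s"
  shows "X t = X s" "Y t = Y s + (t - s)"
proof -
  let ?D = "{s<..t} \<times> (UNIV :: real set)"
  have "set_lebesgue_integral m ?D gm = 0" using increment_N[OF st] N by simp
  then have "AE z in m. indicator ?D z *\<^sub>R gm z = 0"
    unfolding set_lebesgue_integral_def
    by (subst (asm) integral_nonneg_eq_0_iff_AE)
       (use integrable_gm[OF st] in \<open>auto simp: set_integrable_def gLam_nonneg split_beta\<close>)
  then have ae: "AE z in m. z \<in> ?D \<longrightarrow> gm z = 0" by eventually_elim (auto simp: indicator_def split: if_splits)
  have "AE z in m. indicator ?D z *\<^sub>R hm z = 0"
    using ae
  proof eventually_elim
    case (elim z)
    show ?case
    proof (cases "z \<in> ?D")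
      case True
      obtain u v where z: "z = (u, v)" by force
      have "0 < u" using True st z by auto
      from gLam_eq[OF left_lim_X[OF this] left_lim_Y[OF this], of "left_lim N u" v] elim True z
      have "\<not> (\<exists>j\<in>states - {left_lim X u}. v \<in> \<Lambda> (left_lim X u) j (left_lim Y u) (left_lim N u))"
        by (simp split: if_splits)
      from hLam_eq_0[OF this] show ?thesis by (simp add: z)
    qed simp
  qed
  then have "set_lebesgue_integral m ?D hm = 0"
    unfolding set_lebesgue_integral_def by (rule integral_eq_zero_AE)
  then show "X t = X s" using increment_X[OF st] by simp
  have "AE z in m. indicator ?D z *\<^sub>R km z = 0" using ae by eventually_elim (auto simp: indicator_def)
  then have "set_lebesgue_integral m ?D km = 0"
    unfolding set_lebesgue_integral_def by (rule integral_eq_zero_AE)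
  then show "Y t = Y s + (t - s)" using increment_Y[OF st] by simp
qed

text \<open>The points that would end the sojourn in progress at time b, computed as if the state
  stayed frozen forever. The region is not cut off at the next jump; it describes the true integrand
  \<open>gm\<close> only up to and including that jump.\<close>

definition region :: "real \<Rightarrow> (real \<times> real) set" where
  "region b = {(u, v). b < u \<and> v \<in> exit_set (X b) (u - b + Y b) (N b)}"

lemma shifted_cell_borel:
  assumes ij: "(i, j) \<in> state_pairs" and c: "0 \<le> b + c"
  shows "{(u, v). b < u \<and> v \<in> \<Lambda> i j (u + c) n} \<in> sets borel"
proof -
  have "(\<lambda>(u, v). (u + c, v)) -` {(y, v). 0 \<le> y \<and> v \<in> \<Lambda> i j y n} \<inter> space (borel \<Otimes>\<^sub>M borel) \<in> sets (borel \<Otimes>\<^sub>M borel)"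
    using cell_borel[OF ij, of n] unfolding borel_prod[symmetric] by (rule measurable_sets[rotated]) measurable
  then have "(\<lambda>(u, v). (u + c, v)) -` {(y, v). 0 \<le> y \<and> v \<in> \<Lambda> i j y n} \<in> sets borel"
    unfolding borel_prod[symmetric] by (simp only: space_pair_measure space_borel UNIV_Times_UNIV Int_UNIV_right)
  then have "(\<lambda>(u, v). (u + c, v)) -` {(y, v). 0 \<le> y \<and> v \<in> \<Lambda> i j y n} \<inter> {b<..} \<times> UNIV \<in> sets borel"
    by (intro sets.Int strip_borel) auto
  also have "(\<lambda>(u, v). (u + c, v)) -` {(y, v). 0 \<le> y \<and> v \<in> \<Lambda> i j y n} \<inter> {b<..} \<times> UNIV =
    {(u, v). b < u \<and> v \<in> \<Lambda> i j (u + c) n}" using c by auto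
  finally show ?thesis .
qed

lemma region_borel: "0 \<le> b \<Longrightarrow> region b \<in> sets borel"
proof -
  assume b: "0 \<le> b"
  have "region b = (\<Union>j\<in>states - {X b}. {(u, v). b < u \<and> v \<in> \<Lambda> (X b) j (u + (Y b - b)) (N b)})"
    by (auto simp: region_def exit_set_def algebra_simps)
  also have "\<dots> \<in> sets borel"
    using b X_states[OF b] Y_nonneg[OF b]
    by (intro sets.countable_UN'' shifted_cell_borel state_pairsI) auto
  finally show ?thesis .
qed

text \<open>The time u = T is included although \<open>N\<close> may change there, because a left
  limit sees only earlier times. The integrands at a jump therefore still use the old state.\<close>

lemma
  assumes b: "0 \<le> b" "b < T" and N: "\<And>s. b \<le> s \<Longrightarrow> s < T \<Longrightarrow> N s = N b" and u: "b < u" "u \<le> T"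
  shows left_lim_X_eq: "left_lim X u = X b"
    and left_lim_Y_eq: "left_lim Y u = u - b + Y b"
    and left_lim_N_eq: "left_lim N u = N b"
proof -
  have *: "X s = X b" "Y s = Y b + (s - b)" "N s = N b" if "b < s" "s < u" for s
  proof -
    have s: "b \<le> s" "N s = N b" using that u N[of s] by auto
    show "X s = X b" "Y s = Y b + (s - b)" "N s = N b"
      using constant_while_N_constant[OF b(1) s] s(2) by auto
  qed
  show "left_lim X u = X b" "left_lim N u = N b"
    by (rule left_lim_eqI[OF u(1) tendsto_const], fact *)+
  show "left_lim Y u = u - b + Y b"
    by (rule left_lim_eqI[OF u(1), of "\<lambda>s. s - b + Y b"]) (auto intro!: tendsto_intros simp: *(2))
qed

lemma gm_eq:
  assumes b: "0 \<le> b" "b < T" and N: "\<And>s. b \<le> s \<Longrightarrow> s < T \<Longrightarrow> N s = N b" and u: "b < u" "u \<le> T"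
  shows "gm (u, v) = indicator (region b) (u, v)"
  using left_lim_X_eq[OF b N u] left_lim_Y_eq[OF b N u] left_lim_N_eq[OF b N u] X_states[OF b(1)] Y_nonneg[OF b(1)] u
  by (auto simp: region_def exit_set_def gLam_eq indicator_def)

text \<open>Up to \<open>T\<close> the integrand \<open>gm\<close> is the indicator of the region,
  so the increment of \<open>N\<close> is the mass found in it.\<close>

lemma measure_region:
  assumes b: "0 \<le> b" "b < T" and N: "\<And>s. b \<le> s \<Longrightarrow> s < T \<Longrightarrow> N s = N b" and t: "b \<le> t" "t \<le> T"
  shows "emeasure m (region b \<inter> {b<..t} \<times> UNIV) = ennreal (real (N t) - real (N b))"
proof -
  let ?A = "region b \<inter> {b<..t} \<times> UNIV"
  have A: "?A \<in> sets m"
    using b unfolding sets_m by (intro half_plane_setsI sets.Int region_borel strip_borel) auto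
  have eq: "(\<lambda>z. indicator ({b<..t} \<times> UNIV) z *\<^sub>R gm z) = (indicator ?A :: _ \<Rightarrow> real)"
  proof
    fix z show "indicator ({b<..t} \<times> UNIV) z *\<^sub>R gm z = (indicator ?A z :: real)"
    proof (cases "z \<in> {b<..t} \<times> UNIV")
      case True
      then obtain u v where "z = (u, v)" "b < u" "u \<le> T" using t by force
      with gm_eq[OF b N this(2,3)] True show ?thesis by (auto simp: indicator_def)
    qed simp
  qed
  have "integrable m (indicator ?A :: _ \<Rightarrow> real)"
    using integrable_gm[of b t] b t unfolding set_integrable_def eq by simp
  then have fin: "emeasure m ?A < \<infinity>" using A by (simp add: integrable_indicator_iff sets.Int_space_eq2)
  have "real (N t) = real (N b) + (\<integral>z. indicator ?A z \<partial>m)"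
    using increment_N[of b t] b t unfolding set_lebesgue_integral_def eq by simp
  also have "(\<integral>z. indicator ?A z \<partial>m) = measure m ?A" using A by (simp add: sets.Int_space_eq2)
  finally show ?thesis using fin by (simp add: emeasure_eq_ennreal_measure)
qed

text \<open>Uncountably many times are reduced to rational ones: every time of \<open>S'\<close>
  after b is dominated by a rational in \<open>S\<close>, and countably many null sets have a null
  union.\<close>

lemma emeasure_region_eq_0:
  assumes b: "0 \<le> b" and T: "\<And>t. b \<le> t \<Longrightarrow> t \<in> S \<Longrightarrow> emeasure m (region b \<inter> {b<..t} \<times> UNIV) = 0"
    and S: "\<And>t. t \<in> S' \<Longrightarrow> b < t \<Longrightarrow> \<exists>q\<in>\<rat>. t \<le> q \<and> q \<in> S" and S': "S' \<in> sets borel"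
  shows "emeasure m (region b \<inter> S' \<times> UNIV) = 0"
proof -
  have sub: "region b \<inter> S' \<times> UNIV \<subseteq> (\<Union>q\<in>{q\<in>\<rat>. b \<le> q \<and> q \<in> S}. region b \<inter> {b<..q} \<times> UNIV)"
  proof
    fix z assume z: "z \<in> region b \<inter> S' \<times> UNIV"
    then obtain t v where tv: "z = (t, v)" "b < t" "t \<in> S'" by (auto simp: region_def)
    with S obtain q where "q \<in> \<rat>" "t \<le> q" "q \<in> S" by blast
    with tv z show "z \<in> (\<Union>q\<in>{q\<in>\<rat>. b \<le> q \<and> q \<in> S}. region b \<inter> {b<..q} \<times> UNIV)" by auto
  qed
  have null: "(\<Union>q\<in>{q\<in>\<rat>. b \<le> q \<and> q \<in> S}. region b \<inter> {b<..q} \<times> UNIV) \<in> null_sets m"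
  proof (rule null_sets_UN')
    show "countable {q\<in>\<rat>. b \<le> q \<and> q \<in> S}" using countable_rat by (rule countable_subset[rotated]) auto
    show "region b \<inter> {b<..q} \<times> UNIV \<in> null_sets m" if "q \<in> {q\<in>\<rat>. b \<le> q \<and> q \<in> S}" for q
      using T[of q] that b by (auto simp: null_sets_def sets_m region_def[of b] intro!: half_plane_setsI sets.Int region_borel[unfolded region_def] strip_borel)
  qed
  from emeasure_mono[OF sub null_setsD2[OF null]] null_setsD1[OF null] show ?thesis by simp
qed

text \<open>\<open>T\<close> is the first time at which \<open>N\<close> leaves its value at b.
  Between b and \<open>T\<close> the left limits are frozen, so the region has no mass before
  \<open>T\<close>, and the growth of \<open>N\<close> at \<open>T\<close> is the mass of the
  vertical slice of the region. As a vertical set has mass 0 or 1, the slice has mass 1; the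
  interval that carries this mass determines the new state, and the age is reset.\<close>

lemma step:
  assumes b: "0 \<le> b"
  obtains
    (never) "\<And>s. b \<le> s \<Longrightarrow> X s = X b \<and> N s = N b" "emeasure m (region b) = 0"
  | (jump) T :: real where "b < T" "\<And>s. b \<le> s \<Longrightarrow> s < T \<Longrightarrow> X s = X b" "X T \<noteq> X b" "Y T = 0" "N T = Suc (N b)"
      "emeasure m (region b \<inter> {..<T} \<times> UNIV) = 0"
      "\<And>j. j \<in> states - {X b} \<Longrightarrow>
        emeasure m ({T} \<times> \<Lambda> (X b) j (T - b + Y b) (N b)) = (if j = X T then 1 else 0)"
      "emeasure m ({T} \<times> exit_set (X b) (T - b + Y b) (N b)) = 1"
proof (cases "\<forall>s\<ge>b. N s = N b")
  case True
  have "emeasure m (region b \<inter> UNIV \<times> UNIV) = 0"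
  proof (rule emeasure_region_eq_0[OF b, where S=UNIV])
    fix t assume "b \<le> t"
    then have t: "b < t + 1" "t \<le> t + 1" "b \<le> t" by auto
    from t(3) True have "N t = N b" by blast
    moreover have "N s = N b" if "b \<le> s" "s < t + 1" for s using True that by blast
    from measure_region[OF b t(1) this t(3,2)]
    have "emeasure m (region b \<inter> {b<..t} \<times> UNIV) = ennreal (real (N t) - real (N b))" .
    ultimately show "emeasure m (region b \<inter> {b<..t} \<times> UNIV) = 0" by simp
  next
    fix t :: real
    obtain q where "q \<in> \<rat>" "t < q" using Rats_dense_in_real[of t "t + 1"] by auto
    then show "\<exists>q\<in>\<rat>. t \<le> q \<and> q \<in> UNIV" by (intro bexI[of _ q]) auto
  qed simp
  then have region0: "emeasure m (region b) = 0" by simp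
  have "X s = X b \<and> N s = N b" if "b \<le> s" for s
    using constant_while_N_constant(1)[OF b that] True that by blast
  from never[OF this region0] show thesis .
next
  case False
  define S where "S = {s. b \<le> s \<and> N s \<noteq> N b}"
  define T where "T = Inf S"
  have S: "S \<noteq> {}" "bdd_below S" using False by (auto simp: S_def intro!: bdd_belowI[of _ b])
  have right: "\<exists>e>t. \<forall>s. t < s \<and> s < e \<longrightarrow> N s = N t" if "0 \<le> t" for t
    using rcll_N that unfolding rcll_def tendsto_discrete eventually_at_right_field by blast
  \<comment> \<open>Right-continuity of the integer-valued \<open>N\<close> extends constancy on
    [b, t] slightly beyond t. This yields both \<open>b < T\<close> and
    \<open>N T \<noteq> N b\<close>.\<close>
  have far: "t < T" if t: "b \<le> t" "\<And>s. b \<le> s \<Longrightarrow> s \<le> t \<Longrightarrow> N s = N b" for t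
  proof -
    obtain e where e: "t < e" "\<And>s. t < s \<Longrightarrow> s < e \<Longrightarrow> N s = N t" using right[of t] b t(1) by auto
    have "e \<le> T" unfolding T_def
    proof (rule cInf_greatest[OF S(1)])
      fix s assume "s \<in> S"
      then have "b \<le> s" "N s \<noteq> N b" by (auto simp: S_def)
      then show "e \<le> s" using t(2)[of s] e(2)[of s] t(2)[of t] t(1) by (cases "s \<le> t"; cases "s < e") auto
    qed
    with e(1) show ?thesis by simp
  qed
  have bT: "b < T"
  proof (rule far)
    show "N s = N b" if "b \<le> s" "s \<le> b" for s using order_antisym[OF that] by simp
  qed simp
  have N: "N s = N b" if "b \<le> s" "s < T" for s
    using that cInf_lower[OF _ S(2), of s] by (auto simp: T_def S_def)
  have NT: "N T \<noteq> N b"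
  proof
    assume "N T = N b"
    then have "N s = N b" if "b \<le> s" "s \<le> T" for s using N[of s] that by (cases "s = T") auto
    from far[OF less_imp_le[OF bT] this] show False by simp
  qed
  let ?R = "region b" and ?i = "X b" and ?a = "T - b + Y b" and ?n = "N b"
  have i: "?i \<in> states" and a: "0 \<le> ?a" using X_states Y_nonneg[of b] b bT by auto
  have X: "X s = X b" if "b \<le> s" "s < T" for s
    using constant_while_N_constant(1)[OF b that(1) N[OF that]] .
  have before: "emeasure m (?R \<inter> {..<T} \<times> UNIV) = 0"
  proof (rule emeasure_region_eq_0[OF b, where S="{..<T}"])
    fix t assume "b \<le> t" "t \<in> {..<T}"
    then show "emeasure m (?R \<inter> {b<..t} \<times> UNIV) = 0"
      using measure_region[OF b bT N, of t] N[of t] by simp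
  next
    fix t assume "t \<in> {..<T}"
    then obtain q where "q \<in> \<rat>" "t < q" "q < T" using Rats_dense_in_real[of t T] by auto
    then show "\<exists>q\<in>\<rat>. t \<le> q \<and> q \<in> {..<T}" by (intro bexI[of _ q]) auto
  qed simp
  have sets1: "{T} \<times> C \<in> sets m" if "C \<in> sets borel" for C
    using b bT that unfolding sets_m
    by (intro half_plane_setsI) (auto simp: borel_prod[symmetric] intro!: pair_measureI)
  have exit_borel: "exit_set ?i ?a ?n \<in> sets borel"
    unfolding exit_set_def using Lam_borel by (intro sets.countable_UN'') auto
  have R_sets: "?R \<inter> C \<times> UNIV \<in> sets m" if "C \<in> sets borel" for C
    using b that unfolding sets_m
    by (intro half_plane_setsI sets.Int region_borel strip_borel) (auto simp: region_def)
  have before_null: "?R \<inter> {..<T} \<times> UNIV \<in> null_sets m"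
    using before R_sets[of "{..<T}"] by (auto simp: null_sets_def)
  \<comment> \<open>Up to and including \<open>T\<close> the region is its slice at \<open>T\<close>
    together with a null set.\<close>
  have "?R \<inter> {b<..T} \<times> UNIV = {T} \<times> exit_set ?i ?a ?n \<union> (?R \<inter> {..<T} \<times> UNIV)"
    using bT by (auto simp: region_def dest: order_le_imp_less_or_eq)
  then have "emeasure m (?R \<inter> {b<..T} \<times> UNIV) = emeasure m ({T} \<times> exit_set ?i ?a ?n)"
    using emeasure_Un_null_set[OF sets1[OF exit_borel] before_null] by simp
  then have exit_size: "emeasure m ({T} \<times> exit_set ?i ?a ?n) = ennreal (real (N T) - real ?n)"
    using measure_region[OF b bT N, of T] bT by simp
  moreover have "?n < N T" using NT N_mono[OF b, of T] bT by linarith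
  moreover have "emeasure m ({T} \<times> exit_set ?i ?a ?n) \<in> {0, 1}"
    using b bT exit_borel by (intro atoms) auto
  ultimately have exit1: "emeasure m ({T} \<times> exit_set ?i ?a ?n) = 1" by (auto simp: ennreal_eq_0_iff)
  with exit_size have NT_Suc: "N T = Suc ?n" by (simp add: ennreal_eq_1)
  \<comment> \<open>The slice is a countable union of intervals, so one of them must carry
    mass.\<close>
  have "\<exists>j\<in>states - {?i}. emeasure m ({T} \<times> \<Lambda> ?i j ?a ?n) \<noteq> 0"
  proof (rule ccontr)
    assume "\<not> ?thesis"
    then have "(\<Union>j\<in>states - {?i}. {T} \<times> \<Lambda> ?i j ?a ?n) \<in> null_sets m"
      using sets1[OF Lam_borel] by (intro null_sets_UN') (auto simp: null_sets_def)
    also have "(\<Union>j\<in>states - {?i}. {T} \<times> \<Lambda> ?i j ?a ?n) = {T} \<times> exit_set ?i ?a ?n" by (auto simp: exit_set_def)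
    finally show False using exit1 by (simp add: null_sets_def)
  qed
  then obtain j where j: "j \<in> states - {?i}" "emeasure m ({T} \<times> \<Lambda> ?i j ?a ?n) \<noteq> 0" by blast
  have L: "{T} \<times> \<Lambda> ?i j ?a ?n \<in> sets m" by (intro sets1 Lam_borel)
  have j1: "emeasure m ({T} \<times> \<Lambda> ?i j ?a ?n) = 1"
    using j(2) atoms[of T "\<Lambda> ?i j ?a ?n"] b bT Lam_borel by auto
  have rest: "emeasure m ({T} \<times> (exit_set ?i ?a ?n - \<Lambda> ?i j ?a ?n)) = 0"
  proof -
    have "emeasure m ({T} \<times> exit_set ?i ?a ?n - {T} \<times> \<Lambda> ?i j ?a ?n) = 1 - 1"
      using j(1) j1 by (subst emeasure_Diff[OF _ sets1[OF exit_borel] L]) (use exit1 in \<open>auto simp: exit_set_def\<close>)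
    moreover have "{T} \<times> (exit_set ?i ?a ?n - \<Lambda> ?i j ?a ?n) = {T} \<times> exit_set ?i ?a ?n - {T} \<times> \<Lambda> ?i j ?a ?n" by auto
    ultimately show ?thesis by simp
  qed
  have ae: "AE z in m. z \<in> {b<..T} \<times> UNIV \<longrightarrow> z \<in> ?R \<longrightarrow> z \<in> {T} \<times> \<Lambda> ?i j ?a ?n"
  proof (rule AE_I[where N="(?R \<inter> {..<T} \<times> UNIV) \<union> {T} \<times> (exit_set ?i ?a ?n - \<Lambda> ?i j ?a ?n)"])
    show "emeasure m (?R \<inter> {..<T} \<times> UNIV \<union> {T} \<times> (exit_set ?i ?a ?n - \<Lambda> ?i j ?a ?n)) = 0"
      using rest sets1[of "exit_set ?i ?a ?n - \<Lambda> ?i j ?a ?n"] exit_borel Lam_borel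
      by (subst emeasure_Un_null_set[OF null_setsD2[OF before_null]])
        (auto simp: null_sets_def null_setsD1[OF before_null])
    show "?R \<inter> {..<T} \<times> UNIV \<union> {T} \<times> (exit_set ?i ?a ?n - \<Lambda> ?i j ?a ?n) \<in> sets m"
      using R_sets[of "{..<T}"] exit_borel Lam_borel by (intro sets.Un sets1) auto
  qed (auto simp: region_def dest: order_le_imp_less_or_eq)
  have sub: "{T} \<times> \<Lambda> ?i j ?a ?n \<subseteq> ?R \<inter> {b<..T} \<times> UNIV" using j(1) bT by (auto simp: region_def exit_set_def)
  note left = left_lim_X_eq[OF b bT N] left_lim_Y_eq[OF b bT N] left_lim_N_eq[OF b bT N]
  have bT': "b \<le> T" using bT by simp
  \<comment> \<open>Off a null set both integrands are a constant times the indicator of the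
    interval that carries the atom, so the integrals reduce to its mass 1. The constant for
    \<open>Y\<close> is the age \<open>?a\<close> just before \<open>T\<close>, which is why the age
    drops to 0.\<close>
  have pointwise: "AE z in m. indicator ({b<..T} \<times> UNIV) z *\<^sub>R hm z = (real j - real ?i) * indicator ({T} \<times> \<Lambda> ?i j ?a ?n) z \<and>
      indicator ({b<..T} \<times> UNIV) z *\<^sub>R km z = ?a * indicator ({T} \<times> \<Lambda> ?i j ?a ?n) z"
    using ae
  proof eventually_elim
    case (elim z)
    obtain u v where z: "z = (u, v)" by force
    show ?case
    proof (cases "b < u \<and> u \<le> T")
      case u: True
      show ?thesis
      proof (cases "z \<in> ?R")
        case True
        then have "z \<in> {T} \<times> \<Lambda> ?i j ?a ?n" using elim u z by auto
        then show ?thesis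
          using z u left[of u] hLam_eq[OF i a j(1), of v ?n] gm_eq[OF b bT N, of u v] True by auto
      next
        case False
        then have "hLam r lam lamt ?i (u - b + Y b) ?n v = 0"
          using u z by (intro hLam_eq_0) (auto simp: region_def exit_set_def)
        moreover have "z \<notin> {T} \<times> \<Lambda> ?i j ?a ?n" using False sub by auto
        ultimately show ?thesis using z u left[of u] False gm_eq[OF b bT N, of u v] by (auto simp: indicator_def)
      qed
    qed (use sub z in \<open>auto simp: indicator_def\<close>)
  qed
  have L_measure: "measure m ({T} \<times> \<Lambda> ?i j ?a ?n) = 1" using j1 by (simp add: measure_def)
  have "set_lebesgue_integral m ({b<..T} \<times> UNIV) hm = (\<integral>z. (real j - real ?i) * indicator ({T} \<times> \<Lambda> ?i j ?a ?n) z \<partial>m)"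
    unfolding set_lebesgue_integral_def using integrable_hm[OF b bT'] pointwise L
    by (intro integral_cong_AE) (auto simp: set_integrable_def)
  then have XT: "X T = j"
    using increment_X[OF b bT'] L L_measure by (simp add: sets.Int_space_eq2)
  have "set_lebesgue_integral m ({b<..T} \<times> UNIV) km = (\<integral>z. ?a * indicator ({T} \<times> \<Lambda> ?i j ?a ?n) z \<partial>m)"
    unfolding set_lebesgue_integral_def using integrable_km[OF b bT'] pointwise L
    by (intro integral_cong_AE) (auto simp: set_integrable_def)
  then have YT: "Y T = 0"
    using increment_Y[OF b bT'] L L_measure by (simp add: sets.Int_space_eq2)
  have cells: "emeasure m ({T} \<times> \<Lambda> ?i j' ?a ?n) = (if j' = X T then 1 else 0)" if j': "j' \<in> states - {?i}" for j'
  proof (cases "j' = j")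
    case False
    have "{T} \<times> \<Lambda> ?i j' ?a ?n \<subseteq> {T} \<times> (exit_set ?i ?a ?n - \<Lambda> ?i j ?a ?n)"
      using Lam_disjoint[OF state_pairsI[OF i j'] state_pairsI[OF i j(1)] a, of _ ?n] False j'
      by (auto simp: exit_set_def)
    then have "emeasure m ({T} \<times> \<Lambda> ?i j' ?a ?n) \<le> emeasure m ({T} \<times> (exit_set ?i ?a ?n - \<Lambda> ?i j ?a ?n))"
      using exit_borel Lam_borel by (intro emeasure_mono sets1) auto
    with rest False XT show ?thesis by simp
  qed (use j1 XT in simp)
  show thesis
    by (rule jump[OF bT X _ YT NT_Suc before cells exit1]) (use XT j(1) in auto)
qed

end

section \<open>Compensation of Poisson random measures\<close>

lemma emeasure_half_plane: "A \<in> sets half_plane \<Longrightarrow> emeasure half_plane A = emeasure lborel A"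
  unfolding half_plane_def by (subst emeasure_restrict_space) (auto simp: strip_borel sets_restrict_space_iff)

text \<open>The mean of the Poisson law, with parameter 0 allowed: the term k = 0 vanishes, and
  otherwise the factor k cancels against the factorial.\<close>

lemma poisson_expectation: "(\<lambda>k. real k * (exp (- l) * l ^ k / fact k)) sums l" for l :: real
proof -
  have "(\<lambda>k. l * exp (- l) * (l ^ k /\<^sub>R fact k)) sums (l * exp (- l) * exp l)"
    by (intro sums_mult exp_converges)
  then have "(\<lambda>k. real (Suc k) * (exp (- l) * l ^ Suc k / fact (Suc k))) sums l"
    by (simp add: exp_minus divide_simps fact_reduce ac_simps del: of_nat_Suc)
  then show ?thesis by (subst (asm) sums_Suc_iff) simp
qed

lemma poisson_total: "(\<lambda>k. exp (- l) * l ^ k / fact k) sums (1 :: real)" for l :: real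
proof -
  have "(\<lambda>k. exp (- l) * (l ^ k /\<^sub>R fact k)) sums (exp (- l) * exp l)"
    by (intro sums_mult exp_converges)
  then show ?thesis by (simp add: exp_minus divide_simps ac_simps)
qed

text \<open>\<open>V\<close> holds the information present at time 0; in the application it is
  generated by the initial values.\<close>

locale poisson_process = prob_space M for M :: "'a measure" +
  fixes p :: "'a \<Rightarrow> (real \<times> real) measure" and V :: "'a measure"
  assumes complete: "complete_measure M"
    and prm: "poisson_random_measure M half_plane p"
    and space_V: "space V = space M"
    and indep_V: "indep_set (sets V) (sets (sigma_of_random_measure M half_plane p))"
begin

lemma sets_p[measurable_cong]: "\<omega> \<in> space M \<Longrightarrow> sets (p \<omega>) = sets half_plane"
  using prm by (auto simp: poisson_random_measure_def)

lemma p_measurable[measurable]: "A \<in> sets half_plane \<Longrightarrow> (\<lambda>\<omega>. emeasure (p \<omega>) A) \<in> borel_measurable M"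
  using prm by (auto simp: poisson_random_measure_def)

lemma p_distribution:
  "A \<in> sets half_plane \<Longrightarrow> emeasure lborel A < \<infinity> \<Longrightarrow>
    prob {\<omega>\<in>space M. emeasure (p \<omega>) A = of_nat k} = exp (- measure lborel A) * measure lborel A ^ k / fact k"
  using prm emeasure_half_plane[of A] unfolding poisson_random_measure_def by (simp add: measure_def)

lemma p_indep:
  "range A \<subseteq> sets half_plane \<Longrightarrow> disjoint_family A \<Longrightarrow>
    indep_vars (\<lambda>_. borel) (\<lambda>(k::nat) \<omega>. emeasure (p \<omega>) (A k)) UNIV"
  using prm unfolding poisson_random_measure_def by blast

lemma AE_p_nat:
  assumes A: "A \<in> sets half_plane" "emeasure lborel A < \<infinity>"
  shows "AE \<omega> in M. \<exists>k::nat. emeasure (p \<omega>) A = of_nat k"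
proof -
  let ?Q = "\<lambda>k::nat. {\<omega>\<in>space M. emeasure (p \<omega>) A = of_nat k}"
  have [measurable]: "?Q k \<in> events" for k using A by measurable
  have "(\<lambda>k. prob (?Q k)) sums prob (\<Union>k. ?Q k)"
    by (rule finite_measure_UNION) (auto simp: disjoint_family_on_def)
  with poisson_total[of "measure lborel A"] have "prob (\<Union>k. ?Q k) = 1"
    unfolding p_distribution[OF A] by (rule sums_unique2[symmetric])
  then have "AE \<omega> in M. \<omega> \<in> (\<Union>k. ?Q k)" by (intro AE_in_set_eq_1[THEN iffD2]) auto
  then show ?thesis by eventually_elim auto
qed

section \<open>The filtration of the past\<close>

definition past_gen :: "real \<Rightarrow> 'a set set" where
  "past_gen s = {E \<inter> {\<omega>\<in>space M. \<forall>(D, B)\<in>L. emeasure (p \<omega>) D \<in> B} | E L.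
     E \<in> sets V \<and> finite L \<and> L \<subseteq> {D\<in>sets half_plane. D \<subseteq> {0<..s} \<times> UNIV} \<times> sets borel}"

text \<open>A generator combines an event of \<open>V\<close> with finitely many observations, which
  makes the class closed under intersection. Null sets are added because events described by the
  path are identified only almost surely.\<close>

definition past :: "real \<Rightarrow> 'a measure" where
  "past s = sigma (space M) (past_gen s \<union> null_sets M)"

lemma observe_event:
  assumes "D \<in> sets half_plane" "B \<in> sets borel"
  shows "{\<omega>\<in>space M. emeasure (p \<omega>) D \<in> B} \<in> sets (sigma_of_random_measure M half_plane p)"
proof -
  let ?f = "\<lambda>\<omega>. \<lambda>A\<in>sets half_plane. emeasure (p \<omega>) A"
  let ?C = "(\<lambda>x. x D) -` B \<inter> space (PiM (sets half_plane) (\<lambda>_. borel :: ennreal measure))"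
  have "?C \<in> sets (PiM (sets half_plane) (\<lambda>_. borel))"
    using assms by (intro measurable_sets[OF measurable_component_singleton]) auto
  then have "?f -` ?C \<inter> space M \<in> sets (sigma_of_random_measure M half_plane p)"
    unfolding sigma_of_random_measure_def by (rule in_vimage_algebra)
  moreover have "?f -` ?C \<inter> space M = {\<omega>\<in>space M. emeasure (p \<omega>) D \<in> B}"
    using assms by (auto simp: space_PiM)
  ultimately show ?thesis by simp
qed

lemma observe_events:
  assumes "finite L" "L \<subseteq> {D\<in>sets half_plane. D \<subseteq> {0<..s} \<times> UNIV} \<times> sets borel"
  shows "{\<omega>\<in>space M. \<forall>(D, B)\<in>L. emeasure (p \<omega>) D \<in> B} \<in> sets (sigma_of_random_measure M half_plane p)"
proof -
  have eq: "{\<omega>\<in>space M. \<forall>(D, B)\<in>L. emeasure (p \<omega>) D \<in> B} =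
    space M \<inter> (\<Inter>(D, B)\<in>L. {\<omega>\<in>space M. emeasure (p \<omega>) D \<in> B})" by auto
  have sp: "space (sigma_of_random_measure M half_plane p) = space M"
    by (simp add: sigma_of_random_measure_def)
  show ?thesis
  proof (cases "L = {}")
    case True
    then show ?thesis using sets.top[of "sigma_of_random_measure M half_plane p"] by (simp add: sp)
  next
    case False
    then show ?thesis unfolding eq using assms observe_event sets.top[of "sigma_of_random_measure M half_plane p"]
      by (intro sets.Int sets.finite_INT) (auto simp: sp)
  qed
qed

lemma sigma_events: "A \<in> sets (sigma_of_random_measure M half_plane p) \<Longrightarrow> A \<in> events"
  using indep_V by (auto simp: indep_set_def indep_sets_def split: bool.splits)

lemma V_events: "A \<in> sets V \<Longrightarrow> A \<in> events"
  using indep_V by (auto simp: indep_set_def indep_sets_def split: bool.splits)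

lemma past_gen_events: "E \<in> past_gen s \<Longrightarrow> E \<in> events"
proof -
  assume "E \<in> past_gen s"
  then obtain E0 L where E: "E = E0 \<inter> {\<omega>\<in>space M. \<forall>(D, B)\<in>L. emeasure (p \<omega>) D \<in> B}" "E0 \<in> sets V" "finite L"
      "L \<subseteq> {D\<in>sets half_plane. D \<subseteq> {0<..s} \<times> UNIV} \<times> sets borel" unfolding past_gen_def by blast
  show ?thesis
    unfolding E(1) using V_events[OF E(2)] sigma_events[OF observe_events[OF E(3,4)]] by (rule sets.Int)
qed

lemma past_gen_subset: "past_gen s \<union> null_sets M \<subseteq> events"
  using past_gen_events by (auto simp: null_sets_def)

lemma past_gen_Pow: "past_gen s \<union> null_sets M \<subseteq> Pow (space M)"
  using past_gen_subset sets.space_closed by blast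

lemma sets_past: "sets (past s) = sigma_sets (space M) (past_gen s \<union> null_sets M)"
  and space_past: "space (past s) = space M"
  using past_gen_Pow by (auto simp: past_def)

lemma Int_stable_past_gen: "Int_stable (past_gen s \<union> null_sets M)"
proof (rule Int_stableI)
  fix a b assume a: "a \<in> past_gen s \<union> null_sets M" and b: "b \<in> past_gen s \<union> null_sets M"
  show "a \<inter> b \<in> past_gen s \<union> null_sets M"
  proof (cases "a \<in> null_sets M \<or> b \<in> null_sets M")
    case True
    moreover have "a \<in> events" "b \<in> events" using a b past_gen_subset by blast+
    ultimately have "a \<inter> b \<in> null_sets M" by (elim disjE) (auto intro: null_set_Int1 null_set_Int2)
    then show ?thesis by simp
  next
    case False
    with a obtain E L where a: "a = E \<inter> {\<omega>\<in>space M. \<forall>(D, B)\<in>L. emeasure (p \<omega>) D \<in> B}" "E \<in> sets V" "finite L"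
      "L \<subseteq> {D\<in>sets half_plane. D \<subseteq> {0<..s} \<times> UNIV} \<times> sets borel" unfolding past_gen_def by blast
    from False b obtain E' L' where b: "b = E' \<inter> {\<omega>\<in>space M. \<forall>(D, B)\<in>L'. emeasure (p \<omega>) D \<in> B}" "E' \<in> sets V" "finite L'"
      "L' \<subseteq> {D\<in>sets half_plane. D \<subseteq> {0<..s} \<times> UNIV} \<times> sets borel" unfolding past_gen_def by blast
    have "a \<inter> b = (E \<inter> E') \<inter> {\<omega>\<in>space M. \<forall>(D, B)\<in>L \<union> L'. emeasure (p \<omega>) D \<in> B}"
      using a(1) b(1) by auto
    then have "a \<inter> b \<in> past_gen s"
      unfolding past_gen_def using a(2-4) b(2-4)
      by (intro CollectI exI[of _ "E \<inter> E'"] exI[of _ "L \<union> L'"]) auto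
    then show ?thesis ..
  qed
qed

text \<open>The sets in \<open>L\<close> may overlap; their atoms form a disjoint family, indexed by the binary code of
  the membership pattern.\<close>

lemma observe_indep:
  assumes L: "finite L" "L \<subseteq> {D\<in>sets half_plane. D \<subseteq> {0<..s} \<times> UNIV} \<times> sets borel"
    and D0: "D0 \<in> sets half_plane" "D0 \<subseteq> {s<..} \<times> UNIV" and B0: "B0 \<in> sets borel"
  shows "prob ({\<omega>\<in>space M. \<forall>(D, B)\<in>L. emeasure (p \<omega>) D \<in> B} \<inter> {\<omega>\<in>space M. emeasure (p \<omega>) D0 \<in> B0}) =
    prob {\<omega>\<in>space M. \<forall>(D, B)\<in>L. emeasure (p \<omega>) D \<in> B} * prob {\<omega>\<in>space M. emeasure (p \<omega>) D0 \<in> B0}"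
proof -
  obtain ls where ls: "set ls = L" using finite_list[OF L(1)] by blast
  define len where "len = length ls"
  define D where "D k = fst (ls ! k)" for k
  define B where "B k = snd (ls ! k)" for k
  have DB: "D k \<in> sets half_plane" "D k \<subseteq> {0<..s} \<times> UNIV" "B k \<in> sets borel" if "k < len" for k
  proof -
    have "ls ! k \<in> {D\<in>sets half_plane. D \<subseteq> {0<..s} \<times> UNIV} \<times> sets borel"
      using nth_mem[of k ls] that by (intro subsetD[OF L(2)]) (simp add: ls len_def)
    then show "D k \<in> sets half_plane" "D k \<subseteq> {0<..s} \<times> UNIV" "B k \<in> sets borel"
      by (simp_all add: mem_Times_iff D_def B_def)
  qed
  have obs: "(\<forall>(D, B)\<in>L. emeasure (p \<omega>) D \<in> B) \<longleftrightarrow> (\<forall>k<len. emeasure (p \<omega>) (D k) \<in> B k)" for \<omega>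
    by (auto simp: ls[symmetric] all_set_conv_all_nth D_def B_def len_def split_beta)
  \<comment> \<open>Index 0 is reserved for the future set \<open>D0\<close>, so that past and
    future masses are read off disjoint index sets. A code with a bit beyond \<open>len\<close>
    describes no point and gives the empty set.\<close>
  define A where "A n = (case n of 0 \<Rightarrow> D0 | Suc a \<Rightarrow>
    {z \<in> space half_plane. z \<in> {0<..s} \<times> UNIV \<and> (\<forall>k. (k < len \<and> z \<in> D k) \<longleftrightarrow> k \<in> set_decode a)})" for n
  have strip: "{0<..s} \<times> UNIV \<in> sets half_plane" by (rule half_plane_setsI) (auto simp: strip_borel)
  have A: "A n \<in> sets half_plane" for n
  proof (cases n)
    case (Suc a)
    define S where "S k = (if k < len then if k \<in> set_decode a then D k else space half_plane - D k
      else if k \<in> set_decode a then {} else space half_plane)" for k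
    have S: "S k \<in> sets half_plane" for k using DB[of k] by (auto simp: S_def)
    have S_iff: "z \<in> S k \<longleftrightarrow> ((k < len \<and> z \<in> D k) \<longleftrightarrow> k \<in> set_decode a)" if "z \<in> space half_plane" for k z
      using that by (auto simp: S_def)
    have "range S \<subseteq> sets half_plane" using S by blast
    then have "({0<..s} \<times> UNIV) \<inter> (\<Inter>k. S k) \<in> sets half_plane"
      by (rule sets.Int[OF strip sets.countable_INT]) simp
    also have "({0<..s} \<times> UNIV) \<inter> (\<Inter>k. S k) =
      {z \<in> space half_plane. z \<in> {0<..s} \<times> UNIV \<and> (\<forall>k. z \<in> S k)}"
      using sets.sets_into_space[OF strip] by blast
    also have "\<dots> = A n" unfolding Suc A_def nat.case by (intro Collect_cong conj_cong refl all_cong1 S_iff)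
    finally show ?thesis .
  qed (use D0 in \<open>simp add: A_def\<close>)
  have disj: "disjoint_family A"
    unfolding disjoint_family_on_def
  proof (intro ballI impI equals0I)
    fix m n z assume mn: "m \<noteq> n" and z: "z \<in> A m \<inter> A n"
    show False
    proof (cases m; cases n)
      fix a a' assume "m = Suc a" "n = Suc a'"
      then have "set_decode a = set_decode a'" using z by (auto simp: A_def)
      then have "a = a'" by (metis set_decode_inverse)
      then show False using mn \<open>m = Suc a\<close> \<open>n = Suc a'\<close> by simp
    qed (use mn z D0(2) in \<open>auto simp: A_def\<close>)
  qed
  have D_eq: "D k = (\<Union>a. if k \<in> set_decode a then A (Suc a) else {})" if k: "k < len" for k
  proof (intro set_eqI iffI)
    fix z assume z: "z \<in> D k"
    let ?a = "set_encode {k. k < len \<and> z \<in> D k}"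
    have "set_decode ?a = {k. k < len \<and> z \<in> D k}" by (rule set_encode_inverse) auto
    moreover have "z \<in> space half_plane" using z sets.sets_into_space[OF DB(1)[OF k]] by auto
    ultimately show "z \<in> (\<Union>a. if k \<in> set_decode a then A (Suc a) else {})"
      using z k DB(2)[OF k] by (intro UN_I[of ?a]) (auto simp: A_def)
  qed (auto simp: A_def split: if_splits)
  define f where "f k x = (\<Sum>a. if k \<in> set_decode a then x (Suc a) else (0::ennreal))" for k and x :: "nat \<Rightarrow> ennreal"
  have f: "emeasure (p \<omega>) (D k) = f k (\<lambda>n\<in>range Suc. emeasure (p \<omega>) (A n))" if "k < len" "\<omega> \<in> space M" for k \<omega>
  proof -
    let ?A = "\<lambda>a. if k \<in> set_decode a then A (Suc a) else {}"
    have "emeasure (p \<omega>) (D k) = (\<Sum>a. emeasure (p \<omega>) (?A a))"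
      unfolding D_eq[OF that(1)] using A disj that(2)
      by (intro suminf_emeasure[symmetric]) (auto simp: sets_p disjoint_family_on_def)
    also have "\<dots> = f k (\<lambda>n\<in>range Suc. emeasure (p \<omega>) (A n))"
      unfolding f_def by (intro suminf_cong) auto
    finally show ?thesis .
  qed
  have f_meas[measurable]: "f k \<in> borel_measurable (PiM (range Suc) (\<lambda>_. borel))" for k
  proof -
    have "(\<lambda>x. if k \<in> set_decode a then x (Suc a) else (0::ennreal)) \<in> borel_measurable (PiM (range Suc) (\<lambda>_. borel))" for a
      by (cases "k \<in> set_decode a") (auto intro!: measurable_component_singleton)
    then show ?thesis unfolding f_def by measurable
  qed
  have "indep_vars (\<lambda>_. borel) (\<lambda>n \<omega>. emeasure (p \<omega>) (A n)) UNIV"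
    using A disj by (intro p_indep) auto
  from indep_var_restrict[OF this, of "range Suc" "{0}"]
  have ind: "indep_var (PiM (range Suc) (\<lambda>_. borel)) (\<lambda>\<omega>. \<lambda>n\<in>range Suc. emeasure (p \<omega>) (A n))
      (PiM {0} (\<lambda>_. borel)) (\<lambda>\<omega>. \<lambda>n\<in>{0}. emeasure (p \<omega>) (A n))" by auto
  let ?X = "{x \<in> space (PiM (range Suc) (\<lambda>_. borel)). \<forall>k<len. f k x \<in> B k}"
  let ?Y = "{x \<in> space (PiM {0::nat} (\<lambda>_. borel)). x 0 \<in> B0}"
  have X: "?X \<in> sets (PiM (range Suc) (\<lambda>_. borel))"
  proof (rule sets.sets_Collect_countable_All)
    fix k show "{x \<in> space (PiM (range Suc) (\<lambda>_. borel)). k < len \<longrightarrow> f k x \<in> B k} \<in> sets (PiM (range Suc) (\<lambda>_. borel))"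
      using measurable_sets[OF f_meas DB(3)] by (cases "k < len") (auto simp: vimage_def Int_def conj_commute)
  qed
  have Y: "?Y \<in> sets (PiM {0::nat} (\<lambda>_. borel))"
    using B0 measurable_sets[OF measurable_component_singleton[of 0 "{0::nat}" "\<lambda>_. borel :: ennreal measure"] B0]
    by (simp add: vimage_def Int_def conj_commute)
  have 1: "(\<lambda>\<omega>. \<lambda>n\<in>range Suc. emeasure (p \<omega>) (A n)) -` ?X \<inter> space M = {\<omega>\<in>space M. \<forall>(D, B)\<in>L. emeasure (p \<omega>) D \<in> B}"
    unfolding obs using f by (auto simp: space_PiM)
  have 2: "(\<lambda>\<omega>. \<lambda>n\<in>{0}. emeasure (p \<omega>) (A n)) -` ?Y \<inter> space M = {\<omega>\<in>space M. emeasure (p \<omega>) D0 \<in> B0}"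
    by (auto simp: space_PiM A_def)
  have 3: "(\<lambda>\<omega>. (\<lambda>n\<in>range Suc. emeasure (p \<omega>) (A n), \<lambda>n\<in>{0}. emeasure (p \<omega>) (A n))) -` (?X \<times> ?Y) \<inter> space M =
    {\<omega>\<in>space M. \<forall>(D, B)\<in>L. emeasure (p \<omega>) D \<in> B} \<inter> {\<omega>\<in>space M. emeasure (p \<omega>) D0 \<in> B0}"
    unfolding 1[symmetric] 2[symmetric] by auto
  show ?thesis using indep_varD[OF ind X Y] unfolding 1 2 3 .
qed

text \<open>On the generators independence is obtained in two stages: the event of \<open>V\<close>
  is independent of the whole random measure, and past observations are independent of a later mass.
  Closure of the generators under intersection extends this to all of \<open>past s\<close>.\<close>

lemma past_indep:
  assumes E: "E \<in> sets (past s)" and D: "D \<in> sets half_plane" "D \<subseteq> {s<..} \<times> UNIV" and B: "B \<in> sets borel"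
  shows "prob (E \<inter> {\<omega>\<in>space M. emeasure (p \<omega>) D \<in> B}) = prob E * prob {\<omega>\<in>space M. emeasure (p \<omega>) D \<in> B}"
proof -
  let ?R = "{\<omega>\<in>space M. emeasure (p \<omega>) D \<in> B}"
  have R: "?R \<in> events" using D(1) B by measurable
  have R': "?R \<in> sets (sigma_of_random_measure M half_plane p)" using D(1) B by (rule observe_event)
  have "indep_set (past_gen s \<union> null_sets M) {?R}"
    unfolding indep_sets2_eq
  proof (intro conjI ballI)
    show "past_gen s \<union> null_sets M \<subseteq> events" "{?R} \<subseteq> events" using R past_gen_subset by auto
    fix a b assume a: "a \<in> past_gen s \<union> null_sets M" and b: "b \<in> {?R}"
    show "prob (a \<inter> b) = prob a * prob b"
    proof (cases "a \<in> null_sets M")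
      case True
      then have "a \<inter> b \<in> null_sets M" using b R by (intro null_set_Int2) auto
      then show ?thesis using True by (simp add: measure_def null_sets_def)
    next
      case False
      with a obtain E L where a: "a = E \<inter> {\<omega>\<in>space M. \<forall>(D, B)\<in>L. emeasure (p \<omega>) D \<in> B}" (is "_ = _ \<inter> ?Q") "E \<in> sets V" "finite L"
        "L \<subseteq> {D\<in>sets half_plane. D \<subseteq> {0<..s} \<times> UNIV} \<times> sets borel" unfolding past_gen_def by blast
      note Q = observe_events[OF a(3,4)]
      have "prob (a \<inter> b) = prob (E \<inter> (?Q \<inter> ?R))" using a(1) b by (simp add: Int_assoc)
      also have "\<dots> = prob E * prob (?Q \<inter> ?R)" using Q R' a(2) by (intro indep_setD[OF indep_V]) auto
      also have "prob (?Q \<inter> ?R) = prob ?Q * prob ?R" by (rule observe_indep[OF a(3,4) D B])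
      also have "prob E * (prob ?Q * prob ?R) = prob (E \<inter> ?Q) * prob ?R"
        using indep_setD[OF indep_V a(2) Q] by simp
      finally show ?thesis using a(1) b by simp
    qed
  qed
  from indep_set_sigma_sets[OF this Int_stable_past_gen]
  have "indep_set (sigma_sets (space M) (past_gen s \<union> null_sets M)) (sigma_sets (space M) {?R})"
    by (simp add: Int_stable_def)
  then show ?thesis using E unfolding sets_past by (rule indep_setD) auto
qed

lemma past_subalgebra: "subalgebra M (past s)"
  unfolding subalgebra_def space_past sets_past using sets.sigma_sets_subset[OF past_gen_subset] by auto

lemma past_mono: "s \<le> t \<Longrightarrow> sets (past s) \<subseteq> sets (past t)"
proof -
  assume st: "s \<le> t"
  have "{D\<in>sets half_plane. D \<subseteq> {0<..s} \<times> UNIV} \<times> sets borel \<subseteq> {D\<in>sets half_plane. D \<subseteq> {0<..t} \<times> UNIV} \<times> (sets borel :: ennreal set set)"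
    using st by fastforce
  from order_trans[OF _ this] have "past_gen s \<subseteq> past_gen t"
    unfolding past_gen_def by (intro Collect_mono impI) (elim exE conjE, intro exI conjI, assumption+)
  then show ?thesis unfolding sets_past by (intro sigma_sets_mono') auto
qed

lemma null_past: "null_sets M \<subseteq> sets (past s)"
  unfolding sets_past by auto

lemma V_past: "E \<in> sets V \<Longrightarrow> E \<in> sets (past s)"
proof -
  assume E: "E \<in> sets V"
  then have "E = E \<inter> {\<omega>\<in>space M. \<forall>(D, B)\<in>{}. emeasure (p \<omega>) D \<in> B}"
    using sets.sets_into_space[OF E] space_V by auto
  with E have "E \<in> past_gen s" unfolding past_gen_def by (intro CollectI exI[of _ E] exI[of _ "{}"]) auto
  then show ?thesis unfolding sets_past by auto
qed

lemma p_past: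
  assumes "D \<in> sets half_plane" "D \<subseteq> {0<..s} \<times> UNIV"
  shows "(\<lambda>\<omega>. emeasure (p \<omega>) D) \<in> borel_measurable (past s)"
proof (rule measurableI)
  fix B :: "ennreal set" assume B: "B \<in> sets borel"
  have "(\<lambda>\<omega>. emeasure (p \<omega>) D) -` B \<inter> space M = space V \<inter> {\<omega>\<in>space M. \<forall>(D, B)\<in>{(D, B)}. emeasure (p \<omega>) D \<in> B}"
    by (auto simp: space_V)
  also have "\<dots> \<in> past_gen s"
    unfolding past_gen_def using assms B by (intro CollectI exI[of _ "space V"] exI[of _ "{(D, B)}"]) auto
  finally show "(\<lambda>\<omega>. emeasure (p \<omega>) D) -` B \<inter> space (past s) \<in> sets (past s)"
    unfolding space_past sets_past by auto
qed simp

text \<open>Sum over the possible numbers k of points. The event \<open>E\<close> and the mass on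
  the later set \<open>D\<close> are independent, so the probability of \<open>E\<close> factors out
  and the mean of the Poisson law remains.\<close>

lemma p_intensity:
  assumes E: "E \<in> sets (past s)" and D: "D \<in> sets half_plane" "D \<subseteq> {s<..} \<times> UNIV" "emeasure lborel D < \<infinity>"
  shows "(\<integral>\<^sup>+\<omega>. indicator E \<omega> * emeasure (p \<omega>) D \<partial>M) = emeasure M E * emeasure lborel D"
proof -
  let ?Q = "\<lambda>k::nat. {\<omega>\<in>space M. emeasure (p \<omega>) D = of_nat k}"
  let ?l = "measure lborel D"
  have EM: "E \<in> events" using E past_subalgebra by (auto simp: subalgebra_def)
  have Q[measurable]: "?Q k \<in> events" for k using D(1) by measurable
  have "(\<integral>\<^sup>+\<omega>. indicator E \<omega> * emeasure (p \<omega>) D \<partial>M) = (\<integral>\<^sup>+\<omega>. (\<Sum>k. of_nat k * indicator (E \<inter> ?Q k) \<omega>) \<partial>M)"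
  proof (rule nn_integral_cong_AE)
    show "AE \<omega> in M. indicator E \<omega> * emeasure (p \<omega>) D = (\<Sum>k. of_nat k * indicator (E \<inter> ?Q k) \<omega>)"
      using AE_p_nat[OF D(1,3)] AE_space
    proof eventually_elim
      case (elim \<omega>)
      then obtain k where k: "emeasure (p \<omega>) D = of_nat k" by blast
      have "(\<lambda>i. of_nat i * indicator (E \<inter> ?Q i) \<omega>) = (\<lambda>i. if i = k then of_nat k * indicator E \<omega> else (0::ennreal))"
        using elim k by (auto simp: indicator_def fun_eq_iff)
      then have "(\<lambda>i. of_nat i * indicator (E \<inter> ?Q i) \<omega>) sums (of_nat k * indicator E \<omega> :: ennreal)"
        using sums_single[of k "\<lambda>_. of_nat k * indicator E \<omega> :: ennreal"] by simp
      from sums_unique[OF this] show ?case by (simp add: k mult.commute)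
    qed
  qed
  also have "\<dots> = (\<Sum>k. of_nat k * emeasure M (E \<inter> ?Q k))"
    using EM Q by (subst nn_integral_suminf) (auto simp: nn_integral_cmult_indicator)
  also have "\<dots> = (\<Sum>k. emeasure M E * ennreal (real k * (exp (- ?l) * ?l ^ k / fact k)))"
  proof (intro suminf_cong)
    fix k
    have "prob (E \<inter> ?Q k) = prob E * (exp (- ?l) * ?l ^ k / fact k)"
      using past_indep[OF E D(1,2), of "{of_nat k}"] p_distribution[OF D(1,3), of k] by simp
    then show "of_nat k * emeasure M (E \<inter> ?Q k) = emeasure M E * ennreal (real k * (exp (- ?l) * ?l ^ k / fact k))"
      by (simp add: emeasure_eq_measure ennreal_of_nat_eq_real_of_nat ennreal_mult[symmetric] ac_simps)
  qed
  also have "\<dots> = emeasure M E * (\<Sum>k. ennreal (real k * (exp (- ?l) * ?l ^ k / fact k)))"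
    by (rule ennreal_suminf_cmult)
  also have "(\<Sum>k. ennreal (real k * (exp (- ?l) * ?l ^ k / fact k))) = ennreal ?l"
    using poisson_expectation[of ?l] by (intro suminf_ennreal_eq) auto
  also have "ennreal ?l = emeasure lborel D" using D(3) by (simp add: emeasure_eq_ennreal_measure)
  finally show ?thesis .
qed

text \<open>On the null set where \<open>p \<omega>\<close> is not locally finite it is replaced by the zero measure.\<close>

definition plane_measure :: "'a \<Rightarrow> (real \<times> real) measure" where
  "plane_measure \<omega> = (if \<omega> \<in> space M \<and> (\<forall>K. emeasure (p \<omega>) (window K) < \<infinity>)
     then distr (p \<omega>) borel (\<lambda>z. z) else null_measure borel)"

lemma window_half_plane: "window K \<in> sets half_plane"
  by (rule half_plane_setsI) (auto, auto simp: window_def)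

lemma plane_measure_eq:
  assumes "\<omega> \<in> space M" "\<forall>K. emeasure (p \<omega>) (window K) < \<infinity>" "D \<in> sets borel" "D \<subseteq> {0..} \<times> UNIV"
  shows "emeasure (plane_measure \<omega>) D = emeasure (p \<omega>) D"
proof -
  have sp: "space (p \<omega>) = {0..} \<times> UNIV"
    using sets_eq_imp_space_eq[OF sets_p[OF assms(1)]] by (simp add: half_plane_def space_restrict_space)
  have "(\<lambda>z. z) \<in> measurable (p \<omega>) borel"
    by (subst measurable_cong_sets[OF sets_p[OF assms(1)] refl], rule measurableI)
       (auto simp: half_plane_def sets_restrict_space_iff space_restrict_space strip_borel intro!: half_plane_setsI[unfolded half_plane_def] sets.Int)
  then have "emeasure (plane_measure \<omega>) D = emeasure (p \<omega>) (D \<inter> ({0..} \<times> UNIV))"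
    using assms by (simp add: plane_measure_def emeasure_distr sp)
  also have "D \<inter> ({0..} \<times> UNIV) = D" using assms(4) by auto
  finally show ?thesis .
qed

lemma AE_locally_finite: "AE \<omega> in M. \<forall>K. emeasure (p \<omega>) (window K) < \<infinity>"
proof -
  have "AE \<omega> in M. emeasure (p \<omega>) (window K) < \<infinity>" for K
    using AE_p_nat[OF window_half_plane emeasure_lborel_window[of K]]
    by eventually_elim (auto simp: of_nat_less_top)
  then show ?thesis by (subst AE_all_countable) auto
qed

lemma AE_plane_measure_eq:
  "AE \<omega> in M. \<forall>D\<in>sets borel. D \<subseteq> {0..} \<times> UNIV \<longrightarrow> emeasure (plane_measure \<omega>) D = emeasure (p \<omega>) D"
  using AE_locally_finite AE_space by eventually_elim (auto simp: plane_measure_eq)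

text \<open>Changing the random measure on a null set keeps it adapted, since \<open>past\<close>
  contains the null sets of a complete measure, and does not affect expectations.\<close>

lemma unit_intensity_plane_measure: "unit_intensity M past plane_measure"
proof (unfold_locales)
  show "sets (plane_measure \<omega>) = sets borel" for \<omega> by (simp add: plane_measure_def)
  show "emeasure (plane_measure \<omega>) (window K) < \<infinity>" for \<omega> K
  proof (cases "\<omega> \<in> space M \<and> (\<forall>K. emeasure (p \<omega>) (window K) < \<infinity>)")
    case True
    then show ?thesis by (subst plane_measure_eq) (auto, auto simp: window_def)
  qed (auto simp: plane_measure_def)
next
  fix u :: real and D :: "(real \<times> real) set"
  assume u: "0 \<le> u" and D: "D \<in> sets borel" "D \<subseteq> {0<..u} \<times> UNIV"
  have "D \<subseteq> {0..} \<times> UNIV" using D(2) by fastforce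
  then show "(\<lambda>\<omega>. emeasure (plane_measure \<omega>) D) \<in> borel_measurable (past u)"
    using AE_plane_measure_eq D
    by (intro complete_measure.measurable_AE_cong_subalgebra[OF complete past_subalgebra null_past p_past[of D u]])
       (auto intro: half_plane_setsI)
next
  fix s :: real and E and D :: "(real \<times> real) set"
  assume s: "0 \<le> s" and E: "E \<in> sets (past s)" and D: "D \<in> sets borel" "D \<subseteq> {s<..} \<times> UNIV" "emeasure lborel D < \<infinity>"
  have D': "D \<subseteq> {0..} \<times> UNIV" using D(2) s by fastforce
  have "(\<integral>\<^sup>+\<omega>. indicator E \<omega> * emeasure (plane_measure \<omega>) D \<partial>M) = (\<integral>\<^sup>+\<omega>. indicator E \<omega> * emeasure (p \<omega>) D \<partial>M)"
    using AE_plane_measure_eq by (rule nn_integral_cong_AE[OF AE_mp]) (use D D' in auto)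
  then show "(\<integral>\<^sup>+\<omega>. indicator E \<omega> * emeasure (plane_measure \<omega>) D \<partial>M) = emeasure M E * emeasure lborel D"
    using p_intensity[OF E half_plane_setsI[OF D(1) D'] D(2,3)] by simp
qed (use complete_measure.complete[OF complete] past_subalgebra past_mono null_past in auto)

end

section \<open>Atoms of Poisson random measures\<close>

text \<open>The quotient is the right end of the dyadic interval of level k that contains x.
  Together with the companion statement on left ends, this makes the dyadic boxes below
  nested.\<close>

lemma ceiling_dyadic_mono:
  fixes x :: real
  shows "real_of_int \<lceil>x * 2 ^ Suc k\<rceil> / 2 ^ Suc k \<le> real_of_int \<lceil>x * 2 ^ k\<rceil> / 2 ^ k"
proof -
  have "\<lceil>x * 2 ^ Suc k\<rceil> \<le> 2 * \<lceil>x * 2 ^ k\<rceil>"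
    by (rule ceiling_le) (use le_of_int_ceiling[of "x * 2 ^ k"] in simp)
  then have "real_of_int \<lceil>x * 2 ^ Suc k\<rceil> \<le> 2 * real_of_int \<lceil>x * 2 ^ k\<rceil>" by linarith
  then show ?thesis by (simp add: field_simps)
qed

lemma ceiling_dyadic_mono':
  fixes x :: real
  shows "(real_of_int \<lceil>x * 2 ^ k\<rceil> - 1) / 2 ^ k \<le> (real_of_int \<lceil>x * 2 ^ Suc k\<rceil> - 1) / 2 ^ Suc k"
proof -
  define c where "c = \<lceil>x * 2 ^ Suc k\<rceil>"
  have "x * 2 ^ k * 2 \<le> real_of_int c"
    using le_of_int_ceiling[of "x * 2 ^ Suc k"] by (simp add: c_def ac_simps)
  moreover define d where "d = \<lceil>x * 2 ^ k\<rceil>"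
  have "real_of_int d - 1 < x * 2 ^ k" unfolding d_def by linarith
  ultimately have "2 * d - 2 < c" by linarith
  \<comment> \<open>Both sides of the strict inequality are integers, which gains 1.\<close>
  then have "2 * (d - 1) \<le> c - 1" by presburger
  then have "real_of_int (2 * (d - 1)) \<le> real_of_int (c - 1)" by (simp only: of_int_le_iff)
  then have "2 * (real_of_int d - 1) \<le> real_of_int c - 1" by simp
  then have "2 * (real_of_int d - 1) / 2 ^ Suc k \<le> (real_of_int c - 1) / 2 ^ Suc k"
    by (intro divide_right_mono) auto
  moreover have "(real_of_int d - 1) / 2 ^ k = 2 * (real_of_int d - 1) / 2 ^ Suc k" by (simp only: power_Suc mult_divide_mult_cancel_left_if) simp
  ultimately show ?thesis unfolding c_def[symmetric] d_def[symmetric] by (simp only:)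
qed

lemma ceiling_dyadic_bounds:
  fixes x :: real
  shows
  "x \<le> real_of_int \<lceil>x * 2 ^ k\<rceil> / 2 ^ k" "(real_of_int \<lceil>x * 2 ^ k\<rceil> - 1) / 2 ^ k < x"
  "real_of_int \<lceil>x * 2 ^ k\<rceil> / 2 ^ k < x + (1/2) ^ k"
proof -
  have p: "(0::real) < 2 ^ k" by simp
  show "x \<le> real_of_int \<lceil>x * 2 ^ k\<rceil> / 2 ^ k" using p by (simp add: pos_le_divide_eq le_of_int_ceiling)
  have "real_of_int \<lceil>x * 2 ^ k\<rceil> - 1 < x * 2 ^ k" by linarith
  then show "(real_of_int \<lceil>x * 2 ^ k\<rceil> - 1) / 2 ^ k < x" using p by (simp add: pos_divide_less_eq)
  have "real_of_int \<lceil>x * 2 ^ k\<rceil> < (x + (1/2) ^ k) * 2 ^ k"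
    using \<open>real_of_int \<lceil>x * 2 ^ k\<rceil> - 1 < x * 2 ^ k\<close> by (simp add: algebra_simps power_one_over)
  then show "real_of_int \<lceil>x * 2 ^ k\<rceil> / 2 ^ k < x + (1/2) ^ k" using p by (simp add: pos_divide_less_eq)
qed

lemma half_power_eventually_less:
  fixes e :: real assumes "0 < e" obtains k where "(1/2) ^ k < e"
  using real_arch_pow_inv[of e "1/2"] assms by auto

text \<open>Only countably many boxes can be controlled almost surely; a vertical segment is a decreasing
  intersection of dyadic ones.\<close>

definition dyadic_box :: "nat \<Rightarrow> nat \<Rightarrow> int \<Rightarrow> int \<Rightarrow> (real \<times> real) set" where
  "dyadic_box K k l a = {(real_of_int l - 1) / 2 ^ k <.. real_of_int l / 2 ^ k} \<times> {- real K <.. real_of_int a / 2 ^ k}"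

lemma decreasing_dyadic_boxes:
  "decseq (\<lambda>k. dyadic_box K k \<lceil>u * 2 ^ k\<rceil> \<lceil>a * 2 ^ k\<rceil>)"
  "(\<Inter>k. dyadic_box K k \<lceil>u * 2 ^ k\<rceil> \<lceil>a * 2 ^ k\<rceil>) = {u} \<times> {- real K <.. a}"
proof -
  show "decseq (\<lambda>k. dyadic_box K k \<lceil>u * 2 ^ k\<rceil> \<lceil>a * 2 ^ k\<rceil>)"
    unfolding decseq_Suc_iff dyadic_box_def
    by (intro allI Sigma_mono Ioc_subset_iff[THEN iffD2] disjI2 conjI ceiling_dyadic_mono ceiling_dyadic_mono' order_refl)
  show "(\<Inter>k. dyadic_box K k \<lceil>u * 2 ^ k\<rceil> \<lceil>a * 2 ^ k\<rceil>) = {u} \<times> {- real K <.. a}"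
  proof (intro equalityI subsetI)
    fix z assume z: "z \<in> (\<Inter>k. dyadic_box K k \<lceil>u * 2 ^ k\<rceil> \<lceil>a * 2 ^ k\<rceil>)"
    obtain w v where wv: "z = (w, v)" by force
    have in_box: "(real_of_int \<lceil>u * 2 ^ k\<rceil> - 1) / 2 ^ k < w" "w \<le> real_of_int \<lceil>u * 2 ^ k\<rceil> / 2 ^ k"
      "- real K < v" "v \<le> real_of_int \<lceil>a * 2 ^ k\<rceil> / 2 ^ k" for k
      using z by (auto simp: wv dyadic_box_def)
    have "v \<le> a"
    proof (rule ccontr)
      assume "\<not> v \<le> a"
      then obtain k where "(1/2) ^ k < v - a" using half_power_eventually_less[of "v - a"] by auto
      with in_box(4)[of k] ceiling_dyadic_bounds(3)[of a k] show False by linarith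
    qed
    moreover have "w \<le> u"
    proof (rule ccontr)
      assume "\<not> w \<le> u"
      then obtain k where "(1/2) ^ k < w - u" using half_power_eventually_less[of "w - u"] by auto
      with in_box(2)[of k] ceiling_dyadic_bounds(3)[of u k] show False by linarith
    qed
    moreover have "u \<le> w"
    proof (rule ccontr)
      assume "\<not> u \<le> w"
      then obtain k where k: "(1/2) ^ k < u - w" using half_power_eventually_less[of "u - w"] by auto
      have "u - (1/2) ^ k \<le> (real_of_int \<lceil>u * 2 ^ k\<rceil> - 1) / 2 ^ k"
        using ceiling_dyadic_bounds(1)[of u k] unfolding power_one_over diff_divide_distrib by linarith
      with in_box(1)[of k] k show False by linarith
    qed
    ultimately show "z \<in> {u} \<times> {- real K <.. a}" using in_box(3) by (auto simp: wv)
  next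
    fix z assume "z \<in> {u} \<times> {- real K <.. a}"
    then show "z \<in> (\<Inter>k. dyadic_box K k \<lceil>u * 2 ^ k\<rceil> \<lceil>a * 2 ^ k\<rceil>)"
      using ceiling_dyadic_bounds[of u] ceiling_dyadic_bounds(1)[of a]
      by (force simp: dyadic_box_def intro: order_trans)
  qed
qed

lemma nat_valued_Ints: "x = (of_nat k :: ennreal) \<Longrightarrow> enn2real x \<in> \<int>"
  by (simp add: enn2real_of_nat)

lemma Ints_suminf:
  fixes f :: "nat \<Rightarrow> real"
  assumes "f sums s" "\<And>i. f i \<in> \<int>" shows "s \<in> \<int>"
proof (rule closed_sequentially[OF closed_Ints])
  show "(\<lambda>n. \<Sum>i<n. f i) \<longlonglongrightarrow> s" using assms(1) by (simp add: sums_def)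
  show "(\<Sum>i<n. f i) \<in> \<int>" for n using assms(2) by (intro Ints_sum) auto
qed

text \<open>Sets of integer measure are closed under complements and disjoint unions, because
  differences and limits of integers are integers. Half-lines generate the Borel sets and are closed
  under intersection, so they decide.\<close>

lemma Ints_valued_borel:
  fixes M :: "real measure"
  assumes fin: "finite_measure M" and M: "sets M = sets borel"
    and atMost: "\<And>a. measure M {..a} \<in> \<int>" and C: "C \<in> sets borel"
  shows "measure M C \<in> \<int>"
proof -
  interpret finite_measure M by fact
  have sp: "space M = UNIV" using sets_eq_imp_space_eq[OF M] by simp
  have top: "measure M UNIV \<in> \<int>"
  proof (rule closed_sequentially[OF closed_Ints])
    have "(\<Union>k. {..real k}) = UNIV" using real_arch_simple by auto
    moreover have "range (\<lambda>k. {..real k}) \<subseteq> sets M" "incseq (\<lambda>k. {..real k})" by (auto simp: M incseq_def)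
    ultimately show "(\<lambda>k. measure M {..real k}) \<longlonglongrightarrow> measure M UNIV"
      using finite_Lim_measure_incseq[of "\<lambda>k. {..real k}"] by simp
  qed (rule atMost)
  have C': "C \<in> sigma_sets UNIV (range (\<lambda>a. {..a::real}))"
    using C unfolding borel_eq_atMost by simp
  have stable: "Int_stable (range (\<lambda>a. {..a::real}))" by (auto simp: Int_stable_def)
  have closed: "range (\<lambda>a. {..a::real}) \<subseteq> Pow UNIV" by simp
  show ?thesis
    using stable closed C'
  proof (induction C rule: sigma_sets_induct_disjoint)
    case (compl A)
    then have "A \<in> sets M" unfolding M borel_eq_atMost by simp
    then show ?case using compl(2) top finite_measure_compl[of A] by (simp add: sp)
  next
    case (union A)
    then have "range A \<subseteq> sets M" unfolding M borel_eq_atMost by auto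
    from Ints_suminf[OF finite_measure_UNION[OF this union(1)] union(3)] show ?case .
  qed (use atMost in auto)
qed

section \<open>At most one atom at each time\<close>

context poisson_process
begin

lemma dyadic_box_half_plane: "1 \<le> l \<Longrightarrow> dyadic_box K k l a \<in> sets half_plane"
proof (rule half_plane_setsI)
  show "dyadic_box K k l a \<in> sets borel"
    unfolding dyadic_box_def borel_prod[symmetric] by (intro pair_measureI) auto
  assume "1 \<le> l"
  then have "0 \<le> (real_of_int l - 1) / 2 ^ k" by simp
  then show "dyadic_box K k l a \<subseteq> {0..} \<times> UNIV" unfolding dyadic_box_def by (auto intro: order_trans less_imp_le)
qed

lemma dyadic_box_finite: "emeasure lborel (dyadic_box K k l a) < \<infinity>"
proof -
  have "emeasure lborel (dyadic_box K k l a) \<le> emeasure lborel (cbox ((real_of_int l - 1) / 2 ^ k, - real K) (real_of_int l / 2 ^ k, real_of_int a / 2 ^ k))"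
    by (intro emeasure_mono) (simp_all, auto simp: dyadic_box_def cbox_Pair_eq)
  also have "\<dots> < \<infinity>" by (rule emeasure_lborel_cbox_finite)
  finally show ?thesis .
qed

lemma AE_dyadic_nat:
  "AE \<omega> in M. \<forall>K k l a. 1 \<le> l \<longrightarrow> (\<exists>n::nat. emeasure (p \<omega>) (dyadic_box K k l a) = of_nat n)"
  using AE_p_nat[OF dyadic_box_half_plane dyadic_box_finite] by (simp add: AE_all_countable)

lemma prob_two_points:
  assumes D: "D \<in> sets half_plane" "emeasure lborel D < \<infinity>"
  shows "prob {\<omega>\<in>space M. emeasure (p \<omega>) D \<notin> {0, 1}} \<le> (measure lborel D)\<^sup>2"
proof -
  let ?l = "measure lborel D"
  let ?Q = "\<lambda>k::nat. {\<omega>\<in>space M. emeasure (p \<omega>) D = of_nat k}"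
  have Q: "?Q k \<in> events" for k using D(1) by measurable
  have "{\<omega>\<in>space M. emeasure (p \<omega>) D \<notin> {0, 1}} = space M - (?Q 0 \<union> ?Q 1)" by auto
  then have "prob {\<omega>\<in>space M. emeasure (p \<omega>) D \<notin> {0, 1}} = 1 - prob (?Q 0 \<union> ?Q 1)"
    using Q by (simp only: prob_compl sets.Un)
  also have "prob (?Q 0 \<union> ?Q 1) = prob (?Q 0) + prob (?Q 1)"
    by (intro finite_measure_Union Q) auto
  also have "prob (?Q 0) = exp (- ?l)" using p_distribution[OF D, of 0] by simp
  also have "prob (?Q 1) = exp (- ?l) * ?l" using p_distribution[OF D, of 1] by simp
  \<comment> \<open>From \<open>exp (- l) \<ge> 1 - l\<close> it follows that
    \<open>exp (- l) * (1 + l) \<ge> 1 - l\<^sup>2\<close>.\<close>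
  also have "1 - (exp (- ?l) + exp (- ?l) * ?l) \<le> ?l\<^sup>2"
  proof -
    have "(1 - ?l) * (1 + ?l) \<le> exp (- ?l) * (1 + ?l)"
      using exp_ge_add_one_self[of "- ?l"] by (intro mult_right_mono) auto
    then show ?thesis by (simp add: algebra_simps power2_eq_square)
  qed
  finally show ?thesis .
qed

text \<open>For k < n these are the n strips of width K / n into which the window with bound K is
  cut.\<close>

definition strip_cell :: "nat \<Rightarrow> nat \<Rightarrow> nat \<Rightarrow> (real \<times> real) set" where
  "strip_cell K n k = {real K * real k / real n <.. real K * real (Suc k) / real n} \<times> {- real K .. real K}"

lemma strip_cell_half_plane: "strip_cell K n k \<in> sets half_plane"
proof (rule half_plane_setsI)
  show "strip_cell K n k \<in> sets borel"
    unfolding strip_cell_def borel_prod[symmetric] by (intro pair_measureI) auto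
  have "0 \<le> real K * real k / real n" by simp
  then show "strip_cell K n k \<subseteq> {0..} \<times> UNIV" unfolding strip_cell_def
    by (intro Sigma_mono subset_UNIV subsetI) (simp only: greaterThanAtMost_iff atLeast_iff, linarith)
qed

lemma measure_strip_cell:
  assumes "0 < n"
  shows "emeasure lborel (strip_cell K n k) = ennreal (2 * (real K)\<^sup>2 / real n)"
proof -
  have "emeasure lborel (strip_cell K n k) =
    emeasure (lborel :: real measure) {real K * real k / real n <.. real K * real (Suc k) / real n} * emeasure lborel {- real K .. real K}"
    unfolding strip_cell_def lborel_prod[symmetric] by (intro lborel.emeasure_pair_measure_Times) auto
  also have "\<dots> = ennreal (real K * real (Suc k) / real n - real K * real k / real n) * ennreal (2 * real K)"
    by (simp add: divide_right_mono mult_left_mono)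
  also have "real K * real (Suc k) / real n - real K * real k / real n = real K / real n"
    by (simp add: diff_divide_distrib[symmetric] algebra_simps)
  finally show ?thesis by (simp add: ennreal_mult[symmetric] power2_eq_square mult_ac)
qed

text \<open>If \<open>(0, K]\<close> is cut into \<open>n\<close> intervals, each strip contains two or more atoms with probability
  \<open>O(1/n\<^sup>2)\<close>, so some strip does with probability \<open>O(1/n)\<close>.\<close>

lemma AE_simple_window:
  "AE \<omega> in M. \<forall>u. 0 < u \<and> u \<le> real K \<longrightarrow> emeasure (p \<omega>) ({u} \<times> {- real K..real K}) \<le> 1"
proof -
  define bad where "bad n k = {\<omega>\<in>space M. emeasure (p \<omega>) (strip_cell K n k) \<notin> {0, 1}}" for n k
  \<comment> \<open>A path is bad only if every subdivision has a strip whose mass is neither 0 nor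
    1; a single good subdivision suffices to bound the mass of all vertical segments.\<close>
  let ?Bad = "\<Inter>n\<in>{1..}. \<Union>k\<in>{..<n}. bad n k"
  have bad: "bad n k \<in> events" for n k unfolding bad_def using strip_cell_half_plane by measurable
  have Bad: "?Bad \<in> events"
    using bad by (intro sets.countable_INT' image_subsetI sets.finite_UN) auto
  have le: "prob ?Bad \<le> 4 * (real K) ^ 4 / real n" if n: "1 \<le> n" for n
  proof -
    have "prob ?Bad \<le> prob (\<Union>k\<in>{..<n}. bad n k)"
      using n bad by (intro finite_measure_mono sets.finite_UN) auto
    also have "\<dots> \<le> (\<Sum>k<n. prob (bad n k))"
      using bad by (intro finite_measure_subadditive_finite) auto
    also have "\<dots> \<le> (\<Sum>k<n. (2 * (real K)\<^sup>2 / real n)\<^sup>2)"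
    proof (rule sum_mono)
      fix k
      have m: "emeasure lborel (strip_cell K n k) = ennreal (2 * (real K)\<^sup>2 / real n)"
        using n by (intro measure_strip_cell) auto
      then have "measure lborel (strip_cell K n k) = 2 * (real K)\<^sup>2 / real n" by (simp add: measure_def)
      then show "prob (bad n k) \<le> (2 * (real K)\<^sup>2 / real n)\<^sup>2"
        using prob_two_points[OF strip_cell_half_plane, of K n k] m by (simp add: bad_def)
    qed
    also have "\<dots> = 4 * (real K) ^ 4 / real n"
      using n by (simp add: power_divide power_mult_distrib power2_eq_square eval_nat_numeral field_simps)
    finally show ?thesis .
  qed
  have "prob ?Bad = 0"
  proof (rule ccontr)
    assume "prob ?Bad \<noteq> 0"
    then have pos: "0 < prob ?Bad" by (simp add: zero_less_measure_iff)
    obtain n :: nat where "4 * (real K) ^ 4 / prob ?Bad < real n" using reals_Archimedean2 by blast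
    then have "4 * (real K) ^ 4 / prob ?Bad < real (max 1 n)" by linarith
    with pos have "4 * (real K) ^ 4 / real (max 1 n) < prob ?Bad" by (simp add: field_simps)
    with le[of "max 1 n"] show False by simp
  qed
  then have "AE \<omega> in M. \<omega> \<notin> ?Bad"
    using Bad by (intro AE_not_in) (simp add: null_sets_def emeasure_eq_measure)
  then show ?thesis using AE_space
  proof eventually_elim
    case (elim \<omega>)
    then obtain n where n: "1 \<le> n" and good: "\<And>k. k < n \<Longrightarrow> emeasure (p \<omega>) (strip_cell K n k) \<in> {0, 1}"
      by (auto simp: bad_def)
    show ?case
    proof (intro allI impI)
      fix u assume u: "0 < u \<and> u \<le> real K"
      then have K: "0 < real K" by linarith
      \<comment> \<open>\<open>l\<close> is the number, counted from 1, of the strip that contains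
        the vertical segment at u; \<open>k\<close> is the same number counted from 0.\<close>
      define l where "l = \<lceil>u * real n / real K\<rceil>"
      have l: "u * real n / real K \<le> real_of_int l" "real_of_int l - 1 < u * real n / real K"
        unfolding l_def by linarith+
      have "0 < u * real n / real K" using u n K by simp
      then have l1: "1 \<le> l" using l(1) by linarith
      have "u * real n / real K \<le> real n" using u n K by (simp add: pos_divide_le_eq)
      then have ln: "l \<le> int n" unfolding l_def by (simp add: ceiling_le_iff)
      define k where "k = nat (l - 1)"
      have k: "real k = real_of_int l - 1" "k < n" "real (Suc k) = real_of_int l" using l1 ln by (auto simp: k_def)
      have "{u} \<times> {- real K..real K} \<subseteq> strip_cell K n k"
        unfolding strip_cell_def k(1,3) using l K n by (auto simp: field_simps)
      then have "emeasure (p \<omega>) ({u} \<times> {- real K..real K}) \<le> emeasure (p \<omega>) (strip_cell K n k)"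
        using strip_cell_half_plane sets_p[OF elim(2)] by (intro emeasure_mono) auto
      also have "\<dots> \<le> 1" using good[OF k(2)] by auto
      finally show "emeasure (p \<omega>) ({u} \<times> {- real K..real K}) \<le> 1" .
    qed
  qed
qed

lemma vertical_half_plane: "0 \<le> u \<Longrightarrow> C \<in> sets borel \<Longrightarrow> {u} \<times> C \<in> sets half_plane"
  by (rule half_plane_setsI) (auto simp: borel_prod[symmetric] intro!: pair_measureI)

text \<open>The exceptional set must not depend on u or C. A vertical line has mass at most 1 by the
  strip argument, and integer mass on each of its Borel sets: the countably many dyadic boxes have
  integer masses, these pass to segments and half-lines by limits, and half-lines determine the
  rest.\<close>

theorem AE_atoms:
  "AE \<omega> in M. \<forall>u>0. \<forall>C\<in>sets borel. emeasure (p \<omega>) ({u} \<times> C) \<in> {0, 1}"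
proof -
  have "AE \<omega> in M. \<forall>K u. 0 < u \<and> u \<le> real K \<longrightarrow> emeasure (p \<omega>) ({u} \<times> {- real K..real K}) \<le> 1"
    using AE_simple_window by (simp add: AE_all_countable)
  then show ?thesis using AE_dyadic_nat AE_space
  proof eventually_elim
    case (elim \<omega>)
    note simple = elim(1) and dyadic = elim(2) and \<omega> = elim(3)
    show ?case
    proof (intro allI impI)
      fix u :: real assume u: "0 < u"
      note V = vertical_half_plane[OF less_imp_le[OF u]]
      have le1: "emeasure (p \<omega>) ({u} \<times> UNIV) \<le> 1"
      proof -
        have "(SUP K. emeasure (p \<omega>) ({u} \<times> {- real K..real K})) = emeasure (p \<omega>) (\<Union>K. {u} \<times> {- real K..real K})"
          using V sets_p[OF \<omega>] by (intro SUP_emeasure_incseq) (auto simp: incseq_def)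
        also have "(\<Union>K. {u} \<times> {- real K..real K}) = {u} \<times> UNIV"
        proof -
          have "\<exists>K. - real K \<le> v \<and> v \<le> real K" for v :: real
          proof -
            obtain K where "\<bar>v\<bar> \<le> real K" using real_arch_simple by blast
            then show ?thesis by (intro exI[of _ K]) auto
          qed
          then show ?thesis by auto
        qed
        finally have "emeasure (p \<omega>) ({u} \<times> UNIV) = (SUP K. emeasure (p \<omega>) ({u} \<times> {- real K..real K}))" ..
        also have "\<dots> \<le> 1"
        proof (rule SUP_least)
          fix K :: nat
          obtain K' :: nat where "max u (real K) \<le> real K'" using real_arch_simple by blast
          then have K': "u \<le> real K'" "real K \<le> real K'" by auto
          then have "emeasure (p \<omega>) ({u} \<times> {- real K..real K}) \<le> emeasure (p \<omega>) ({u} \<times> {- real K'..real K'})"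
            using V sets_p[OF \<omega>] by (intro emeasure_mono) auto
          also have "\<dots> \<le> 1" using simple u K' by blast
          finally show "emeasure (p \<omega>) ({u} \<times> {- real K..real K}) \<le> 1" .
        qed
        finally show ?thesis .
      qed
      have sp: "space (p \<omega>) = {0..} \<times> UNIV"
        using sets_eq_imp_space_eq[OF sets_p[OF \<omega>]] by (simp add: half_plane_def space_restrict_space)
      \<comment> \<open>The random measure on the line at u, read as a measure on the reals.\<close>
      define \<nu> where "\<nu> = distr (restrict_space (p \<omega>) ({u} \<times> UNIV)) borel snd"
      have snd_meas: "snd \<in> measurable (restrict_space (p \<omega>) ({u} \<times> UNIV)) borel"
      proof (rule measurableI)
        fix C :: "real set" assume C: "C \<in> sets borel"
        have "snd -` C \<inter> space (restrict_space (p \<omega>) ({u} \<times> UNIV)) = {u} \<times> C"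
          using u by (auto simp: space_restrict_space sp)
        then show "snd -` C \<inter> space (restrict_space (p \<omega>) ({u} \<times> UNIV)) \<in> sets (restrict_space (p \<omega>) ({u} \<times> UNIV))"
          using V[OF C] V[of UNIV] sets_p[OF \<omega>] by (simp add: sets_restrict_space_iff) auto
      qed simp
      have \<nu>: "emeasure \<nu> C = emeasure (p \<omega>) ({u} \<times> C)" if C: "C \<in> sets borel" for C
      proof -
        have "snd -` C \<inter> space (restrict_space (p \<omega>) ({u} \<times> UNIV)) = {u} \<times> C"
          using u by (auto simp: space_restrict_space sp)
        then show ?thesis
          unfolding \<nu>_def emeasure_distr[OF snd_meas C]
          using V[of UNIV] sets_p[OF \<omega>] by (subst emeasure_restrict_space) auto
      qed
      interpret \<nu>: finite_measure \<nu>
      proof (rule finite_measureI)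
        have "space \<nu> = UNIV" by (simp add: \<nu>_def)
        then show "emeasure \<nu> (space \<nu>) \<noteq> \<infinity>" using le1 by (auto simp: \<nu> top_unique)
      qed
      have "measure \<nu> C \<in> \<int>" if C: "C \<in> sets borel" for C
      proof (rule Ints_valued_borel[OF \<nu>.finite_measure_axioms _ _ C])
        show "sets \<nu> = sets borel" by (simp add: \<nu>_def)
        fix a :: real
        show "measure \<nu> {..a} \<in> \<int>"
        proof (rule closed_sequentially[OF closed_Ints])
          have "(\<Union>K. {- real K<..a}) = {..a}"
          proof -
            have "\<exists>K. - real K < v" for v :: real using reals_Archimedean2[of "- v"] by (auto simp: minus_less_iff)
            then show ?thesis by auto
          qed
          moreover have "range (\<lambda>K. {- real K<..a}) \<subseteq> sets \<nu>" "incseq (\<lambda>K. {- real K<..a})"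
            by (auto simp: \<nu>_def incseq_def)
          ultimately show "(\<lambda>K. measure \<nu> {- real K<..a}) \<longlonglongrightarrow> measure \<nu> {..a}"
            using \<nu>.finite_Lim_measure_incseq[of "\<lambda>K. {- real K<..a}"] by simp
        next
          fix K
          let ?J = "\<lambda>k. dyadic_box K k \<lceil>u * 2 ^ k\<rceil> \<lceil>a * 2 ^ k\<rceil>"
          \<comment> \<open>Since u > 0, the boxes have index at least 1 and stay in the right
            half-plane.\<close>
          have pos: "1 \<le> \<lceil>u * 2 ^ k\<rceil>" for k using u by (simp add: one_le_ceiling)
          then have J: "?J k \<in> sets (p \<omega>)" for k using dyadic_box_half_plane sets_p[OF \<omega>] by simp
          have nat: "\<exists>n::nat. emeasure (p \<omega>) (?J k) = of_nat n" for k using dyadic pos by blast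
          have "(\<lambda>k. emeasure (p \<omega>) (?J k)) \<longlonglongrightarrow> emeasure (p \<omega>) (\<Inter>k. ?J k)"
          proof (rule Lim_emeasure_decseq)
            show "emeasure (p \<omega>) (?J k) \<noteq> \<infinity>" for k using nat[of k] by auto
          qed (use J decreasing_dyadic_boxes(1) in auto)
          then have "(\<lambda>k. enn2real (emeasure (p \<omega>) (?J k))) \<longlonglongrightarrow> enn2real (emeasure \<nu> {- real K<..a})"
            unfolding decreasing_dyadic_boxes(2)
            using \<nu>.emeasure_finite[of "{- real K<..a}"] by (intro tendsto_enn2real) (auto simp: \<nu> less_top[symmetric])
          moreover have "enn2real (emeasure (p \<omega>) (?J k)) \<in> \<int>" for k using nat[of k] by (elim exE nat_valued_Ints)
          ultimately show "measure \<nu> {- real K<..a} \<in> \<int>"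
            unfolding measure_def by (rule closed_sequentially[OF closed_Ints, rotated])
        qed
      qed
      show "\<forall>C\<in>sets borel. emeasure (p \<omega>) ({u} \<times> C) \<in> {0, 1}"
      proof
        fix C :: "real set" assume C: "C \<in> sets borel"
        have "emeasure \<nu> C \<le> emeasure \<nu> UNIV" using C by (intro emeasure_mono) (auto simp: \<nu>_def)
        then have "measure \<nu> C \<le> 1"
          using le1 by (simp add: \<nu> measure_def enn2real_leI)
        moreover obtain i where i: "measure \<nu> C = of_int i" using \<open>\<And>C. C \<in> sets borel \<Longrightarrow> measure \<nu> C \<in> \<int>\<close>[OF C] by (auto elim: Ints_cases)
        ultimately have "0 \<le> i" "i \<le> 1" using measure_nonneg[of \<nu> C] by auto
        then have "i = 0 \<or> i = 1" by auto
        then have "measure \<nu> C \<in> {0, 1}" using i by auto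
        then show "emeasure (p \<omega>) ({u} \<times> C) \<in> {0, 1}"
          using \<nu>[OF C] by (auto simp: \<nu>.emeasure_eq_measure)
      qed
    qed
  qed
qed

end

section \<open>Jumps of the solution\<close>

lemma isCont_if_locally_constant:
  fixes x :: "real \<Rightarrow> 's :: topological_space"
  assumes "a < t" "t < b" "\<And>s. a < s \<Longrightarrow> s < b \<Longrightarrow> x s = c"
  shows "isCont x t"
proof -
  have "eventually (\<lambda>s. s \<in> {a<..<b}) (nhds t)"
    using assms(1,2) by (intro eventually_nhds_in_open) auto
  then have "eventually (\<lambda>s. x s = c) (nhds t)" by eventually_elim (use assms(3) in auto)
  then have "isCont x t \<longleftrightarrow> isCont (\<lambda>_. c) t" by (rule isCont_cong)
  then show ?thesis by simp
qed

text \<open>Constancy before \<open>T\<close> excludes earlier discontinuities, and at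
  \<open>T\<close> the left limit c differs from the value.\<close>

lemma jump_time_eqI:
  fixes x :: "real \<Rightarrow> nat"
  assumes b: "jump_time x n < T" and const: "\<And>s. jump_time x n \<le> s \<Longrightarrow> s < T \<Longrightarrow> x s = c" and T: "x T \<noteq> c"
  shows "jump_time x (Suc n) = T" "\<not> isCont x T"
proof -
  show disc: "\<not> isCont x T"
  proof
    assume "isCont x T"
    then have "(x \<longlongrightarrow> x T) (at_left T)" by (auto simp: isCont_def intro: tendsto_within_subset)
    then have "eventually (\<lambda>s. x s = x T) (at_left T)" by (simp add: tendsto_discrete)
    moreover have "eventually (\<lambda>s. x s = c) (at_left T)"
      unfolding eventually_at_left[OF b] using b const by (intro exI[of _ "jump_time x n"]) auto
    ultimately have "eventually (\<lambda>s. False) (at_left T)" by eventually_elim (use T in auto)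
    then show False by simp
  qed
  have "Inf {t. jump_time x n < t \<and> \<not> isCont x t} = T"
  proof (rule cInf_eq_minimum)
    show "T \<in> {t. jump_time x n < t \<and> \<not> isCont x t}" using b disc by simp
    fix t assume t: "t \<in> {t. jump_time x n < t \<and> \<not> isCont x t}"
    then show "T \<le> t" using isCont_if_locally_constant[of "jump_time x n" t T x c] const by force
  qed
  then show "jump_time x (Suc n) = T" by simp
qed

declare jump_time.simps(2)[simp del]

text \<open>\<open>q\<close> is a measure on the whole plane, whereas a solution is driven by a
  measure on the right half-plane; \<open>paths\<close> asks that the two agree on the Borel subsets
  of the half-plane.\<close>

locale semi_markov_process = transition_rates r lam lamt + unit_intensity M G q
  for r lam lamt and M :: "'a measure" and G q +
  fixes X :: "real \<Rightarrow> 'a \<Rightarrow> nat" and Y :: "real \<Rightarrow> 'a \<Rightarrow> real" and N :: "real \<Rightarrow> 'a \<Rightarrow> nat"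
  assumes X_0: "X 0 \<in> measurable (G 0) (count_space UNIV)"
    and Y_0: "Y 0 \<in> borel_measurable (G 0)"
    and X_0_states: "\<omega> \<in> space M \<Longrightarrow> X 0 \<omega> \<in> states"
    and Y_0_nonneg: "\<omega> \<in> space M \<Longrightarrow> 0 \<le> Y 0 \<omega>"
    and paths: "AE \<omega> in M. \<exists>m. solution_path r lam lamt m (\<lambda>t. X t \<omega>) (\<lambda>t. Y t \<omega>) (\<lambda>t. N t \<omega>) \<and>
        (\<forall>D\<in>sets borel. D \<subseteq> {0..} \<times> UNIV \<longrightarrow> emeasure (q \<omega>) D = emeasure m D)"
begin

abbreviation T :: "nat \<Rightarrow> 'a \<Rightarrow> real" where
  "T n \<omega> \<equiv> jump_time (\<lambda>t. X t \<omega>) n"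

text \<open>During the sojourn that starts at \<open>T n\<close> the age at time \<open>u\<close> is \<open>u - origin n\<close>; this differs from
  \<open>u - T n\<close> only for \<open>n = 0\<close>.\<close>

definition origin :: "nat \<Rightarrow> 'a \<Rightarrow> real" where
  "origin = transition_time (\<lambda>\<omega>. - Y 0 \<omega>) X"

definition state :: "nat \<Rightarrow> 'a \<Rightarrow> nat" where
  "state = embedded X origin"

lemma origin_0: "origin 0 \<omega> = - Y 0 \<omega>" and origin_Suc: "origin (Suc n) \<omega> = T (Suc n) \<omega>"
  by (simp_all add: origin_def transition_time_def)

lemma state_eq: "state n \<omega> = X (T n \<omega>) \<omega>"
  by (cases n) (simp_all add: state_def embedded_def origin_def transition_time_def)

lemma origin_le: "\<omega> \<in> space M \<Longrightarrow> origin n \<omega> \<le> T n \<omega>"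
  using Y_0_nonneg by (cases n) (auto simp: origin_0 origin_Suc)

text \<open>\<open>jump_time\<close> takes an arbitrary value when no further discontinuity exists;
  \<open>stage n\<close> certifies that the n-th jump time is genuine and records the system there.
  The comparison with earlier jump times will allow the whole history to be read off at
  \<open>T n\<close>.\<close>

definition stage :: "nat \<Rightarrow> 'a \<Rightarrow> bool" where
  "stage n \<omega> \<longleftrightarrow> 0 \<le> T n \<omega> \<and> N (T n \<omega>) \<omega> = n \<and> Y (T n \<omega>) \<omega> = T n \<omega> - origin n \<omega> \<and>
     state n \<omega> \<in> states \<and> (\<forall>k\<le>n. T k \<omega> \<le> T n \<omega>)"

text \<open>The candidates for the atom that causes the jump number n + 1, with target j. They are
  not cut off at \<open>T (Suc n)\<close>, whose existence is still open; the cut is made by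
  \<open>fresh\<close>.\<close>

definition reg :: "nat \<Rightarrow> nat \<Rightarrow> ('a \<times> real \<times> real) set" where
  "reg n j = {(\<omega>, u, v). \<omega> \<in> space M \<and> 0 < u \<and> T n \<omega> < u \<and> j \<in> states - {state n \<omega>} \<and>
     state n \<omega> \<in> states \<and> v \<in> \<Lambda> (state n \<omega>) j (u - origin n \<omega>) n}"

definition exits :: "nat \<Rightarrow> ('a \<times> real \<times> real) set" where
  "exits n = (\<Union>j. reg n j)"

text \<open>The condition \<open>u \<le> T (Suc n) \<omega>\<close>, expressed without presupposing that a further jump exists.\<close>

definition fresh :: "nat \<Rightarrow> ('a \<times> real \<times> real) set" where
  "fresh n = {(\<omega>, u, v). \<omega> \<in> space M \<and> 0 < u \<and> emeasure (q \<omega>) (Pair \<omega> -` exits n \<inter> ({0<..<u} \<times> UNIV)) = 0}"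

text \<open>Besides the path this records how \<open>q\<close> sees the jump: no mass of candidates
  before \<open>T (Suc n)\<close>, and at that time a mass 1 in the interval of the new
  state.\<close>

definition jump :: "nat \<Rightarrow> 'a \<Rightarrow> bool" where
  "jump n \<omega> \<longleftrightarrow> T n \<omega> < T (Suc n) \<omega> \<and> (\<forall>s. T n \<omega> \<le> s \<and> s < T (Suc n) \<omega> \<longrightarrow> X s \<omega> = state n \<omega>) \<and>
     \<not> isCont (\<lambda>t. X t \<omega>) (T (Suc n) \<omega>) \<and> state (Suc n) \<omega> \<noteq> state n \<omega> \<and> stage n \<omega> \<and> stage (Suc n) \<omega> \<and>
     emeasure (q \<omega>) (Pair \<omega> -` exits n \<inter> {..<T (Suc n) \<omega>} \<times> UNIV) = 0 \<and>
     (\<forall>j\<in>states - {state n \<omega>}.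
        emeasure (q \<omega>) ({T (Suc n) \<omega>} \<times> \<Lambda> (state n \<omega>) j (T (Suc n) \<omega> - origin n \<omega>) n) =
        (if j = state (Suc n) \<omega> then 1 else 0)) \<and>
     emeasure (q \<omega>) ({T (Suc n) \<omega>} \<times> exit_set (state n \<omega>) (T (Suc n) \<omega> - origin n \<omega>) n) = 1"

lemma
  assumes "jump n \<omega>"
  shows jump_less: "T n \<omega> < T (Suc n) \<omega>"
    and jump_const: "T n \<omega> \<le> s \<Longrightarrow> s < T (Suc n) \<omega> \<Longrightarrow> X s \<omega> = state n \<omega>"
    and jump_discontinuous: "\<not> isCont (\<lambda>t. X t \<omega>) (T (Suc n) \<omega>)"
    and jump_state_neq: "state (Suc n) \<omega> \<noteq> state n \<omega>"
    and jump_stage: "stage n \<omega>" and jump_stage_Suc: "stage (Suc n) \<omega>"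
    and jump_before: "emeasure (q \<omega>) (Pair \<omega> -` exits n \<inter> {..<T (Suc n) \<omega>} \<times> UNIV) = 0"
    and jump_cell: "j \<in> states - {state n \<omega>} \<Longrightarrow>
        emeasure (q \<omega>) ({T (Suc n) \<omega>} \<times> \<Lambda> (state n \<omega>) j (T (Suc n) \<omega> - origin n \<omega>) n) =
        (if j = state (Suc n) \<omega> then 1 else 0)"
    and jump_exit: "emeasure (q \<omega>) ({T (Suc n) \<omega>} \<times> exit_set (state n \<omega>) (T (Suc n) \<omega> - origin n \<omega>) n) = 1"
  using assms unfolding jump_def by blast+

lemma jump_pos: "jump n \<omega> \<Longrightarrow> 0 < T (Suc n) \<omega>"
  using jump_less[of n \<omega>] jump_stage[of n \<omega>] by (simp add: stage_def)

lemma AE_stage_0: "AE \<omega> in M. stage 0 \<omega>"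
  using paths AE_space
proof eventually_elim
  case (elim \<omega>)
  then obtain m where "solution_path r lam lamt m (\<lambda>t. X t \<omega>) (\<lambda>t. Y t \<omega>) (\<lambda>t. N t \<omega>)" by blast
  then have "N 0 \<omega> = 0" by (rule solution_path.N_0)
  then show ?case using X_0_states[OF elim(2)] by (simp add: stage_def origin_0 state_eq)
qed

lemma exits_section:
  assumes "\<omega> \<in> space M" "stage n \<omega>"
  shows "Pair \<omega> -` exits n = {(u, v). T n \<omega> < u \<and> v \<in> exit_set (state n \<omega>) (u - origin n \<omega>) n}"
  using assms by (auto simp: exits_def reg_def exit_set_def stage_def)

text \<open>The pathwise alternative at time \<open>T n\<close>: either the candidates carry no mass
  at all, or the next jump takes place. The former will be excluded almost surely by
  \<open>A2\<close>.\<close>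

lemma stage_dichotomy:
  "AE \<omega> in M. stage n \<omega> \<longrightarrow> emeasure (q \<omega>) (Pair \<omega> -` exits n) = 0 \<or> jump n \<omega>"
  using paths AE_space
proof eventually_elim
  case (elim \<omega>)
  then obtain m where m: "solution_path r lam lamt m (\<lambda>t. X t \<omega>) (\<lambda>t. Y t \<omega>) (\<lambda>t. N t \<omega>)"
    and qm: "\<And>D. D \<in> sets borel \<Longrightarrow> D \<subseteq> {0..} \<times> UNIV \<Longrightarrow> emeasure (q \<omega>) D = emeasure m D" by blast
  interpret sp: solution_path r lam lamt m "\<lambda>t. X t \<omega>" "\<lambda>t. Y t \<omega>" "\<lambda>t. N t \<omega>" by (rule m)
  show ?case
  proof
    assume st: "stage n \<omega>"
    let ?b = "T n \<omega>"
    have b: "0 \<le> ?b" and Nb: "N ?b \<omega> = n" and Yb: "u - ?b + Y ?b \<omega> = u - origin n \<omega>" and Xb: "X ?b \<omega> = state n \<omega>" for u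
      using st by (auto simp: stage_def state_eq)
    have region: "sp.region ?b = Pair \<omega> -` exits n"
      unfolding sp.region_def exits_section[OF elim(2) st] Nb Yb Xb ..
    have R: "Pair \<omega> -` exits n \<inter> C \<in> sets borel" "Pair \<omega> -` exits n \<inter> C \<subseteq> {0..} \<times> UNIV" if "C \<in> sets borel" for C
      using sp.region_borel[OF b] that b unfolding region by (auto simp: exits_section[OF elim(2) st])
    show "emeasure (q \<omega>) (Pair \<omega> -` exits n) = 0 \<or> jump n \<omega>"
    proof (rule sp.step[OF b])
      assume "emeasure m (sp.region ?b) = 0"
      then show ?thesis using R[of UNIV] qm[of "Pair \<omega> -` exits n"] by (simp add: region)
    next
      fix t
      assume bt: "?b < t" and const: "\<And>s. ?b \<le> s \<Longrightarrow> s < t \<Longrightarrow> X s \<omega> = X ?b \<omega>" and neq: "X t \<omega> \<noteq> X ?b \<omega>"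
        and Yt: "Y t \<omega> = 0" and Nt: "N t \<omega> = Suc (N ?b \<omega>)"
        and before: "emeasure m (sp.region ?b \<inter> {..<t} \<times> UNIV) = 0"
        and cells: "\<And>j. j \<in> states - {X ?b \<omega>} \<Longrightarrow> emeasure m ({t} \<times> \<Lambda> (X ?b \<omega>) j (t - ?b + Y ?b \<omega>) (N ?b \<omega>)) = (if j = X t \<omega> then 1 else 0)"
        and one: "emeasure m ({t} \<times> exit_set (X ?b \<omega>) (t - ?b + Y ?b \<omega>) (N ?b \<omega>)) = 1"
      have T: "T (Suc n) \<omega> = t" and disc: "\<not> isCont (\<lambda>s. X s \<omega>) t"
        using jump_time_eqI[OF bt const neq] by auto
      have vert: "emeasure (q \<omega>) ({t} \<times> C) = emeasure m ({t} \<times> C)" if "C \<in> sets borel" for C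
        using that b bt by (intro qm) (auto simp: borel_prod[symmetric] intro!: pair_measureI)
      have exit_borel: "exit_set i y k \<in> sets borel" for i y k
        unfolding exit_set_def using Lam_borel by (intro sets.countable_UN'') auto
      have "emeasure (q \<omega>) (Pair \<omega> -` exits n \<inter> {..<t} \<times> UNIV) = 0"
        using before qm[OF R[of "{..<t} \<times> UNIV"]] by (simp add: region strip_borel)
      moreover have "stage (Suc n) \<omega>"
        using st bt b Nb Nt Yt sp.X_states[of t] T unfolding stage_def state_eq origin_Suc
        by (auto simp: le_Suc_eq intro: order_trans[OF _ less_imp_le])
      ultimately show ?thesis
        using bt const neq disc cells one st unfolding jump_def T state_eq[of "Suc n"] Nb Yb Xb
        by (auto simp: vert Lam_borel exit_borel)
    qed
  qed
qed

section \<open>Predictability of the exit regions\<close>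

lemma sets_G_AE:
  assumes u: "0 \<le> u" and A: "A \<in> sets (G u)" and A': "A' \<subseteq> space M" and ae: "AE \<omega> in M. \<omega> \<in> A \<longleftrightarrow> \<omega> \<in> A'"
  shows "A' \<in> sets (G u)"
proof -
  have A_pred: "(\<lambda>\<omega>. \<omega> \<in> A) \<in> measurable (G u) (count_space UNIV)" using A by simp
  have "(\<lambda>\<omega>. \<omega> \<in> A') \<in> measurable (G u) (count_space UNIV)"
  proof (rule complete_measure.measurable_AE_cong_subalgebra[OF complete subalg[OF u] _ A_pred])
    show "null_sets M \<subseteq> sets (G u)" using null_G G_mono[OF order_refl u] by (rule order_trans)
    show "AE \<omega> in M. (\<omega> \<in> A') = (\<omega> \<in> A)" using ae by eventually_elim simp
  qed simp
  from measurable_sets[OF this, of "{True}"] have "(\<lambda>\<omega>. \<omega> \<in> A') -` {True} \<inter> space (G u) \<in> sets (G u)" by simp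
  also have "(\<lambda>\<omega>. \<omega> \<in> A') -` {True} \<inter> space (G u) = A'" using A' by (auto simp: space_G[OF u])
  finally show ?thesis .
qed

text \<open>For \<open>k \<ge> 1\<close> this says that \<open>T k\<close> is a stopping time and that the new state is known at that time.\<close>

definition observed :: "nat \<Rightarrow> bool" where
  "observed k \<longleftrightarrow> (\<forall>i t u. 0 \<le> u \<longrightarrow> {\<omega>\<in>space M. state k \<omega> = i \<and> origin k \<omega> \<le> t \<and> T k \<omega> \<le> u} \<in> sets (G u))"

lemma observed_0: "observed 0"
  unfolding observed_def
proof (intro allI impI)
  fix i t and u :: real assume u: "0 \<le> u"
  have "{\<omega>\<in>space (G 0). X 0 \<omega> = i \<and> - Y 0 \<omega> \<le> t} \<in> sets (G 0)"
    using X_0 Y_0 by measurable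
  then have "{\<omega>\<in>space M. X 0 \<omega> = i \<and> - Y 0 \<omega> \<le> t} \<in> sets (G u)"
    using G_mono[OF order_refl u] by (auto simp: space_G)
  then show "{\<omega>\<in>space M. state 0 \<omega> = i \<and> origin 0 \<omega> \<le> t \<and> T 0 \<omega> \<le> u} \<in> sets (G u)"
    using u by (simp add: state_eq origin_0)
qed

text \<open>On the event fixed by state and origin, \<open>T k\<close> behaves like a stopping time.
  The variants that follow drop conditions by countable unions.\<close>

lemma observed_pred_set:
  assumes "observed k"
  shows "{(\<omega>, u, v). \<omega> \<in> space M \<and> state k \<omega> = i \<and> origin k \<omega> \<le> t \<and> T k \<omega> < u \<and> 0 < u} \<in> sets pred"
proof -
  have "{(\<omega>, u, v). \<omega> \<in> {\<omega>\<in>space M. state k \<omega> = i \<and> origin k \<omega> \<le> t} \<and> T k \<omega> < u \<and> 0 < u} \<in> sets pred"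
    using assms by (intro pred_left_open) (simp add: observed_def conj_assoc)
  then show ?thesis by (rule back_subst[where P="\<lambda>A. A \<in> sets pred"]) auto
qed

lemma observed_pred_origin_le:
  assumes "observed k"
  shows "{(\<omega>, u, v). \<omega> \<in> space M \<and> origin k \<omega> \<le> t \<and> T k \<omega> < u \<and> 0 < u} \<in> sets pred"
proof -
  have "(\<Union>i. {(\<omega>, u, v). \<omega> \<in> space M \<and> state k \<omega> = i \<and> origin k \<omega> \<le> t \<and> T k \<omega> < u \<and> 0 < u}) \<in> sets pred"
    using observed_pred_set[OF assms] by (intro sets.countable_UN'') auto
  then show ?thesis by (rule back_subst[where P="\<lambda>A. A \<in> sets pred"]) auto
qed

lemma observed_pred_state:
  assumes "observed k"
  shows "{(\<omega>, u, v). \<omega> \<in> space M \<and> state k \<omega> = i \<and> T k \<omega> < u \<and> 0 < u} \<in> sets pred"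
proof -
  have "(\<Union>t::nat. {(\<omega>, u, v). \<omega> \<in> space M \<and> state k \<omega> = i \<and> origin k \<omega> \<le> real t \<and> T k \<omega> < u \<and> 0 < u}) \<in> sets pred"
    using observed_pred_set[OF assms] by (intro sets.countable_UN'') auto
  then show ?thesis
    by (rule back_subst[where P="\<lambda>A. A \<in> sets pred"]) (auto simp: real_arch_simple)
qed

lemma observed_pred_started:
  assumes "observed k"
  shows "{(\<omega>, u, v). \<omega> \<in> space M \<and> T k \<omega> < u \<and> 0 < u} \<in> sets pred"
proof -
  have "(\<Union>i. {(\<omega>, u, v). \<omega> \<in> space M \<and> state k \<omega> = i \<and> T k \<omega> < u \<and> 0 < u}) \<in> sets pred"
    using observed_pred_state[OF assms] by (intro sets.countable_UN'') auto
  then show ?thesis by (rule back_subst[where P="\<lambda>A. A \<in> sets pred"]) auto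
qed

lemma plane_pred: "snd \<in> measurable pred (borel :: (real \<times> real) measure)"
proof (rule measurableI)
  fix D :: "(real \<times> real) set" assume D: "D \<in> sets borel"
  have "space M \<times> (D \<inter> {0<..} \<times> UNIV) \<in> sets pred"
    using D sets.top[of "G 0"] by (intro pred_basic[of 0]) (auto simp: space_G strip_borel)
  also have "space M \<times> (D \<inter> {0<..} \<times> UNIV) = snd -` D \<inter> space pred" by (auto simp: space_pred)
  finally show "snd -` D \<inter> space pred \<in> sets pred" .
qed simp

text \<open>Before \<open>T n\<close> the origin need not be known yet, so the function is given the
  value 0 there; afterwards \<open>observed n\<close> determines it.\<close>

lemma origin_pred:
  assumes obs: "observed n"
  shows "(\<lambda>(\<omega>, u, v). if T n \<omega> < u then origin n \<omega> else 0) \<in> borel_measurable pred" (is "?orig \<in> _")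
proof (rule borel_measurable_iff_le[THEN iffD2], rule allI)
  fix t
  let ?A = "{(\<omega>, u, v). \<omega> \<in> space M \<and> origin n \<omega> \<le> t \<and> T n \<omega> < u \<and> 0 < u}"
  let ?B = "{(\<omega>, u, v). \<omega> \<in> space M \<and> T n \<omega> < u \<and> 0 < u}"
  have "{w \<in> space pred. ?orig w \<le> t} = ?A \<union> (if 0 \<le> t then space pred - ?B else {})"
    by (auto simp: space_pred split: if_splits)
  then show "{w \<in> space pred. ?orig w \<le> t} \<in> sets pred"
    using observed_pred_origin_le[OF obs, of t] observed_pred_started[OF obs] by auto
qed

lemma reg_pred:
  assumes obs: "observed n"
  shows "reg n j \<in> sets pred"
proof -
  define orig where "orig w = (case w of (\<omega>, u, v :: real) \<Rightarrow> if T n \<omega> < u then origin n \<omega> else 0)" for w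
  have orig: "orig \<in> borel_measurable pred"
    using origin_pred[OF obs] unfolding orig_def .
  have age: "(\<lambda>w. (fst (snd w) - orig w, snd (snd w))) \<in> measurable pred (borel :: (real \<times> real) measure)"
  proof -
    have [measurable]: "snd \<in> measurable pred (borel \<Otimes>\<^sub>M (borel :: real measure))" using plane_pred by (simp add: borel_prod)
    note orig[measurable]
    show ?thesis unfolding borel_prod[symmetric] by measurable
  qed
  \<comment> \<open>For a fixed state i the region is the preimage of a planar set under the map to
    age and mark. Countably many states have to be united.\<close>
  have "(if (i, j) \<in> state_pairs then {(\<omega>, u, v). \<omega> \<in> space M \<and> state n \<omega> = i \<and> T n \<omega> < u \<and> 0 < u} \<inter>
      ((\<lambda>w. (fst (snd w) - orig w, snd (snd w))) -` {(y, v). 0 \<le> y \<and> v \<in> \<Lambda> i j y n} \<inter> space pred) else {}) \<in> sets pred" (is "?S i \<in> _") for i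
    using measurable_sets[OF age cell_borel] observed_pred_state[OF obs, of i] by auto
  then have "(\<Union>i. ?S i) \<in> sets pred" by (intro sets.countable_UN'') auto
  also have "(\<Union>i. ?S i) = reg n j"
  proof (intro set_eqI iffI)
    fix w assume "w \<in> (\<Union>i. ?S i)"
    then show "w \<in> reg n j" by (auto simp: reg_def orig_def state_pairs_def split: if_splits)
  next
    fix w assume "w \<in> reg n j"
    moreover obtain \<omega> u v where w: "w = (\<omega>, u, v)" by (cases w) auto
    ultimately have "w \<in> ?S (state n \<omega>)"
      using origin_le[of \<omega> n] by (auto simp: reg_def orig_def state_pairs_def space_pred)
    then show "w \<in> (\<Union>i. ?S i)" by blast
  qed
  finally show ?thesis .
qed

lemma exits_pred: "observed n \<Longrightarrow> exits n \<in> sets pred"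
  unfolding exits_def using reg_pred by (intro sets.countable_UN'') auto

lemma fresh_pred: "observed n \<Longrightarrow> fresh n \<in> sets pred"
  unfolding fresh_def by (rule pred_no_points_before[OF exits_pred])

text \<open>Only atoms strictly before u count against \<open>fresh\<close>, so the atom that causes
  the jump leaves the time \<open>T (Suc n)\<close> itself in the section, and cuts off every later
  time.\<close>

lemma fresh_section:
  assumes obs: "observed n" and \<omega>: "\<omega> \<in> space M" and j: "jump n \<omega>"
  shows "Pair \<omega> -` fresh n = {(u, v :: real). 0 < u \<and> u \<le> T (Suc n) \<omega>}"
proof (intro set_eqI iffI)
  fix z assume z: "z \<in> Pair \<omega> -` fresh n"
  obtain u v where uv: "z = (u, v)" by force
  let ?t = "T (Suc n) \<omega>" and ?R = "Pair \<omega> -` exits n"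
  have st: "stage n \<omega>" "T n \<omega> < ?t" and one: "emeasure (q \<omega>) ({?t} \<times> exit_set (state n \<omega>) (?t - origin n \<omega>) n) = 1"
    using jump_stage[OF j] jump_less[OF j] jump_exit[OF j] by blast+
  have "u \<le> ?t"
  proof (rule ccontr)
    assume "\<not> u \<le> ?t"
    then have "{?t} \<times> exit_set (state n \<omega>) (?t - origin n \<omega>) n \<subseteq> ?R \<inter> ({0<..<u} \<times> UNIV)"
      using st by (auto simp: exits_section[OF \<omega> st(1)] stage_def)
    then have "1 \<le> emeasure (q \<omega>) (?R \<inter> ({0<..<u} \<times> UNIV))"
      unfolding one[symmetric] using exits_pred[OF obs] by (intro emeasure_mono) (auto simp: strip_borel)
    then show False using z uv by (simp add: fresh_def)
  qed
  then show "z \<in> {(u, v :: real). 0 < u \<and> u \<le> ?t}" using z uv by (auto simp: fresh_def)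
next
  fix z assume "z \<in> {(u, v :: real). 0 < u \<and> u \<le> T (Suc n) \<omega>}"
  then obtain u v where uv: "z = (u, v)" "0 < u" "u \<le> T (Suc n) \<omega>" by auto
  have "emeasure (q \<omega>) (Pair \<omega> -` exits n \<inter> ({0<..<u} \<times> UNIV)) \<le> emeasure (q \<omega>) (Pair \<omega> -` exits n \<inter> {..<T (Suc n) \<omega>} \<times> UNIV)"
    using uv exits_pred[OF obs] by (intro emeasure_mono) (auto simp: strip_borel)
  also have "\<dots> = 0" by (rule jump_before[OF j])
  finally show "z \<in> Pair \<omega> -` fresh n" using \<omega> uv by (simp add: fresh_def)
qed

text \<open>Candidates before \<open>T (Suc n)\<close> carry no mass and later ones are not fresh,
  so only the vertical slice at the jump time remains.\<close>

lemma emeasure_fresh_section: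
  assumes obs: "observed n" and \<omega>: "\<omega> \<in> space M" and j: "jump n \<omega>"
    and C: "C \<in> sets borel" "C \<subseteq> Pair \<omega> -` exits n"
  shows "emeasure (q \<omega>) (C \<inter> Pair \<omega> -` fresh n) = emeasure (q \<omega>) (C \<inter> {T (Suc n) \<omega>} \<times> UNIV)"
proof -
  let ?t = "T (Suc n) \<omega>"
  have vert: "{?t} \<times> (UNIV :: real set) \<in> sets borel" by (rule strip_borel) simp
  have "C \<inter> {..<?t} \<times> UNIV \<in> null_sets (q \<omega>)"
  proof (rule null_sets_subset[of "Pair \<omega> -` exits n \<inter> {..<?t} \<times> UNIV"])
    show "Pair \<omega> -` exits n \<inter> {..<?t} \<times> UNIV \<in> null_sets (q \<omega>)"
      using jump_before[OF j] exits_pred[OF obs] by (auto simp: null_sets_def strip_borel)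
  qed (use C in \<open>auto simp: strip_borel\<close>)
  moreover have "C \<inter> Pair \<omega> -` fresh n = (C \<inter> {?t} \<times> UNIV) \<union> (C \<inter> {..<?t} \<times> UNIV)"
    using C(2) jump_pos[OF j] by (auto simp: fresh_section[OF obs \<omega> j] exits_def reg_def)
  ultimately show ?thesis using C(1) vert by (simp add: emeasure_Un_null_set)
qed

lemma reg_section:
  assumes "\<omega> \<in> space M" "stage n \<omega>" "j \<in> states - {state n \<omega>}"
  shows "Pair \<omega> -` reg n j = {(u, v). T n \<omega> < u \<and> v \<in> \<Lambda> (state n \<omega>) j (u - origin n \<omega>) n}"
  using assms by (auto simp: reg_def stage_def)

lemma reg_subset_exits: "reg n j \<subseteq> exits n"
  by (auto simp: exits_def)

text \<open>The bridge from the random measure to probabilities: the mass of fresh candidates is the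
  indicator of an event about the next jump, so Campbell's formula computes the probability of that
  event.\<close>

lemma emeasure_reg_fresh:
  assumes obs: "observed n" and \<omega>: "\<omega> \<in> space M" and j: "jump n \<omega>" and U: "U \<in> sets borel"
  shows "emeasure (q \<omega>) (Pair \<omega> -` (reg n i \<inter> fresh n) \<inter> U \<times> UNIV) =
     (if state (Suc n) \<omega> = i \<and> T (Suc n) \<omega> \<in> U then 1 else 0)"
    and "emeasure (q \<omega>) (Pair \<omega> -` (exits n \<inter> fresh n) \<inter> U \<times> UNIV) = (if T (Suc n) \<omega> \<in> U then 1 else 0)"
proof -
  let ?t = "T (Suc n) \<omega>"
  have st: "stage n \<omega>" "T n \<omega> < ?t" "stage (Suc n) \<omega>"
    using jump_stage[OF j] jump_less[OF j] jump_stage_Suc[OF j] by blast+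
  have *: "emeasure (q \<omega>) (Pair \<omega> -` (A \<inter> fresh n) \<inter> U \<times> UNIV) = emeasure (q \<omega>) (Pair \<omega> -` A \<inter> U \<times> UNIV \<inter> {?t} \<times> UNIV)"
    if "A \<in> sets pred" "A \<subseteq> exits n" for A
  proof -
    have "Pair \<omega> -` (A \<inter> fresh n) \<inter> U \<times> UNIV = Pair \<omega> -` A \<inter> U \<times> UNIV \<inter> Pair \<omega> -` fresh n" by auto
    then show ?thesis using that U
      by (simp only:) (rule emeasure_fresh_section[OF obs \<omega> j], auto simp: strip_borel)
  qed
  have "Pair \<omega> -` exits n \<inter> U \<times> UNIV \<inter> {?t} \<times> UNIV = (if ?t \<in> U then {?t} \<times> exit_set (state n \<omega>) (?t - origin n \<omega>) n else {})"
    using st by (auto simp: exits_section[OF \<omega> st(1)])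
  then show "emeasure (q \<omega>) (Pair \<omega> -` (exits n \<inter> fresh n) \<inter> U \<times> UNIV) = (if ?t \<in> U then 1 else 0)"
    using *[OF exits_pred[OF obs]] jump_exit[OF j] by simp
  show "emeasure (q \<omega>) (Pair \<omega> -` (reg n i \<inter> fresh n) \<inter> U \<times> UNIV) = (if state (Suc n) \<omega> = i \<and> ?t \<in> U then 1 else 0)"
  proof (cases "i \<in> states - {state n \<omega>}")
    case True
    then have "Pair \<omega> -` reg n i \<inter> U \<times> UNIV \<inter> {?t} \<times> UNIV = (if ?t \<in> U then {?t} \<times> \<Lambda> (state n \<omega>) i (?t - origin n \<omega>) n else {})"
      using st by (auto simp: reg_section[OF \<omega> st(1)])
    then show ?thesis
      using *[OF reg_pred[OF obs] reg_subset_exits] jump_cell[OF j True] by auto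
  next
    case False
    then have "Pair \<omega> -` reg n i = {}" by (auto simp: reg_def)
    then have "Pair \<omega> -` (reg n i \<inter> fresh n) = {}" by auto
    moreover have "state (Suc n) \<omega> \<noteq> i" using False jump_state_neq[OF j] st(3) by (auto simp: stage_def)
    ultimately show ?thesis by simp
  qed
qed

text \<open>That a jump to i has occurred by time s means, up to a null set, that the adapted mass
  of fresh candidates up to s equals 1. For a positive index \<open>origin\<close> and
  \<open>T\<close> coincide, so the two bounds merge into \<open>min t u\<close>.\<close>

lemma observed_Suc:
  assumes obs: "observed n" and ae: "AE \<omega> in M. jump n \<omega>"
  shows "observed (Suc n)"
  unfolding observed_def
proof (intro allI impI)
  fix i t and u :: real assume u: "0 \<le> u"
  let ?A' = "{\<omega>\<in>space M. state (Suc n) \<omega> = i \<and> origin (Suc n) \<omega> \<le> t \<and> T (Suc n) \<omega> \<le> u}"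
  let ?s = "min t u"
  show "?A' \<in> sets (G u)"
  proof (cases "0 \<le> ?s")
    case True
    let ?A = "{\<omega>\<in>space M. emeasure (q \<omega>) (Pair \<omega> -` (reg n i \<inter> fresh n) \<inter> ({0<..?s} \<times> UNIV)) = 1}"
    have "(\<lambda>\<omega>. emeasure (q \<omega>) (Pair \<omega> -` (reg n i \<inter> fresh n) \<inter> ({0<..?s} \<times> UNIV))) \<in> borel_measurable (G ?s)"
      using reg_pred[OF obs] fresh_pred[OF obs] True by (intro section_adapted) auto
    from measurable_sets[OF this, of "{1}"] have "?A \<in> sets (G ?s)"
      by (simp add: vimage_def Int_def space_G[OF True] conj_commute)
    then have A: "?A \<in> sets (G u)" using G_mono[OF True, of u] by auto
    show ?thesis
    proof (rule sets_G_AE[OF u A])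
      show "AE \<omega> in M. \<omega> \<in> ?A \<longleftrightarrow> \<omega> \<in> ?A'"
        using ae AE_space
      proof eventually_elim
        case (elim \<omega>)
        have "0 < T (Suc n) \<omega>" by (rule jump_pos[OF elim(1)])
        then show ?case
          using emeasure_reg_fresh(1)[OF obs elim(2,1), of "{0<..?s}" i] elim(2) by (auto simp: origin_Suc)
      qed
    qed auto
  next
    case False
    show ?thesis
    proof (rule sets_G_AE[OF u sets.empty_sets])
      show "AE \<omega> in M. \<omega> \<in> {} \<longleftrightarrow> \<omega> \<in> ?A'"
        using ae
      proof eventually_elim
        case (elim \<omega>)
        then show ?case using False jump_pos[OF elim] u by (auto simp: origin_Suc)
      qed
    qed auto
  qed
qed

section \<open>Almost sure existence of the next jump\<close>

lemma emeasure_exits_section: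
  assumes \<omega>: "\<omega> \<in> space M" and st: "stage n \<omega>" and obs: "observed n" and U: "U \<in> sets borel" "U \<subseteq> {T n \<omega><..}"
  shows "emeasure lborel (Pair \<omega> -` exits n \<inter> U \<times> UNIV) =
    (\<integral>\<^sup>+u. indicator U u * total_rate lam (state n \<omega>) (u - origin n \<omega>) n \<partial>lborel)"
proof -
  have "Pair \<omega> -` exits n \<inter> U \<times> UNIV \<in> sets borel"
    using exits_pred[OF obs] U(1) by (intro sets.Int pred_section strip_borel)
  then have "Pair \<omega> -` exits n \<inter> U \<times> UNIV \<in> sets (lborel \<Otimes>\<^sub>M lborel)"
    by (simp only: lborel_prod sets_lborel)
  then have "emeasure lborel (Pair \<omega> -` exits n \<inter> U \<times> UNIV) =
    (\<integral>\<^sup>+u. emeasure lborel (Pair u -` (Pair \<omega> -` exits n \<inter> U \<times> UNIV)) \<partial>lborel)"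
    unfolding lborel_prod[symmetric] by (rule lborel.emeasure_pair_measure_alt)
  also have "\<dots> = (\<integral>\<^sup>+u. indicator U u * total_rate lam (state n \<omega>) (u - origin n \<omega>) n \<partial>lborel)"
  proof (rule nn_integral_cong)
    fix u
    have "Pair u -` (Pair \<omega> -` exits n \<inter> U \<times> UNIV) = (if u \<in> U then exit_set (state n \<omega>) (u - origin n \<omega>) n else {})"
      using U(2) by (auto simp: exits_section[OF \<omega> st])
    moreover have "0 \<le> u - origin n \<omega>" if "u \<in> U" using that U(2) origin_le[OF \<omega>, of n] by force
    ultimately show "emeasure lborel (Pair u -` (Pair \<omega> -` exits n \<inter> U \<times> UNIV)) =
      indicator U u * total_rate lam (state n \<omega>) (u - origin n \<omega>) n"
      using st by (auto simp: emeasure_exit_set stage_def)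
  qed
  finally show ?thesis .
qed

text \<open>Integrating the slices gives the integral of the total rate over all ages beyond the
  current one, which diverges by \<open>A2\<close>.\<close>

lemma emeasure_exits_infinite:
  assumes \<omega>: "\<omega> \<in> space M" and st: "stage n \<omega>" and obs: "observed n"
  shows "emeasure lborel (Pair \<omega> -` exits n) = \<infinity>"
proof -
  let ?i = "state n \<omega>" and ?a = "origin n \<omega>" and ?b = "T n \<omega>"
  let ?f = "\<lambda>y. if 0 \<le> y then total_rate lam ?i y n else 0"
  have i: "?i \<in> states" using st by (simp add: stage_def)
  have ab: "?a \<le> ?b" by (rule origin_le[OF \<omega>])
  note [measurable] = total_rate_borel[OF i, of n]
  have "\<infinity> = (\<integral>\<^sup>+y. ?f y * indicator {?b - ?a<..} y \<partial>lborel)"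
  proof -
    have "(\<integral>\<^sup>+y. ?f y * indicator {?b - ?a<..} y \<partial>lborel) = (\<integral>\<^sup>+y\<in>{?b - ?a<..}. total_rate lam ?i y n \<partial>lborel)"
      using ab by (intro nn_integral_cong) (auto simp: indicator_def)
    then show ?thesis using total_rate_integral_infinite[OF i, of "?b - ?a" n] ab by simp
  qed
  also have "\<dots> = (\<integral>\<^sup>+u. ?f (- ?a + 1 * u) * indicator {?b - ?a<..} (- ?a + 1 * u) \<partial>lborel)"
    by (subst nn_integral_real_affine[where c=1 and t="- ?a"]) auto
  also have "\<dots> = (\<integral>\<^sup>+u. indicator {?b<..} u * total_rate lam ?i (u - ?a) n \<partial>lborel)"
    using ab by (intro nn_integral_cong) (auto simp: indicator_def)
  also have "\<dots> = emeasure lborel (Pair \<omega> -` exits n \<inter> {?b<..} \<times> UNIV)"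
    by (rule emeasure_exits_section[OF \<omega> st obs, symmetric]) auto
  also have "Pair \<omega> -` exits n \<inter> {?b<..} \<times> UNIV = Pair \<omega> -` exits n"
    by (auto simp: exits_section[OF \<omega> st])
  finally show ?thesis ..
qed

text \<open>Where the candidates carry no mass, the whole exit region is fresh and has infinite
  area; but the fresh part of the exit region has \<open>q\<close>-mass at most 1. Campbell's
  formula equates the means, so an infinite multiple of the probability of having no jump is at most
  1.\<close>

lemma AE_jump:
  assumes obs: "observed n" and st: "AE \<omega> in M. stage n \<omega>"
  shows "AE \<omega> in M. jump n \<omega>"
proof -
  let ?A = "exits n \<inter> fresh n"
  let ?never = "{\<omega>\<in>space M. emeasure (q \<omega>) (Pair \<omega> -` exits n) = 0}"
  have A: "?A \<in> sets pred" using exits_pred[OF obs] fresh_pred[OF obs] by auto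
  have never: "?never \<in> events" using section_measurable[OF exits_pred[OF obs]] by measurable
  have "\<infinity> * emeasure M ?never = (\<integral>\<^sup>+\<omega>. \<infinity> * indicator ?never \<omega> \<partial>M)"
    using never by (simp add: nn_integral_cmult_indicator)
  also have "\<dots> \<le> (\<integral>\<^sup>+\<omega>. emeasure lborel (Pair \<omega> -` ?A) \<partial>M)"
  proof (rule nn_integral_mono_AE)
    show "AE \<omega> in M. \<infinity> * indicator ?never \<omega> \<le> emeasure lborel (Pair \<omega> -` ?A)"
      using st AE_space
    proof eventually_elim
      case (elim \<omega>)
      show ?case
      proof (cases "\<omega> \<in> ?never")
        case True
        have "emeasure (q \<omega>) (Pair \<omega> -` exits n \<inter> ({0<..<u} \<times> UNIV)) = 0" for u
        proof -
          have "emeasure (q \<omega>) (Pair \<omega> -` exits n \<inter> ({0<..<u} \<times> UNIV)) \<le> emeasure (q \<omega>) (Pair \<omega> -` exits n)"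
            using exits_pred[OF obs] by (intro emeasure_mono) auto
          then show ?thesis using True by simp
        qed
        then have "Pair \<omega> -` ?A = Pair \<omega> -` exits n"
          by (auto simp: fresh_def exits_def reg_def)
        then show ?thesis using emeasure_exits_infinite[OF elim(2,1) obs] by simp
      qed simp
    qed
  qed
  also have "\<dots> = (\<integral>\<^sup>+\<omega>. emeasure (q \<omega>) (Pair \<omega> -` ?A) \<partial>M)" by (rule campbell[OF A, symmetric])
  also have "\<dots> \<le> (\<integral>\<^sup>+\<omega>. 1 \<partial>M)"
  proof (rule nn_integral_mono_AE)
    show "AE \<omega> in M. emeasure (q \<omega>) (Pair \<omega> -` ?A) \<le> 1"
      using st stage_dichotomy[of n] AE_space
    proof eventually_elim
      case (elim \<omega>)
      show ?case
      proof (cases "jump n \<omega>")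
        case True
        then show ?thesis using emeasure_reg_fresh(2)[OF obs elim(3) True, of UNIV] by simp
      next
        case False
        have "emeasure (q \<omega>) (Pair \<omega> -` ?A) \<le> emeasure (q \<omega>) (Pair \<omega> -` exits n)"
          using exits_pred[OF obs] by (intro emeasure_mono) auto
        then show ?thesis using False elim by simp
      qed
    qed
  qed
  also have "\<dots> = 1" by (simp add: emeasure_space_1)
  finally have "emeasure M ?never = 0"
    by (auto simp: ennreal_top_mult top_unique split: if_splits)
  then have "AE \<omega> in M. \<omega> \<notin> ?never" using never by (intro AE_not_in) (auto simp: null_sets_def)
  then show ?thesis using st stage_dichotomy[of n] AE_space by eventually_elim auto
qed

text \<open>The two claims need one common induction: existence of the next jump uses the
  predictability of the exit region after \<open>T n\<close>, and \<open>observed (Suc n)\<close>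
  uses the existence of that jump.\<close>

theorem AE_stage_observed: "observed n \<and> (AE \<omega> in M. stage n \<omega>)"
proof (induction n)
  case 0
  then show ?case using observed_0 AE_stage_0 by simp
next
  case (Suc n)
  then have j: "AE \<omega> in M. jump n \<omega>" using AE_jump by blast
  then have "AE \<omega> in M. stage (Suc n) \<omega>" by eventually_elim (rule jump_stage_Suc)
  with j Suc observed_Suc show ?case by blast
qed

end

section \<open>Sojourn times\<close>

lemma nn_integral_power_Ioo:
  fixes y :: real
  assumes y: "0 \<le> y" and C: "0 \<le> C"
  shows "(\<integral>\<^sup>+w\<in>{0<..<y}. ennreal (C * w ^ k) \<partial>lborel) \<le> ennreal (C * (y ^ Suc k / real (Suc k)))"
proof -
  have "(\<integral>\<^sup>+w\<in>{0<..<y}. ennreal (C * w ^ k) \<partial>lborel) \<le> (\<integral>\<^sup>+w. ennreal (C * w ^ k) * indicator {0..y} w \<partial>lborel)"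
    by (intro nn_integral_mono) (auto simp: indicator_def)
  also have "\<dots> = C * (y ^ Suc k / real (Suc k)) - C * (0 ^ Suc k / real (Suc k))"
  proof (rule nn_integral_FTC_Icc)
    show "((\<lambda>w. C * (w ^ Suc k / real (Suc k))) has_real_derivative C * w ^ k) (at w)" for w
    proof -
      have "((\<lambda>w. C * (w ^ Suc k / real (Suc k))) has_real_derivative C * (real (Suc k) * w ^ k / real (Suc k))) (at w)"
        by (intro DERIV_cmult DERIV_cdivide) (use DERIV_pow[of "Suc k" w] in simp)
      then show ?thesis by simp
    qed
  qed (use y C in auto)
  finally show ?thesis by simp
qed

text \<open>Iterating the inequality k times gives the bound
  \<open>K * (c * y) ^ k / fact k\<close>, which tends to 0.\<close>

lemma gronwall_zero:
  fixes h :: "real \<Rightarrow> real"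
  assumes c: "0 \<le> c" and bound: "\<And>w. 0 \<le> w \<Longrightarrow> \<bar>h w\<bar> \<le> K"
    and h: "\<And>y. 0 \<le> y \<Longrightarrow> ennreal \<bar>h y\<bar> \<le> (\<integral>\<^sup>+w\<in>{0<..<y}. ennreal (c * \<bar>h w\<bar>) \<partial>lborel)"
    and y: "0 \<le> y"
  shows "h y = 0"
proof -
  have K: "0 \<le> K" using bound[of 0] by simp
  have step: "\<bar>h y\<bar> \<le> K * (c * y) ^ k / fact k" if "0 \<le> y" for y k
    using that
  proof (induction k arbitrary: y)
    case 0
    then show ?case using bound by simp
  next
    case (Suc k)
    have "ennreal \<bar>h y\<bar> \<le> (\<integral>\<^sup>+w\<in>{0<..<y}. ennreal (c * \<bar>h w\<bar>) \<partial>lborel)" by (rule h[OF Suc.prems])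
    also have "\<dots> \<le> (\<integral>\<^sup>+w\<in>{0<..<y}. ennreal (c * (K * c ^ k / fact k) * w ^ k) \<partial>lborel)"
    proof (rule nn_integral_mono)
      fix w
      show "ennreal (c * \<bar>h w\<bar>) * indicator {0<..<y} w \<le> ennreal (c * (K * c ^ k / fact k) * w ^ k) * indicator {0<..<y} w"
      proof (cases "w \<in> {0<..<y}")
        case True
        then have "c * \<bar>h w\<bar> \<le> c * (K * (c * w) ^ k / fact k)" using Suc.IH[of w] c by (intro mult_left_mono) auto
        also have "\<dots> = c * (K * c ^ k / fact k) * w ^ k" by (simp add: power_mult_distrib)
        finally show ?thesis using True by (simp add: ennreal_leI)
      qed simp
    qed
    also have "\<dots> \<le> ennreal (c * (K * c ^ k / fact k) * (y ^ Suc k / real (Suc k)))"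
      using c K Suc.prems by (intro nn_integral_power_Ioo) auto
    also have "c * (K * c ^ k / fact k) * (y ^ Suc k / real (Suc k)) = K * (c * y) ^ Suc k / fact (Suc k)"
      by (simp add: power_mult_distrib field_simps)
    finally show ?case
      using c K Suc.prems by (subst (asm) ennreal_le_iff) auto
  qed
  have "(\<lambda>k. K * (c * y) ^ k / fact k) \<longlonglongrightarrow> K * 0"
    using summable_LIMSEQ_zero[OF summable_exp[of "c * y"]]
    by (simp only: times_divide_eq_right[symmetric]) (intro tendsto_mult_left, simp add: divide_inverse mult.commute)
  then have "\<bar>h y\<bar> \<le> K * 0" using step[OF y] by (intro LIMSEQ_le_const) auto
  then show ?thesis by simp
qed

section \<open>Laws of sojourn times and transitions\<close>

context semi_markov_process
begin

lemma observed: "observed n" and AE_stage: "AE \<omega> in M. stage n \<omega>"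
  using AE_stage_observed by auto

lemma AE_jump_n: "AE \<omega> in M. jump n \<omega>"
  by (rule AE_jump[OF observed AE_stage])

lemma AE_jumps: "AE \<omega> in M. \<forall>n. jump n \<omega>"
  unfolding AE_all_countable using AE_jump_n by blast

lemma observed_events: "{\<omega>\<in>space M. state k \<omega> = i \<and> origin k \<omega> \<le> t} \<in> events"
proof -
  have "{\<omega>\<in>space M. state k \<omega> = i \<and> origin k \<omega> \<le> t \<and> T k \<omega> \<le> real u} \<in> events" for u :: nat
    by (rule sets_G_M[of "real u"]) (use observed[of k] in \<open>simp_all add: observed_def\<close>)
  then have "(\<Union>u::nat. {\<omega>\<in>space M. state k \<omega> = i \<and> origin k \<omega> \<le> t \<and> T k \<omega> \<le> real u}) \<in> events"
    by (intro sets.countable_UN'') auto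
  also have "(\<Union>u::nat. {\<omega>\<in>space M. state k \<omega> = i \<and> origin k \<omega> \<le> t \<and> T k \<omega> \<le> real u}) =
    {\<omega>\<in>space M. state k \<omega> = i \<and> origin k \<omega> \<le> t}"
    by (auto simp: real_arch_simple)
  finally show ?thesis .
qed

lemma state_measurable[measurable]: "state k \<in> measurable M (count_space UNIV)"
proof (rule measurable_count_space_eq2_countable[THEN iffD2], intro conjI ballI)
  fix i
  have "(\<Union>t::nat. {\<omega>\<in>space M. state k \<omega> = i \<and> origin k \<omega> \<le> real t}) \<in> events"
    using observed_events by (intro sets.countable_UN'') auto
  also have "(\<Union>t::nat. {\<omega>\<in>space M. state k \<omega> = i \<and> origin k \<omega> \<le> real t}) = state k -` {i} \<inter> space M"
    by (auto simp: real_arch_simple)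
  finally show "state k -` {i} \<inter> space M \<in> events" .
qed auto

lemma origin_measurable[measurable]: "origin k \<in> borel_measurable M"
proof (rule borel_measurable_iff_le[THEN iffD2], rule allI)
  fix t
  have "(\<Union>i. {\<omega>\<in>space M. state k \<omega> = i \<and> origin k \<omega> \<le> t}) \<in> events"
    using observed_events by (intro sets.countable_UN'') auto
  also have "(\<Union>i. {\<omega>\<in>space M. state k \<omega> = i \<and> origin k \<omega> \<le> t}) = {\<omega>\<in>space M. origin k \<omega> \<le> t}" by auto
  finally show "{\<omega>\<in>space M. origin k \<omega> \<le> t} \<in> events" .
qed

text \<open>Taken from \<open>origin\<close>, so that it is the increment of the times used in
  \<open>semi_Markov\<close>; for n = 0 it includes the initial age.\<close>

definition sojourn :: "nat \<Rightarrow> 'a \<Rightarrow> real" where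
  "sojourn n \<omega> = origin (Suc n) \<omega> - origin n \<omega>"

lemma sojourn_measurable[measurable]: "sojourn n \<in> borel_measurable M"
  unfolding sojourn_def by measurable

text \<open>Membership of \<open>E\<close> in the sigma-algebra of the stopping time
  \<open>T n\<close>.\<close>

definition stopped :: "nat \<Rightarrow> 'a set \<Rightarrow> bool" where
  "stopped n E \<longleftrightarrow> E \<in> events \<and> (\<forall>r\<ge>0. {\<omega>\<in>E. T n \<omega> \<le> r} \<in> sets (G r))"

lemma origin_pos: "1 \<le> n \<Longrightarrow> origin n \<omega> = T n \<omega>"
  by (cases n) (auto simp: origin_Suc)

lemma sojourn_pos: "1 \<le> n \<Longrightarrow> jump n \<omega> \<Longrightarrow> 0 < sojourn n \<omega>"
  using jump_less[of n \<omega>] by (simp add: sojourn_def origin_pos)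

lemma shifted_age_pred:
  assumes n: "1 \<le> n" and E: "stopped n E" and U: "U \<in> sets borel"
  shows "{(\<omega>, u, v). \<omega> \<in> E \<and> T n \<omega> < u \<and> 0 < u \<and> u - T n \<omega> \<in> U} \<in> sets pred"
proof -
  define orig where "orig w = (case w of (\<omega>, u, v :: real) \<Rightarrow> if T n \<omega> < u then origin n \<omega> else 0)" for w
  have orig[measurable]: "orig \<in> borel_measurable pred"
    using origin_pred[OF observed, of n] unfolding orig_def .
  have [measurable]: "snd \<in> measurable pred (borel \<Otimes>\<^sub>M (borel :: real measure))" using plane_pred by (simp add: borel_prod)
  have "(\<lambda>w. fst (snd w) - orig w) \<in> borel_measurable pred" by measurable
  from measurable_sets[OF this U] have "(\<lambda>w. fst (snd w) - orig w) -` U \<inter> space pred \<in> sets pred" .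
  moreover have "{(\<omega>, u, v :: real). \<omega> \<in> E \<and> T n \<omega> < u \<and> 0 < u} \<in> sets pred"
    using E by (intro pred_left_open) (auto simp: stopped_def)
  ultimately have "((\<lambda>w. fst (snd w) - orig w) -` U \<inter> space pred) \<inter> {(\<omega>, u, v). \<omega> \<in> E \<and> T n \<omega> < u \<and> 0 < u} \<in> sets pred" by (rule sets.Int)
  also have "((\<lambda>w. fst (snd w) - orig w) -` U \<inter> space pred) \<inter> {(\<omega>, u, v). \<omega> \<in> E \<and> T n \<omega> < u \<and> 0 < u} =
    {(\<omega>, u, v). \<omega> \<in> E \<and> T n \<omega> < u \<and> 0 < u \<and> u - T n \<omega> \<in> U}"
    using E sets.sets_into_space[of E M] n by (auto simp: stopped_def orig_def space_pred origin_pos)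
  finally show ?thesis .
qed

text \<open>Campbell's formula for the fresh points of \<open>W\<close> at elapsed times in
  \<open>U\<close>. The slice of \<open>W\<close> at elapsed time w has length
  \<open>\<rho> w\<close>, whatever the path, and counts exactly while w \<le>
  \<open>sojourn n \<omega>\<close>. Exchanging the integrals turns the area into an integral
  against the survival function. For n \<ge> 1 the age equals the elapsed time.\<close>

lemma sojourn_compensator:
  fixes \<rho> :: "real \<Rightarrow> ennreal"
  assumes n: "1 \<le> n" and E: "stopped n E" and U: "U \<in> sets borel" "U \<subseteq> {0<..}"
    and W: "W \<in> sets pred" and \<rho>[measurable]: "\<rho> \<in> borel_measurable borel"
    and W_section: "\<And>\<omega>. \<omega> \<in> E \<Longrightarrow> jump n \<omega> \<Longrightarrow> Pair \<omega> -` W = {(u, v). T n \<omega> < u \<and> v \<in> \<Gamma> (u - T n \<omega>)}"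
    and \<Gamma>: "\<And>w. 0 < w \<Longrightarrow> emeasure lborel (\<Gamma> w) = \<rho> w"
  shows "(\<integral>\<^sup>+\<omega>. indicator E \<omega> * emeasure (q \<omega>) (Pair \<omega> -` (W \<inter> fresh n) \<inter> {u. u - T n \<omega> \<in> U} \<times> UNIV) \<partial>M) =
    (\<integral>\<^sup>+w. indicator U w * \<rho> w * emeasure M {\<omega>\<in>E. w \<le> sojourn n \<omega>} \<partial>lborel)"
proof -
  let ?H = "{(\<omega>, u, v). \<omega> \<in> E \<and> T n \<omega> < u \<and> 0 < u \<and> u - T n \<omega> \<in> U}"
  let ?A = "W \<inter> fresh n \<inter> ?H"
  have EM[measurable]: "E \<in> events" using E by (simp add: stopped_def)
  have A: "?A \<in> sets pred"
    by (intro sets.Int W fresh_pred[OF observed] shifted_age_pred[OF n E U(1)])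
  have U_meas[measurable]: "U \<in> sets borel" by (rule U(1))
  have "(\<integral>\<^sup>+\<omega>. indicator E \<omega> * emeasure (q \<omega>) (Pair \<omega> -` (W \<inter> fresh n) \<inter> {u. u - T n \<omega> \<in> U} \<times> UNIV) \<partial>M) =
      (\<integral>\<^sup>+\<omega>. emeasure (q \<omega>) (Pair \<omega> -` ?A) \<partial>M)"
  proof (rule nn_integral_cong_AE)
    show "AE \<omega> in M. indicator E \<omega> * emeasure (q \<omega>) (Pair \<omega> -` (W \<inter> fresh n) \<inter> {u. u - T n \<omega> \<in> U} \<times> UNIV) =
      emeasure (q \<omega>) (Pair \<omega> -` ?A)"
      using AE_stage[of n]
    proof eventually_elim
      case (elim \<omega>)
      have "Pair \<omega> -` ?A = (if \<omega> \<in> E then Pair \<omega> -` (W \<inter> fresh n) \<inter> {u. u - T n \<omega> \<in> U} \<times> UNIV else {})"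
        using U(2) elim by (auto simp: stage_def)
      then show ?case by simp
    qed
  qed
  also have "\<dots> = (\<integral>\<^sup>+\<omega>. emeasure lborel (Pair \<omega> -` ?A) \<partial>M)" by (rule campbell[OF A])
  also have "\<dots> = (\<integral>\<^sup>+\<omega>. (\<integral>\<^sup>+w. indicator E \<omega> * (indicator U w * \<rho> w * indicator {..sojourn n \<omega>} w) \<partial>lborel) \<partial>M)"
  proof (rule nn_integral_cong_AE)
    show "AE \<omega> in M. emeasure lborel (Pair \<omega> -` ?A) =
      (\<integral>\<^sup>+w. indicator E \<omega> * (indicator U w * \<rho> w * indicator {..sojourn n \<omega>} w) \<partial>lborel)"
      using AE_jump_n[of n] AE_space
    proof eventually_elim
      case (elim \<omega>)
      note j = elim(1)
      then have st: "stage n \<omega>" by (rule jump_stage)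
      show ?case
      proof (cases "\<omega> \<in> E")
        case True
        let ?t = "T n \<omega>"
        have "Pair \<omega> -` ?A \<in> sets (lborel \<Otimes>\<^sub>M lborel)"
          using pred_section[OF A] by (simp only: lborel_prod sets_lborel)
        then have "emeasure lborel (Pair \<omega> -` ?A) = (\<integral>\<^sup>+u. emeasure lborel (Pair u -` (Pair \<omega> -` ?A)) \<partial>lborel)"
          unfolding lborel_prod[symmetric] by (rule lborel.emeasure_pair_measure_alt)
        \<comment> \<open>The elapsed time replaces u; the shape \<open>- ?t + 1 * u\<close> is that
          of the affine substitution rule.\<close>
        also have "\<dots> = (\<integral>\<^sup>+u. indicator U (- ?t + 1 * u) * \<rho> (- ?t + 1 * u) * indicator {..sojourn n \<omega>} (- ?t + 1 * u) \<partial>lborel)"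
        proof (rule nn_integral_cong)
          fix u
          have "Pair u -` (Pair \<omega> -` ?A) = (if u - ?t \<in> U \<and> u - ?t \<le> sojourn n \<omega> then \<Gamma> (u - ?t) else {})"
          proof (rule set_eqI)
            fix v
            have "(u, v) \<in> Pair \<omega> -` W \<longleftrightarrow> ?t < u \<and> v \<in> \<Gamma> (u - ?t)" unfolding W_section[OF True j] by simp
            moreover have "(u, v) \<in> Pair \<omega> -` fresh n \<longleftrightarrow> 0 < u \<and> u \<le> T (Suc n) \<omega>"
              unfolding fresh_section[OF observed elim(2) j] by simp
            moreover have "0 \<le> ?t" using st by (simp add: stage_def)
            moreover have "u - ?t \<le> sojourn n \<omega> \<longleftrightarrow> u \<le> T (Suc n) \<omega>"
              using n by (simp add: sojourn_def origin_pos)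
            moreover have "u - ?t \<in> U \<Longrightarrow> ?t < u" using U(2) by auto
            ultimately show "v \<in> Pair u -` (Pair \<omega> -` ?A) \<longleftrightarrow> v \<in> (if u - ?t \<in> U \<and> u - ?t \<le> sojourn n \<omega> then \<Gamma> (u - ?t) else {})"
              using True by auto
          qed
          moreover have "0 < u - ?t" if "u - ?t \<in> U" using that U(2) by blast
          ultimately show "emeasure lborel (Pair u -` (Pair \<omega> -` ?A)) =
            indicator U (- ?t + 1 * u) * \<rho> (- ?t + 1 * u) * indicator {..sojourn n \<omega>} (- ?t + 1 * u)"
            using \<Gamma>[of "u - ?t"] by (auto simp: indicator_def)
        qed
        also have "\<dots> = (\<integral>\<^sup>+w. indicator U w * \<rho> w * indicator {..sojourn n \<omega>} w \<partial>lborel)"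
          by (subst (2) nn_integral_real_affine[where c=1 and t="- ?t"]) auto
        finally show ?thesis using True by simp
      next
        case False
        then have "Pair \<omega> -` ?A = {}" by auto
        then show ?thesis using False by simp
      qed
    qed
  qed
  also have "\<dots> = (\<integral>\<^sup>+w. (\<integral>\<^sup>+\<omega>. indicator E \<omega> * (indicator U w * \<rho> w * indicator {..sojourn n \<omega>} w) \<partial>M) \<partial>lborel)"
  proof -
    interpret pair_sigma_finite M lborel
      by (intro pair_sigma_finite.intro lborel.sigma_finite_measure_axioms sigma_finite_measure_axioms)
    have ind: "indicator {..sojourn n \<omega>} w = (if w \<le> sojourn n \<omega> then 1 else 0 :: ennreal)" for \<omega> w
      by (simp add: indicator_def)
    have "(\<lambda>(\<omega>, w). indicator E \<omega> * (indicator U w * \<rho> w * indicator {..sojourn n \<omega>} w)) \<in> borel_measurable (M \<Otimes>\<^sub>M lborel)"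
      unfolding ind by measurable
    from Fubini'[OF this] show ?thesis by (rule sym)
  qed
  also have "\<dots> = (\<integral>\<^sup>+w. indicator U w * \<rho> w * emeasure M {\<omega>\<in>E. w \<le> sojourn n \<omega>} \<partial>lborel)"
  proof (rule nn_integral_cong)
    fix w
    have "{\<omega>\<in>space M. \<omega> \<in> E \<and> w \<le> sojourn n \<omega>} \<in> events" by measurable
    also have "{\<omega>\<in>space M. \<omega> \<in> E \<and> w \<le> sojourn n \<omega>} = {\<omega>\<in>E. w \<le> sojourn n \<omega>}"
      using sets.sets_into_space[OF EM] by auto
    finally have ev: "{\<omega>\<in>E. w \<le> sojourn n \<omega>} \<in> events" .
    have "(\<integral>\<^sup>+\<omega>. indicator E \<omega> * (indicator U w * \<rho> w * indicator {..sojourn n \<omega>} w) \<partial>M) =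
      (\<integral>\<^sup>+\<omega>. (indicator U w * \<rho> w) * indicator {\<omega>\<in>E. w \<le> sojourn n \<omega>} \<omega> \<partial>M)"
      by (intro nn_integral_cong) (auto simp: indicator_def)
    also have "\<dots> = indicator U w * \<rho> w * emeasure M {\<omega>\<in>E. w \<le> sojourn n \<omega>}"
      using ev by (rule nn_integral_cmult_indicator)
    finally show "(\<integral>\<^sup>+\<omega>. indicator E \<omega> * (indicator U w * \<rho> w * indicator {..sojourn n \<omega>} w) \<partial>M) =
      indicator U w * \<rho> w * emeasure M {\<omega>\<in>E. w \<le> sojourn n \<omega>}" .
  qed
  finally show ?thesis .
qed

lemma stopped_events: "stopped n E \<Longrightarrow> E \<in> events"
  by (simp add: stopped_def)

lemma restrict_event:
  assumes "E \<in> events" "Measurable.pred M P"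
  shows "{\<omega>\<in>E. P \<omega>} \<in> events"
proof -
  have "E \<inter> {\<omega>\<in>space M. P \<omega>} \<in> events" using assms by (intro sets.Int) auto
  also have "E \<inter> {\<omega>\<in>space M. P \<omega>} = {\<omega>\<in>E. P \<omega>}" using sets.sets_into_space[OF assms(1)] by auto
  finally show ?thesis .
qed

text \<open>The total rate is the hazard rate of the sojourn: the compensator formula is applied to
  the whole exit region. Since sojourns are positive, those shorter than y are counted on the open
  interval from 0 to y.\<close>

lemma sojourn_law:
  assumes n: "1 \<le> n" and E: "stopped n E" "\<And>\<omega>. \<omega> \<in> E \<Longrightarrow> state n \<omega> = i" and i: "i \<in> states"
  shows "emeasure M {\<omega>\<in>E. sojourn n \<omega> < y} =
    (\<integral>\<^sup>+w\<in>{0<..<y}. total_rate lam i w n * emeasure M {\<omega>\<in>E. w \<le> sojourn n \<omega>} \<partial>lborel)"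
proof -
  let ?\<rho> = "\<lambda>w. if 0 \<le> w then total_rate lam i w n else 0"
  have EM[measurable]: "E \<in> events" using E by (simp add: stopped_def)
  have "emeasure M {\<omega>\<in>E. sojourn n \<omega> < y} = (\<integral>\<^sup>+\<omega>. indicator {\<omega>\<in>E. sojourn n \<omega> < y} \<omega> \<partial>M)"
    by (intro nn_integral_indicator[symmetric] restrict_event EM) measurable
  also have "\<dots> = (\<integral>\<^sup>+\<omega>. indicator E \<omega> * emeasure (q \<omega>) (Pair \<omega> -` (exits n \<inter> fresh n) \<inter> {u. u - T n \<omega> \<in> {0<..<y}} \<times> UNIV) \<partial>M)"
  proof (rule nn_integral_cong_AE)
    show "AE \<omega> in M. indicator {\<omega>\<in>E. sojourn n \<omega> < y} \<omega> =
      indicator E \<omega> * emeasure (q \<omega>) (Pair \<omega> -` (exits n \<inter> fresh n) \<inter> {u. u - T n \<omega> \<in> {0<..<y}} \<times> UNIV)"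
      using AE_jump_n[of n] AE_space
    proof eventually_elim
      case (elim \<omega>)
      note j = elim(1)
      have "{u. u - T n \<omega> \<in> {0<..<y}} \<in> sets borel" by measurable
      from emeasure_reg_fresh(2)[OF observed elim(2) j this] sojourn_pos[OF n j]
      show ?case using n by (auto simp: indicator_def sojourn_def origin_pos origin_Suc)
    qed
  qed
  also have "\<dots> = (\<integral>\<^sup>+w. indicator {0<..<y} w * ?\<rho> w * emeasure M {\<omega>\<in>E. w \<le> sojourn n \<omega>} \<partial>lborel)"
  proof (rule sojourn_compensator[OF n E(1)])
    show "exits n \<in> sets pred" by (rule exits_pred[OF observed])
    show "?\<rho> \<in> borel_measurable borel" by (rule total_rate_borel[OF i])
    show "Pair \<omega> -` exits n = {(u, v). T n \<omega> < u \<and> v \<in> exit_set i (u - T n \<omega>) n}" if "\<omega> \<in> E" "jump n \<omega>" for \<omega>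
      using that exits_section[OF _ jump_stage[OF that(2)]] sets.sets_into_space[OF EM] E(2) n by (auto simp: origin_pos)
    show "emeasure lborel (exit_set i w n) = ?\<rho> w" if "0 < w" for w
      using emeasure_exit_set[OF i, of w n] that by simp
  qed auto
  also have "\<dots> = (\<integral>\<^sup>+w\<in>{0<..<y}. total_rate lam i w n * emeasure M {\<omega>\<in>E. w \<le> sojourn n \<omega>} \<partial>lborel)"
    by (intro nn_integral_cong) (auto simp: indicator_def)
  finally show ?thesis .
qed

text \<open>The compensator formula for the candidates with target j alone, whose slices have length
  \<open>lam i j\<close>.\<close>

lemma transition_law:
  assumes n: "1 \<le> n" and E: "stopped n E" "\<And>\<omega>. \<omega> \<in> E \<Longrightarrow> state n \<omega> = i" and ij: "(i, j) \<in> state_pairs"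
  shows "emeasure M {\<omega>\<in>E. state (Suc n) \<omega> = j \<and> sojourn n \<omega> \<le> y} =
    (\<integral>\<^sup>+w\<in>{0<..y}. ennreal (lam i j w n) * emeasure M {\<omega>\<in>E. w \<le> sojourn n \<omega>} \<partial>lborel)"
proof -
  let ?\<rho> = "\<lambda>w. ennreal (if 0 \<le> w then lam i j w n else 0)"
  have i: "i \<in> states" and j: "j \<in> states - {i}" using ij by (auto simp: state_pairs_def)
  have EM[measurable]: "E \<in> events" using E by (simp add: stopped_def)
  have "emeasure M {\<omega>\<in>E. state (Suc n) \<omega> = j \<and> sojourn n \<omega> \<le> y} = (\<integral>\<^sup>+\<omega>. indicator {\<omega>\<in>E. state (Suc n) \<omega> = j \<and> sojourn n \<omega> \<le> y} \<omega> \<partial>M)"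
    by (intro nn_integral_indicator[symmetric] restrict_event EM) measurable
  also have "\<dots> = (\<integral>\<^sup>+\<omega>. indicator E \<omega> * emeasure (q \<omega>) (Pair \<omega> -` (reg n j \<inter> fresh n) \<inter> {u. u - T n \<omega> \<in> {0<..y}} \<times> UNIV) \<partial>M)"
  proof (rule nn_integral_cong_AE)
    show "AE \<omega> in M. indicator {\<omega>\<in>E. state (Suc n) \<omega> = j \<and> sojourn n \<omega> \<le> y} \<omega> =
      indicator E \<omega> * emeasure (q \<omega>) (Pair \<omega> -` (reg n j \<inter> fresh n) \<inter> {u. u - T n \<omega> \<in> {0<..y}} \<times> UNIV)"
      using AE_jump_n[of n] AE_space
    proof eventually_elim
      case (elim \<omega>)
      note j = elim(1)
      have "{u. u - T n \<omega> \<in> {0<..y}} \<in> sets borel" by measurable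
      from emeasure_reg_fresh(1)[OF observed elim(2) j this] sojourn_pos[OF n j]
      show ?case using n by (auto simp: indicator_def sojourn_def origin_pos origin_Suc)
    qed
  qed
  also have "\<dots> = (\<integral>\<^sup>+w. indicator {0<..y} w * ?\<rho> w * emeasure M {\<omega>\<in>E. w \<le> sojourn n \<omega>} \<partial>lborel)"
  proof (rule sojourn_compensator[OF n E(1)])
    show "reg n j \<in> sets pred" by (rule reg_pred[OF observed])
    show "?\<rho> \<in> borel_measurable borel" using lam_borel[OF ij] by simp
    show "Pair \<omega> -` reg n j = {(u, v). T n \<omega> < u \<and> v \<in> \<Lambda> i j (u - T n \<omega>) n}" if "\<omega> \<in> E" "jump n \<omega>" for \<omega>
      using that reg_section[OF _ jump_stage[OF that(2)]] sets.sets_into_space[OF EM] E(2) n j by (auto simp: origin_pos)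
    show "emeasure lborel (\<Lambda> i j w n) = ?\<rho> w" if "0 < w" for w
      using emeasure_Lam[OF ij, of w n] that by simp
  qed auto
  also have "\<dots> = (\<integral>\<^sup>+w\<in>{0<..y}. ennreal (lam i j w n) * emeasure M {\<omega>\<in>E. w \<le> sojourn n \<omega>} \<partial>lborel)"
    by (intro nn_integral_cong) (auto simp: indicator_def)
  finally show ?thesis .
qed

end

section \<open>The Markov property at the jump times\<close>

context semi_markov_process
begin

abbreviation survival :: "nat \<Rightarrow> 'a set \<Rightarrow> real \<Rightarrow> real" where
  "survival n E w \<equiv> prob {\<omega>\<in>E. w \<le> sojourn n \<omega>}"

lemma survival_event: "E \<in> events \<Longrightarrow> {\<omega>\<in>E. w \<le> sojourn n \<omega>} \<in> events"
  by (rule restrict_event, assumption) measurable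

lemma survival_borel:
  assumes E: "E \<in> events"
  shows "survival n E \<in> borel_measurable borel"
proof -
  have "(\<lambda>w. - survival n E w) \<in> borel_measurable borel"
    by (rule borel_measurable_mono, rule monoI) (auto intro!: finite_measure_mono survival_event E)
  then have "(\<lambda>w. - (- survival n E w)) \<in> borel_measurable borel" by (rule borel_measurable_uminus)
  then show ?thesis by simp
qed

text \<open>The survival functions of two events on which \<open>X\<^sub>T\<^sub>n = i\<close> solve the same linear Volterra
  equation, whose solution is determined by its initial value.\<close>

lemma survival_proportional:
  assumes n: "1 \<le> n" and i: "i \<in> states"
    and E: "stopped n E" "\<And>\<omega>. \<omega> \<in> E \<Longrightarrow> state n \<omega> = i"
    and S: "stopped n S" "\<And>\<omega>. \<omega> \<in> S \<Longrightarrow> state n \<omega> = i"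
    and y: "0 \<le> y"
  shows "prob S * survival n E y = prob E * survival n S y"
proof -
  \<comment> \<open>A real-valued version of the total rate; the two agree at almost every
    nonnegative age, where the total rate is finite.\<close>
  define rate where "rate w = enn2real (if 0 \<le> w then total_rate lam i w n else 0)" for w
  have rate[measurable]: "rate \<in> borel_measurable borel"
    unfolding rate_def using total_rate_borel[OF i] by measurable
  have rate_nonneg: "0 \<le> rate w" for w by (simp add: rate_def)
  have ae: "AE w in lborel. 0 \<le> w \<longrightarrow> total_rate lam i w n = ennreal (rate w) \<and> rate w \<le> rate_sup"
    using total_rate_le[OF i, of n]
  proof eventually_elim
    case (elim w)
    show ?case
    proof
      assume w: "0 \<le> w"
      with elim have le: "total_rate lam i w n \<le> ennreal rate_sup" by blast
      then have "total_rate lam i w n < top" by (rule order.strict_trans1) simp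
      moreover have "enn2real (total_rate lam i w n) \<le> rate_sup"
        using le by (intro enn2real_leI) (auto simp: rate_sup_def)
      ultimately show "total_rate lam i w n = ennreal (rate w) \<and> rate w \<le> rate_sup"
        using w by (simp add: rate_def)
    qed
  qed
  have volterra: "has_bochner_integral lborel (\<lambda>w. indicator {0<..<y} w * (rate w * survival n E w)) (prob E - survival n E y)"
    if E: "stopped n E" "\<And>\<omega>. \<omega> \<in> E \<Longrightarrow> state n \<omega> = i" for E y
  proof (rule has_bochner_integral_nn_integral)
    have EM: "E \<in> events" by (rule stopped_events[OF E(1)])
    note [measurable] = survival_borel[OF EM, of n]
    show "(\<lambda>w. indicator {0<..<y} w * (rate w * survival n E w)) \<in> borel_measurable lborel" by measurable
    show "AE w in lborel. 0 \<le> indicator {0<..<y} w * (rate w * survival n E w)"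
      using rate_nonneg by (intro AE_I2) (simp add: indicator_def)
    show "0 \<le> prob E - survival n E y" using EM by (simp add: finite_measure_mono)
    have "{\<omega>\<in>E. sojourn n \<omega> < y} = E - {\<omega>\<in>E. y \<le> sojourn n \<omega>}" by auto
    then have "prob E - survival n E y = prob {\<omega>\<in>E. sojourn n \<omega> < y}"
      using EM survival_event[OF EM] by (simp only:) (subst finite_measure_Diff, auto)
    then have "ennreal (prob E - survival n E y) = emeasure M {\<omega>\<in>E. sojourn n \<omega> < y}"
      by (simp add: emeasure_eq_measure)
    also have "\<dots> = (\<integral>\<^sup>+w\<in>{0<..<y}. total_rate lam i w n * emeasure M {\<omega>\<in>E. w \<le> sojourn n \<omega>} \<partial>lborel)"
      by (rule sojourn_law[OF n E i])
    also have "\<dots> = (\<integral>\<^sup>+w. ennreal (indicator {0<..<y} w * (rate w * survival n E w)) \<partial>lborel)"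
      using ae by (intro nn_integral_cong_AE, eventually_elim)
        (auto simp: indicator_def emeasure_eq_measure ennreal_mult rate_nonneg)
    finally show "(\<integral>\<^sup>+w. ennreal (indicator {0<..<y} w * (rate w * survival n E w)) \<partial>lborel) = ennreal (prob E - survival n E y)" ..
  qed
  \<comment> \<open>Cross-multiplication makes the constant terms of the two equations cancel, so
    \<open>h\<close> solves the homogeneous equation. As a difference of two products of
    probabilities it is bounded by 2.\<close>
  define h where "h w = prob S * survival n E w - prob E * survival n S w" for w
  have "h y = 0"
  proof (rule gronwall_zero[where h=h and c=rate_sup and K=2])
    show "0 \<le> rate_sup" by (simp add: rate_sup_def)
    show "\<bar>h w\<bar> \<le> 2" for w
    proof -
      have "0 \<le> prob S * survival n E w" "prob S * survival n E w \<le> 1"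
        "0 \<le> prob E * survival n S w" "prob E * survival n S w \<le> 1"
        by (auto intro!: mult_le_one mult_nonneg_nonneg)
      then show ?thesis unfolding h_def by linarith
    qed
    fix y :: real
    have int: "has_bochner_integral lborel (\<lambda>w. prob E * (indicator {0<..<y} w * (rate w * survival n S w)) -
        prob S * (indicator {0<..<y} w * (rate w * survival n E w)))
        (prob E * (prob S - survival n S y) - prob S * (prob E - survival n E y))"
      by (intro has_bochner_integral_diff has_bochner_integral_mult_right volterra E S)
    have "(\<lambda>w. prob E * (indicator {0<..<y} w * (rate w * survival n S w)) -
        prob S * (indicator {0<..<y} w * (rate w * survival n E w))) = (\<lambda>w. - (indicator {0<..<y} w * (rate w * h w)))"
      by (auto simp: h_def algebra_simps)
    moreover have "prob E * (prob S - survival n S y) - prob S * (prob E - survival n E y) = h y"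
      by (simp add: h_def algebra_simps)
    ultimately have hy: "has_bochner_integral lborel (\<lambda>w. - (indicator {0<..<y} w * (rate w * h w))) (h y)"
      using int by simp
    then have "ennreal \<bar>h y\<bar> \<le> (\<integral>\<^sup>+w. norm (- (indicator {0<..<y} w * (rate w * h w))) \<partial>lborel)"
      using integral_norm_bound_ennreal[of lborel "\<lambda>w. - (indicator {0<..<y} w * (rate w * h w))"]
      by (simp add: has_bochner_integral_iff)
    also have "\<dots> \<le> (\<integral>\<^sup>+w\<in>{0<..<y}. ennreal (rate_sup * \<bar>h w\<bar>) \<partial>lborel)"
    proof (rule nn_integral_mono_AE)
      show "AE w in lborel. ennreal (norm (- (indicator {0<..<y} w * (rate w * h w)))) \<le> ennreal (rate_sup * \<bar>h w\<bar>) * indicator {0<..<y} w"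
        using ae
      proof eventually_elim
        case (elim w)
        show ?case
        proof (cases "w \<in> {0<..<y}")
          case True
          then have "rate w * \<bar>h w\<bar> \<le> rate_sup * \<bar>h w\<bar>" using elim by (intro mult_right_mono) auto
          then show ?thesis using True rate_nonneg[of w] by (simp add: abs_mult ennreal_leI)
        qed simp
      qed
    qed
    finally show "ennreal \<bar>h y\<bar> \<le> (\<integral>\<^sup>+w\<in>{0<..<y}. ennreal (rate_sup * \<bar>h w\<bar>) \<partial>lborel)" .
  qed (rule y)
  then show ?thesis by (simp add: h_def)
qed

text \<open>A transition probability is the integral of the survival function against a kernel that
  depends only on i, j and n, so proportionality carries over. If (i, j) is not an admissible pair,
  both sides are 0, because the next state is almost surely an element of \<open>states\<close>
  different from i.\<close>

lemma transition_proportional: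
  assumes n: "1 \<le> n" and i: "i \<in> states"
    and E: "stopped n E" "\<And>\<omega>. \<omega> \<in> E \<Longrightarrow> state n \<omega> = i"
    and S: "stopped n S" "\<And>\<omega>. \<omega> \<in> S \<Longrightarrow> state n \<omega> = i"
  shows "prob S * prob {\<omega>\<in>E. state (Suc n) \<omega> = j \<and> sojourn n \<omega> \<le> y} =
    prob E * prob {\<omega>\<in>S. state (Suc n) \<omega> = j \<and> sojourn n \<omega> \<le> y}"
proof (cases "(i, j) \<in> state_pairs")
  case True
  note [measurable] = survival_borel[OF stopped_events[OF E(1)], of n] survival_borel[OF stopped_events[OF S(1)], of n]
  have [measurable]: "(\<lambda>w. if 0 \<le> w then lam i j w n else 0) \<in> borel_measurable borel" by (rule lam_borel[OF True])
  define l where "l w = ennreal (if 0 \<le> w then lam i j w n else 0)" for w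
  have [measurable]: "l \<in> borel_measurable borel" unfolding l_def by measurable
  have law: "ennreal c * emeasure M {\<omega>\<in>E. state (Suc n) \<omega> = j \<and> sojourn n \<omega> \<le> y} =
      (\<integral>\<^sup>+w. l w * indicator {0<..y} w * ennreal (c * survival n E w) \<partial>lborel)"
    if E: "stopped n E" "\<And>\<omega>. \<omega> \<in> E \<Longrightarrow> state n \<omega> = i" and c: "0 \<le> c" for E c
  proof -
    note [measurable] = survival_borel[OF stopped_events[OF E(1)], of n]
    have "emeasure M {\<omega>\<in>E. state (Suc n) \<omega> = j \<and> sojourn n \<omega> \<le> y} =
      (\<integral>\<^sup>+w\<in>{0<..y}. ennreal (lam i j w n) * emeasure M {\<omega>\<in>E. w \<le> sojourn n \<omega>} \<partial>lborel)"
      by (rule transition_law[OF n E True])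
    also have "\<dots> = (\<integral>\<^sup>+w. l w * indicator {0<..y} w * ennreal (survival n E w) \<partial>lborel)"
      by (intro nn_integral_cong) (auto simp: l_def indicator_def emeasure_eq_measure)
    finally have "ennreal c * emeasure M {\<omega>\<in>E. state (Suc n) \<omega> = j \<and> sojourn n \<omega> \<le> y} =
      (\<integral>\<^sup>+w. ennreal c * (l w * indicator {0<..y} w * ennreal (survival n E w)) \<partial>lborel)"
      by (subst nn_integral_cmult) auto
    also have "\<dots> = (\<integral>\<^sup>+w. l w * indicator {0<..y} w * ennreal (c * survival n E w) \<partial>lborel)"
      using c by (intro nn_integral_cong) (simp add: ennreal_mult ac_simps)
    finally show ?thesis .
  qed
  have "ennreal (prob S) * emeasure M {\<omega>\<in>E. state (Suc n) \<omega> = j \<and> sojourn n \<omega> \<le> y} =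
    (\<integral>\<^sup>+w. l w * indicator {0<..y} w * ennreal (prob S * survival n E w) \<partial>lborel)"
    by (rule law[OF E measure_nonneg])
  also have "\<dots> = (\<integral>\<^sup>+w. l w * indicator {0<..y} w * ennreal (prob E * survival n S w) \<partial>lborel)"
    by (intro nn_integral_cong) (auto simp: survival_proportional[OF n i E S] indicator_def)
  also have "\<dots> = ennreal (prob E) * emeasure M {\<omega>\<in>S. state (Suc n) \<omega> = j \<and> sojourn n \<omega> \<le> y}"
    by (rule law[OF S measure_nonneg, symmetric])
  finally have "ennreal (prob S * prob {\<omega>\<in>E. state (Suc n) \<omega> = j \<and> sojourn n \<omega> \<le> y}) =
    ennreal (prob E * prob {\<omega>\<in>S. state (Suc n) \<omega> = j \<and> sojourn n \<omega> \<le> y})"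
    by (simp add: emeasure_eq_measure ennreal_mult)
  then show ?thesis by (subst (asm) ennreal_inj) auto
next
  case False
  have "prob {\<omega>\<in>E. state (Suc n) \<omega> = j \<and> sojourn n \<omega> \<le> y} = 0"
    if "stopped n E" "\<And>\<omega>. \<omega> \<in> E \<Longrightarrow> state n \<omega> = i" for E
  proof -
    have "{\<omega>\<in>E. state (Suc n) \<omega> = j \<and> sojourn n \<omega> \<le> y} \<in> events"
      by (rule restrict_event[OF stopped_events[OF that(1)]]) measurable
    moreover have "AE \<omega> in M. \<omega> \<notin> {\<omega>\<in>E. state (Suc n) \<omega> = j \<and> sojourn n \<omega> \<le> y}"
      using AE_jump_n[of n]
    proof eventually_elim
      case (elim \<omega>)
      have "state (Suc n) \<omega> \<in> states" "state (Suc n) \<omega> \<noteq> state n \<omega>"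
        using jump_stage_Suc[OF elim] jump_state_neq[OF elim] by (auto simp: stage_def)
      then show ?case using False i that(2)[of \<omega>] by (auto simp: state_pairs_def)
    qed
    ultimately show ?thesis by (simp add: prob_eq_0)
  qed
  from this[OF E] this[OF S] show ?thesis by simp
qed

section \<open>Conditional independence of past and next jump\<close>

definition history :: "nat \<Rightarrow> 'a \<Rightarrow> nat \<Rightarrow> nat \<times> real" where
  "history n \<omega> = (\<lambda>k\<in>{..n}. (state k \<omega>, origin k \<omega>))"

abbreviation history_space :: "nat \<Rightarrow> (nat \<Rightarrow> nat \<times> real) measure" where
  "history_space n \<equiv> PiM {..n} (\<lambda>_. count_space UNIV \<Otimes>\<^sub>M borel)"

lemma history_measurable[measurable]: "history n \<in> measurable M (history_space n)"
  unfolding history_def by (intro measurable_restrict measurable_Pair state_measurable origin_measurable)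

text \<open>The part of the history visible at time s, with the dummy entry (0, 0) for jumps still
  to come. This makes it measurable for \<open>G s\<close>, which the history itself is in general
  not.\<close>

definition snapshot :: "real \<Rightarrow> nat \<Rightarrow> 'a \<Rightarrow> nat \<times> real" where
  "snapshot s k \<omega> = (if T k \<omega> \<le> s then (state k \<omega>, origin k \<omega>) else (0, 0))"

lemma snapshot_started:
  assumes s: "0 \<le> s"
  shows "{\<omega>\<in>space M. state k \<omega> = i \<and> T k \<omega> \<le> s} \<in> sets (G s)"
    and "{\<omega>\<in>space M. origin k \<omega> \<le> t \<and> T k \<omega> \<le> s} \<in> sets (G s)"
    and "{\<omega>\<in>space M. T k \<omega> \<le> s} \<in> sets (G s)"
proof -
  have obs: "{\<omega>\<in>space M. state k \<omega> = i \<and> origin k \<omega> \<le> t \<and> T k \<omega> \<le> s} \<in> sets (G s)" for i t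
    using observed[of k] s by (simp add: observed_def)
  have "(\<Union>t::nat. {\<omega>\<in>space M. state k \<omega> = i \<and> origin k \<omega> \<le> real t \<and> T k \<omega> \<le> s}) \<in> sets (G s)" for i
    using obs by (intro sets.countable_UN'') auto
  also have "(\<Union>t::nat. {\<omega>\<in>space M. state k \<omega> = i \<and> origin k \<omega> \<le> real t \<and> T k \<omega> \<le> s}) =
    {\<omega>\<in>space M. state k \<omega> = i \<and> T k \<omega> \<le> s}" for i
    by (auto simp: real_arch_simple)
  finally show 1: "{\<omega>\<in>space M. state k \<omega> = i \<and> T k \<omega> \<le> s} \<in> sets (G s)" for i .
  have "(\<Union>i. {\<omega>\<in>space M. state k \<omega> = i \<and> origin k \<omega> \<le> t \<and> T k \<omega> \<le> s}) \<in> sets (G s)"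
    using obs by (intro sets.countable_UN'') auto
  also have "(\<Union>i. {\<omega>\<in>space M. state k \<omega> = i \<and> origin k \<omega> \<le> t \<and> T k \<omega> \<le> s}) =
    {\<omega>\<in>space M. origin k \<omega> \<le> t \<and> T k \<omega> \<le> s}" by auto
  finally show "{\<omega>\<in>space M. origin k \<omega> \<le> t \<and> T k \<omega> \<le> s} \<in> sets (G s)" .
  have "(\<Union>i. {\<omega>\<in>space M. state k \<omega> = i \<and> T k \<omega> \<le> s}) \<in> sets (G s)"
    using 1 by (intro sets.countable_UN'') auto
  also have "(\<Union>i. {\<omega>\<in>space M. state k \<omega> = i \<and> T k \<omega> \<le> s}) = {\<omega>\<in>space M. T k \<omega> \<le> s}" by auto
  finally show "{\<omega>\<in>space M. T k \<omega> \<le> s} \<in> sets (G s)" .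
qed

lemma snapshot_measurable:
  assumes s: "0 \<le> s"
  shows "snapshot s k \<in> measurable (G s) (count_space UNIV \<Otimes>\<^sub>M borel)"
proof -
  have late: "space M - {\<omega>\<in>space M. T k \<omega> \<le> s} \<in> sets (G s)"
    using snapshot_started(3)[OF s, of k] space_G[OF s] by (metis sets.compl_sets)
  have 1: "(\<lambda>\<omega>. if T k \<omega> \<le> s then state k \<omega> else 0) \<in> measurable (G s) (count_space UNIV)"
  proof (rule measurable_count_space_eq2_countable[THEN iffD2], intro conjI ballI)
    fix i
    have "(\<lambda>\<omega>. if T k \<omega> \<le> s then state k \<omega> else 0) -` {i} \<inter> space (G s) =
      {\<omega>\<in>space M. state k \<omega> = i \<and> T k \<omega> \<le> s} \<union> (if i = 0 then space M - {\<omega>\<in>space M. T k \<omega> \<le> s} else {})"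
      by (auto simp: space_G[OF s] split: if_splits)
    then show "(\<lambda>\<omega>. if T k \<omega> \<le> s then state k \<omega> else 0) -` {i} \<inter> space (G s) \<in> sets (G s)"
      using late snapshot_started(1)[OF s, of k i] by auto
  qed auto
  have 2: "(\<lambda>\<omega>. if T k \<omega> \<le> s then origin k \<omega> else 0) \<in> borel_measurable (G s)"
  proof (rule borel_measurable_iff_le[THEN iffD2], rule allI)
    fix t
    have "{\<omega>\<in>space (G s). (if T k \<omega> \<le> s then origin k \<omega> else 0) \<le> t} =
      {\<omega>\<in>space M. origin k \<omega> \<le> t \<and> T k \<omega> \<le> s} \<union> (if 0 \<le> t then space M - {\<omega>\<in>space M. T k \<omega> \<le> s} else {})"
      by (auto simp: space_G[OF s] split: if_splits)
    then show "{\<omega>\<in>space (G s). (if T k \<omega> \<le> s then origin k \<omega> else 0) \<le> t} \<in> sets (G s)"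
      using late snapshot_started(2)[OF s, of k t] by auto
  qed
  have "snapshot s k = (\<lambda>\<omega>. (if T k \<omega> \<le> s then state k \<omega> else 0, if T k \<omega> \<le> s then origin k \<omega> else 0))"
    by (auto simp: snapshot_def fun_eq_iff)
  then show ?thesis using measurable_Pair[OF 1 2] by simp
qed

text \<open>When \<open>T n \<le> s\<close>, all earlier jump times are almost surely at most s as
  well, so the history coincides with the snapshot at s.\<close>

lemma stopped_history:
  assumes B: "B \<in> sets (history_space n)"
  shows "stopped n {\<omega>\<in>space M. history n \<omega> \<in> B \<and> state n \<omega> = i}"
  unfolding stopped_def
proof (intro conjI allI impI)
  show "{\<omega>\<in>space M. history n \<omega> \<in> B \<and> state n \<omega> = i} \<in> events" using B by measurable
  fix s :: real assume s: "0 \<le> s"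
  let ?A = "{\<omega>\<in>space M. T n \<omega> \<le> s} \<inter> {\<omega>\<in>space M. state n \<omega> = i \<and> T n \<omega> \<le> s} \<inter>
    ((\<lambda>\<omega>. \<lambda>k\<in>{..n}. snapshot s k \<omega>) -` B \<inter> space (G s))"
  have "(\<lambda>\<omega>. \<lambda>k\<in>{..n}. snapshot s k \<omega>) \<in> measurable (G s) (history_space n)"
    by (intro measurable_restrict snapshot_measurable s)
  then have A: "?A \<in> sets (G s)" using B by (intro sets.Int snapshot_started s measurable_sets)
  show "{\<omega> \<in> {\<omega>\<in>space M. history n \<omega> \<in> B \<and> state n \<omega> = i}. T n \<omega> \<le> s} \<in> sets (G s)"
  proof (rule sets_G_AE[OF s A])
    show "AE \<omega> in M. \<omega> \<in> ?A \<longleftrightarrow> \<omega> \<in> {\<omega> \<in> {\<omega>\<in>space M. history n \<omega> \<in> B \<and> state n \<omega> = i}. T n \<omega> \<le> s}"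
      using AE_stage[of n]
    proof eventually_elim
      case (elim \<omega>)
      have "(\<lambda>k\<in>{..n}. snapshot s k \<omega>) = history n \<omega>" if "T n \<omega> \<le> s"
        using elim that by (auto simp: history_def snapshot_def stage_def intro!: restrict_ext)
      then show ?case by (auto simp: space_G[OF s])
    qed
  qed auto
qed

lemma state_AE: "AE \<omega> in M. state n \<omega> \<in> states"
  using AE_stage[of n] by eventually_elim (simp add: stage_def)

lemma prob_state_0: "i \<notin> states \<Longrightarrow> prob {\<omega>\<in>space M. state n \<omega> = i} = 0"
  using state_AE[of n] by (subst prob_eq_0) (auto elim!: eventually_mono)

text \<open>Proportionality of the transition probabilities, for a history event within the event
  that the state is i and for that latter event alone. Values i outside \<open>states\<close> have
  probability 0.\<close>

lemma markov_property:
  assumes n: "1 \<le> n" and B: "B \<in> sets (history_space n)"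
  shows "prob ({\<omega>\<in>space M. history n \<omega> \<in> B} \<inter> {\<omega>\<in>space M. state (Suc n) \<omega> = j \<and> sojourn n \<omega> \<le> y} \<inter> {\<omega>\<in>space M. state n \<omega> = i}) *
      prob {\<omega>\<in>space M. state n \<omega> = i} =
    prob ({\<omega>\<in>space M. history n \<omega> \<in> B} \<inter> {\<omega>\<in>space M. state n \<omega> = i}) *
      prob ({\<omega>\<in>space M. state (Suc n) \<omega> = j \<and> sojourn n \<omega> \<le> y} \<inter> {\<omega>\<in>space M. state n \<omega> = i})"
proof (cases "i \<in> states")
  case i: True
  let ?E = "{\<omega>\<in>space M. history n \<omega> \<in> B \<and> state n \<omega> = i}"
  \<comment> \<open>The condition on the history is trivial; it gives the event the form that
    \<open>stopped_history\<close> covers.\<close>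
  let ?S = "{\<omega>\<in>space M. history n \<omega> \<in> space (history_space n) \<and> state n \<omega> = i}"
  have S: "?S = {\<omega>\<in>space M. state n \<omega> = i}"
    using measurable_space[OF history_measurable[of n]] by auto
  have "prob ?S * prob {\<omega>\<in>?E. state (Suc n) \<omega> = j \<and> sojourn n \<omega> \<le> y} =
    prob ?E * prob {\<omega>\<in>?S. state (Suc n) \<omega> = j \<and> sojourn n \<omega> \<le> y}"
    by (rule transition_proportional[OF n i stopped_history[OF B] _ stopped_history[OF sets.top]]) auto
  moreover have "{\<omega>\<in>?E. state (Suc n) \<omega> = j \<and> sojourn n \<omega> \<le> y} =
    {\<omega>\<in>space M. history n \<omega> \<in> B} \<inter> {\<omega>\<in>space M. state (Suc n) \<omega> = j \<and> sojourn n \<omega> \<le> y} \<inter> {\<omega>\<in>space M. state n \<omega> = i}"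
    "?E = {\<omega>\<in>space M. history n \<omega> \<in> B} \<inter> {\<omega>\<in>space M. state n \<omega> = i}"
    "{\<omega>\<in>{\<omega>\<in>space M. state n \<omega> = i}. state (Suc n) \<omega> = j \<and> sojourn n \<omega> \<le> y} =
      {\<omega>\<in>space M. state (Suc n) \<omega> = j \<and> sojourn n \<omega> \<le> y} \<inter> {\<omega>\<in>space M. state n \<omega> = i}"
    by auto
  ultimately show ?thesis unfolding S by (simp only: mult.commute)
next
  case False
  let ?S = "{\<omega>\<in>space M. state n \<omega> = i}"
  have "?S \<in> events" by measurable
  then have "prob (C \<inter> ?S) \<le> prob ?S" for C by (intro finite_measure_mono) auto
  then have "prob (C \<inter> ?S) = 0" for C using prob_state_0[OF False, of n] by (metis measure_le_0_iff)
  then show ?thesis using prob_state_0[OF False, of n] by simp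
qed

text \<open>The bound on the sojourn is removed by letting y tend to infinity through the
  integers.\<close>

lemma markov_property_state:
  assumes n: "1 \<le> n" and B: "B \<in> sets (history_space n)"
  shows "prob ({\<omega>\<in>space M. history n \<omega> \<in> B} \<inter> {\<omega>\<in>space M. state (Suc n) \<omega> = j} \<inter> {\<omega>\<in>space M. state n \<omega> = i}) *
      prob {\<omega>\<in>space M. state n \<omega> = i} =
    prob ({\<omega>\<in>space M. history n \<omega> \<in> B} \<inter> {\<omega>\<in>space M. state n \<omega> = i}) *
      prob ({\<omega>\<in>space M. state (Suc n) \<omega> = j} \<inter> {\<omega>\<in>space M. state n \<omega> = i})"
proof -
  let ?H = "{\<omega>\<in>space M. history n \<omega> \<in> B}" and ?S = "{\<omega>\<in>space M. state n \<omega> = i}"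
  let ?Q = "\<lambda>y::nat. {\<omega>\<in>space M. state (Suc n) \<omega> = j \<and> sojourn n \<omega> \<le> real y}"
  have H: "?H \<in> events" and S: "?S \<in> events" and Q: "?Q y \<in> events" for y using B by measurable
  have lim: "(\<lambda>y. prob (C \<inter> ?Q y \<inter> ?S)) \<longlonglongrightarrow> prob (C \<inter> {\<omega>\<in>space M. state (Suc n) \<omega> = j} \<inter> ?S)"
    if C: "C \<in> events" for C
  proof -
    have "(\<lambda>y. prob (C \<inter> ?Q y \<inter> ?S)) \<longlonglongrightarrow> prob (\<Union>y. C \<inter> ?Q y \<inter> ?S)"
      using C S Q by (intro finite_Lim_measure_incseq) (auto simp: incseq_def intro: order_trans)
    also have "(\<Union>y. C \<inter> ?Q y \<inter> ?S) = C \<inter> {\<omega>\<in>space M. state (Suc n) \<omega> = j} \<inter> ?S"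
      by (auto simp: real_arch_simple)
    finally show ?thesis .
  qed
  have space: "space M \<inter> A = A" if "A \<in> events" for A using sets.sets_into_space[OF that] by auto
  have "(\<lambda>y. prob (?H \<inter> ?Q y \<inter> ?S) * prob ?S) \<longlonglongrightarrow> prob (?H \<inter> {\<omega>\<in>space M. state (Suc n) \<omega> = j} \<inter> ?S) * prob ?S"
    by (intro tendsto_mult_right lim H)
  moreover have "(\<lambda>y. prob (?H \<inter> ?S) * prob (space M \<inter> ?Q y \<inter> ?S)) \<longlonglongrightarrow>
      prob (?H \<inter> ?S) * prob (space M \<inter> {\<omega>\<in>space M. state (Suc n) \<omega> = j} \<inter> ?S)"
    by (intro tendsto_mult_left lim sets.top)
  moreover have "prob (?H \<inter> ?Q y \<inter> ?S) * prob ?S = prob (?H \<inter> ?S) * prob (space M \<inter> ?Q y \<inter> ?S)" for y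
    using markov_property[OF n B, of j "real y" i] by (simp only: space[OF Q])
  moreover have "space M \<inter> {\<omega>\<in>space M. state (Suc n) \<omega> = j} = {\<omega>\<in>space M. state (Suc n) \<omega> = j}" by auto
  ultimately show ?thesis by (simp only: LIMSEQ_unique)
qed

text \<open>Both sides of a Markov property fit this form: \<open>f\<close> is a function of the
  history, through \<open>\<phi>\<close>, and still determines the current state, through
  \<open>\<psi>\<close>. Each conditional probability then equals the same elementary
  quotient.\<close>

lemma cond_prob_given_eq:
  assumes f: "f \<in> measurable M K" and \<phi>: "\<phi> \<in> measurable (history_space n) K" and f_eq: "\<And>\<omega>. \<omega> \<in> space M \<Longrightarrow> f \<omega> = \<phi> (history n \<omega>)"
    and \<psi>: "\<psi> \<in> measurable K (count_space UNIV)" and state_eq: "\<And>\<omega>. \<omega> \<in> space M \<Longrightarrow> state n \<omega> = \<psi> (f \<omega>)"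
    and Q: "Q \<in> events"
    and markov: "\<And>B i. B \<in> sets (history_space n) \<Longrightarrow>
      prob ({\<omega>\<in>space M. history n \<omega> \<in> B} \<inter> Q \<inter> {\<omega>\<in>space M. state n \<omega> = i}) * prob {\<omega>\<in>space M. state n \<omega> = i} =
      prob ({\<omega>\<in>space M. history n \<omega> \<in> B} \<inter> {\<omega>\<in>space M. state n \<omega> = i}) * prob (Q \<inter> {\<omega>\<in>space M. state n \<omega> = i})"
  shows "AE \<omega> in M. cond_prob_given M f K Q \<omega> =
    prob (Q \<inter> {\<omega>'\<in>space M. state n \<omega>' = state n \<omega>}) / prob {\<omega>'\<in>space M. state n \<omega>' = state n \<omega>}"
  unfolding cond_prob_given_def
proof (rule real_cond_exp_eq_of_discrete)
  have f_space: "f \<in> space M \<rightarrow> space K" using measurable_space[OF f] by auto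
  note sets_V = sets_vimage_algebra2[OF f_space]
  show "subalgebra M (vimage_algebra (space M) f K)"
    unfolding subalgebra_def sets_V using measurable_sets[OF f] by auto
  have "(\<lambda>\<omega>. \<psi> (f \<omega>)) \<in> measurable (vimage_algebra (space M) f K) (count_space UNIV)"
    by (rule measurable_compose[OF measurable_vimage_algebra1[OF f_space] \<psi>])
  then show "state n \<in> measurable (vimage_algebra (space M) f K) (count_space UNIV)"
    by (rule measurable_cong[THEN iffD2, rotated]) (simp add: state_eq)
  fix A i assume "A \<in> sets (vimage_algebra (space M) f K)"
  then obtain C where C: "C \<in> sets K" "A = f -` C \<inter> space M" unfolding sets_V by blast
  have "A = {\<omega>\<in>space M. history n \<omega> \<in> \<phi> -` C \<inter> space (history_space n)}"
    using C f_eq measurable_space[OF history_measurable[of n]] by auto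
  then show "prob (A \<inter> Q \<inter> {\<omega>\<in>space M. state n \<omega> = i}) * prob {\<omega>\<in>space M. state n \<omega> = i} =
      prob (A \<inter> {\<omega>\<in>space M. state n \<omega> = i}) * prob (Q \<inter> {\<omega>\<in>space M. state n \<omega> = i})"
    using markov[OF measurable_sets[OF \<phi> C(1)]] by simp
qed fact

lemma past_state_measurable:
  assumes "k \<le> n"
  shows "(\<lambda>x. fst (x k)) \<in> measurable (history_space n) (count_space UNIV)"
proof -
  have "(\<lambda>x. x k) \<in> measurable (history_space n) (count_space UNIV \<Otimes>\<^sub>M borel)"
    using assms by (intro measurable_component_singleton) simp
  from measurable_compose[OF this measurable_fst] show ?thesis .
qed

text \<open>\<open>N\<close> is finite, monotone and equal to n at \<open>T n\<close>. If all jump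
  times were at most t, the jump with index \<open>N t + 1\<close> would give
  \<open>N t + 1 \<le> N t\<close>.\<close>

theorem AE_no_explosion: "AE \<omega> in M. filterlim (\<lambda>n. T n \<omega>) at_top sequentially"
  using AE_jumps paths
proof eventually_elim
  case (elim \<omega>)
  then obtain m where "solution_path r lam lamt m (\<lambda>t. X t \<omega>) (\<lambda>t. Y t \<omega>) (\<lambda>t. N t \<omega>)" by blast
  then interpret sp: solution_path r lam lamt m "\<lambda>t. X t \<omega>" "\<lambda>t. Y t \<omega>" "\<lambda>t. N t \<omega>" .
  have st: "0 \<le> T n \<omega>" "N (T n \<omega>) \<omega> = n" for n
    using jump_stage[of n \<omega>] elim(1) by (auto simp: stage_def)
  have mono: "incseq (\<lambda>n. T n \<omega>)"
    using jump_less elim(1) by (intro incseq_SucI less_imp_le) blast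
  show ?case
    unfolding filterlim_at_top
  proof
    fix t :: real
    have "\<exists>n. t < T n \<omega>"
    proof (rule ccontr)
      assume "\<nexists>n. t < T n \<omega>"
      then have "T (Suc (N t \<omega>)) \<omega> \<le> t" by (simp add: not_less)
      from sp.N_mono[OF st(1) this] show False unfolding st(2) by simp
    qed
    then obtain n where "t < T n \<omega>" by blast
    then have "t \<le> T k \<omega>" if "n \<le> k" for k using incseqD[OF mono that] by simp
    then show "eventually (\<lambda>k. t \<le> T k \<omega>) sequentially" by (auto simp: eventually_sequentially)
  qed
qed

text \<open>Since the jump times are unbounded, every nonnegative time lies in some interval from
  \<open>T n\<close> up to, but excluding, \<open>T (Suc n)\<close>, and the path is constant on
  each of these.\<close>

lemma AE_piecewise_constant:
  "AE \<omega> in M. piecewise_constant_with_jumps (\<lambda>t. X t \<omega>) (\<lambda>n. origin n \<omega>)"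
  using AE_jumps AE_no_explosion
proof eventually_elim
  case (elim \<omega>)
  then have j: "jump n \<omega>" for n by blast
  have const: "X t \<omega> = X (T n \<omega>) \<omega>" if "T n \<omega> \<le> t" "t < T (Suc n) \<omega>" for n t
    using jump_const[OF j that] by (simp add: state_eq)
  have between: "\<exists>n. T n \<omega> \<le> t \<and> t < T (Suc n) \<omega>" if t: "0 \<le> t" for t
  proof -
    from elim(2) have "eventually (\<lambda>n. t + 1 \<le> T n \<omega>) sequentially" unfolding filterlim_at_top by blast
    then obtain m where "t < T m \<omega>" by (auto simp: eventually_sequentially) (metis add_le_cancel_left le_refl less_add_one order.strict_trans2)
    \<comment> \<open>The first jump time beyond t; its predecessor opened the interval that
      contains t.\<close>
    define k where "k = (LEAST m. t < T m \<omega>)"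
    have k: "t < T k \<omega>" unfolding k_def using \<open>t < T m \<omega>\<close> by (rule LeastI)
    with t have "k \<noteq> 0" by (cases k) auto
    then obtain n where n: "k = Suc n" by (cases k) auto
    then have "\<not> t < T n \<omega>" using not_less_Least[of n "\<lambda>m. t < T m \<omega>"] unfolding k_def by simp
    then show ?thesis using k n by (intro exI[of _ n]) auto
  qed
  have "{t. 0 < t \<and> \<not> isCont (\<lambda>t. X t \<omega>) t} = (\<lambda>n. origin n \<omega>) ` {1..}"
  proof (intro equalityI subsetI)
    fix t assume t: "t \<in> {t. 0 < t \<and> \<not> isCont (\<lambda>t. X t \<omega>) t}"
    then obtain n where n: "T n \<omega> \<le> t" "t < T (Suc n) \<omega>" using between[of t] by auto
    have "t = T n \<omega>"
    proof (rule ccontr)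
      assume "t \<noteq> T n \<omega>"
      with n have "T n \<omega> < t" by simp
      then have "isCont (\<lambda>t. X t \<omega>) t"
        using n(2) const by (intro isCont_if_locally_constant[of "T n \<omega>" t "T (Suc n) \<omega>"]) (auto intro: less_imp_le)
      with t show False by simp
    qed
    moreover from this t have "n \<noteq> 0" by (cases n) auto
    ultimately show "t \<in> (\<lambda>n. origin n \<omega>) ` {1..}" by (auto simp: origin_pos intro!: image_eqI[of _ _ n])
  next
    fix t assume "t \<in> (\<lambda>n. origin n \<omega>) ` {1..}"
    then obtain n where "t = T (Suc n) \<omega>" by (auto simp: Suc_le_eq gr0_conv_Suc origin_Suc)
    then show "t \<in> {t. 0 < t \<and> \<not> isCont (\<lambda>t. X t \<omega>) t}"
      using jump_pos[OF j] jump_discontinuous[OF j] by simp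
  qed
  moreover have "0 < origin 1 \<omega>" using jump_pos[OF j[of 0]] by (simp add: origin_pos)
  moreover have "origin n \<omega> < origin (Suc n) \<omega>" if "1 \<le> n" for n
    using jump_less[OF j] that by (simp add: origin_pos)
  moreover have "X t \<omega> = X 0 \<omega>" if "0 \<le> t" "t < origin 1 \<omega>" for t
    using const[of 0 t] that by (simp add: origin_pos)
  moreover have "X t \<omega> = X (origin n \<omega>) \<omega>" if "1 \<le> n" "origin n \<omega> \<le> t" "t < origin (Suc n) \<omega>" for n t
    using const[of n t] that by (simp add: origin_pos)
  ultimately show ?case unfolding piecewise_constant_with_jumps_def by blast
qed

theorem pure_semi_Markov_process:
  assumes X_meas: "\<And>t. 0 \<le> t \<Longrightarrow> X t \<in> measurable M (count_space UNIV)"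
    and X_paths: "AE \<omega> in M. (\<forall>t\<ge>0. X t \<omega> \<in> states) \<and> rcll (\<lambda>t. X t \<omega>)"
  shows "pure_semi_Markov M states X origin"
  unfolding pure_semi_Markov_def semi_Markov_def state_def[symmetric] Let_def
proof (intro conjI allI impI ballI)
  show "prob_space M" by (rule prob_space_axioms)
  show "AE \<omega> in M. (\<forall>t\<ge>0. X t \<omega> \<in> states) \<and> rcll (\<lambda>t. X t \<omega>) \<and> origin 0 \<omega> \<le> 0 \<and>
      piecewise_constant_with_jumps (\<lambda>t. X t \<omega>) (\<lambda>n. origin n \<omega>)"
    using X_paths AE_piecewise_constant AE_space by eventually_elim (simp add: origin_0 Y_0_nonneg)
  show "AE \<omega> in M. filterlim (\<lambda>n. origin n \<omega>) at_top sequentially"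
    using AE_no_explosion
  proof eventually_elim
    case (elim \<omega>)
    have "eventually (\<lambda>n. T n \<omega> = origin n \<omega>) sequentially"
      using eventually_ge_at_top[of 1] by eventually_elim (simp add: origin_pos)
    then show ?case using elim by (rule filterlim_cong[THEN iffD1, OF refl refl])
  qed
next
  fix n :: nat and j and y :: real
  assume n: "1 \<le> n"
  let ?Q = "{\<omega>\<in>space M. state (Suc n) \<omega> = j \<and> sojourn n \<omega> \<le> y}"
  have Q: "?Q \<in> events" by measurable
  \<comment> \<open>Conditioning on the full history and conditioning on the state lead to the same
    quotient.\<close>
  have "AE \<omega> in M. cond_prob_given M (history n) (history_space n) ?Q \<omega> =
      prob (?Q \<inter> {\<omega>'\<in>space M. state n \<omega>' = state n \<omega>}) / prob {\<omega>'\<in>space M. state n \<omega>' = state n \<omega>}"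
    by (rule cond_prob_given_eq[where \<phi>="\<lambda>x. x" and \<psi>="\<lambda>x. fst (x n)", OF history_measurable _ _ _ _ Q markov_property[OF n]])
       (auto simp: history_def intro!: past_state_measurable)
  moreover have "AE \<omega> in M. cond_prob_given M (state n) (count_space UNIV) ?Q \<omega> =
      prob (?Q \<inter> {\<omega>'\<in>space M. state n \<omega>' = state n \<omega>}) / prob {\<omega>'\<in>space M. state n \<omega>' = state n \<omega>}"
    by (rule cond_prob_given_eq[where \<phi>="\<lambda>x. fst (x n)" and \<psi>="\<lambda>x. x", OF state_measurable _ _ _ _ Q markov_property[OF n]])
       (auto simp: history_def intro!: past_state_measurable)
  ultimately have "AE \<omega> in M. cond_prob_given M (history n) (history_space n) ?Q \<omega> =
      cond_prob_given M (state n) (count_space UNIV) ?Q \<omega>"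
    by eventually_elim simp
  then show "AE \<omega> in M.
      cond_prob_given M (\<lambda>\<omega>. \<lambda>k\<in>{..n}. (state k \<omega>, origin k \<omega>)) (PiM {..n} (\<lambda>_. count_space UNIV \<Otimes>\<^sub>M borel))
        {\<omega>\<in>space M. state (Suc n) \<omega> = j \<and> origin (Suc n) \<omega> - origin n \<omega> \<le> y} \<omega> =
      cond_prob_given M (state n) (count_space UNIV)
        {\<omega>\<in>space M. state (Suc n) \<omega> = j \<and> origin (Suc n) \<omega> - origin n \<omega> \<le> y} \<omega>"
    unfolding history_def[abs_def] sojourn_def .
qed (use complete X_meas origin_measurable state_measurable in auto)

text \<open>The index shift leaves out \<open>X 0\<close>. The past of the chain is a function of
  the longer history, which also contains the jump times, so conditional independence of that
  history implies the claim.\<close>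

theorem embedded_markov_chain: "markov_chain M states (\<lambda>n. state (Suc n))"
  unfolding markov_chain_def Let_def
proof (intro conjI allI ballI)
  show "prob_space M" by (rule prob_space_axioms)
  show "state (Suc n) \<in> measurable M (count_space UNIV)" for n by (rule state_measurable)
  show "AE \<omega> in M. \<forall>n. state (Suc n) \<omega> \<in> states" using state_AE by (simp add: AE_all_countable)
  fix n j
  let ?Q = "{\<omega>\<in>space M. state (Suc (Suc n)) \<omega> = j}"
  have Q: "?Q \<in> events" by measurable
  have n: "1 \<le> Suc n" by simp
  have f: "(\<lambda>\<omega>. \<lambda>k\<in>{..n}. state (Suc k) \<omega>) \<in> measurable M (PiM {..n} (\<lambda>_. count_space UNIV))"
    by (intro measurable_restrict state_measurable)
  have "AE \<omega> in M. cond_prob_given M (\<lambda>\<omega>. \<lambda>k\<in>{..n}. state (Suc k) \<omega>) (PiM {..n} (\<lambda>_. count_space UNIV)) ?Q \<omega> =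
      prob (?Q \<inter> {\<omega>'\<in>space M. state (Suc n) \<omega>' = state (Suc n) \<omega>}) / prob {\<omega>'\<in>space M. state (Suc n) \<omega>' = state (Suc n) \<omega>}"
    \<comment> \<open>\<open>\<phi>\<close> forgets the initial entry and the times;
      \<open>\<psi>\<close> reads the last entry, which is the state after \<open>Suc n\<close>
      jumps.\<close>
    by (rule cond_prob_given_eq[where \<phi>="\<lambda>x. \<lambda>k\<in>{..n}. fst (x (Suc k))" and \<psi>="\<lambda>x. x n", OF f _ _ _ _ Q markov_property_state[OF n]])
       (auto simp: history_def intro!: measurable_restrict past_state_measurable measurable_component_singleton restrict_ext)
  moreover have "AE \<omega> in M. cond_prob_given M (state (Suc n)) (count_space UNIV) ?Q \<omega> =
      prob (?Q \<inter> {\<omega>'\<in>space M. state (Suc n) \<omega>' = state (Suc n) \<omega>}) / prob {\<omega>'\<in>space M. state (Suc n) \<omega>' = state (Suc n) \<omega>}"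
    by (rule cond_prob_given_eq[where \<phi>="\<lambda>x. fst (x (Suc n))" and \<psi>="\<lambda>x. x", OF state_measurable _ _ _ _ Q markov_property_state[OF n]])
       (auto simp: history_def intro!: past_state_measurable)
  ultimately show "AE \<omega> in M. cond_prob_given M (\<lambda>\<omega>. \<lambda>k\<in>{..n}. state (Suc k) \<omega>) (PiM {..n} (\<lambda>_. count_space UNIV)) ?Q \<omega> =
      cond_prob_given M (state (Suc n)) (count_space UNIV) ?Q \<omega>"
    by eventually_elim simp
qed

end

theorem theorem3p1:
  fixes M :: "'a measure" and F :: "real \<Rightarrow> 'a measure"
    and p :: "'a \<Rightarrow> (real \<times> real) measure"
    and r :: "(nat \<times> nat) set" and lam lamt :: rates
    and X :: "real \<Rightarrow> 'a \<Rightarrow> nat" and Y :: "real \<Rightarrow> 'a \<Rightarrow> real" and N :: "real \<Rightarrow> 'a \<Rightarrow> nat"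
  assumes prob: "prob_space M"
    and filt: "usual_filtration M F"
    and order: "strict_linear_order_on states r"
    and lam_meas: "\<And>i j. (i, j) \<in> state_pairs \<Longrightarrow>
        (\<lambda>(y, n). lam i j y n) \<in> borel_measurable age_count_measure"
    and lam_nonneg: "\<And>i j y n. (i, j) \<in> state_pairs \<Longrightarrow> 0 \<le> y \<Longrightarrow> 0 \<le> lam i j y n"
    and lam_bounded: "\<And>i j. (i, j) \<in> state_pairs \<Longrightarrow> \<exists>B. \<forall>y\<ge>0. \<forall>n. lam i j y n \<le> B"
    and A1: "(SUP i\<in>states. rate_bound lam i) < \<infinity>"
    and A2: "\<And>i n. i \<in> states \<Longrightarrow> ((\<lambda>y. cumulative_rate lam i y n) \<longlongrightarrow> \<infinity>) at_top"
    and lamt_meas: "\<And>i j. (i, j) \<in> state_pairs \<Longrightarrow>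
        (\<lambda>(y, n). lamt i j y n) \<in> borel_measurable age_count_measure"
    and lam_le_lamt: "\<And>i j y n. (i, j) \<in> state_pairs \<Longrightarrow> 0 \<le> y \<Longrightarrow> lam i j y n \<le> lamt i j y n"
    and lamt_le: "\<And>i j. (i, j) \<in> state_pairs \<Longrightarrow>
        AE (y, n) in age_count_measure. ennreal (lamt i j y n) \<le> Linf_norm (lam i j)"
    and Lam_defined: "\<And>i j y n. (i, j) \<in> state_pairs \<Longrightarrow> 0 \<le> y \<Longrightarrow>
        (\<lambda>(i', j'). lamt i' j' y n) summable_on pairs_before r i j"
    and prm: "poisson_random_measure M half_plane p"
    and prm_adapted: "\<And>t B. 0 \<le> t \<Longrightarrow> B \<in> sets borel \<Longrightarrow>
        (\<lambda>\<omega>. emeasure (p \<omega>) ({0<..t} \<times> B)) \<in> borel_measurable (F t)"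
    and init_indep: "prob_space.indep_set M
        (sets (vimage_algebra (space M) (\<lambda>\<omega>. (X 0 \<omega>, Y 0 \<omega>)) (count_space UNIV \<Otimes>\<^sub>M borel)))
        (sets (sigma_of_random_measure M half_plane p))"
    and sol: "strong_solution M F p r lam lamt X Y N"
  shows "pure_semi_Markov M states X (transition_time (\<lambda>\<omega>. - Y 0 \<omega>) X) \<and>
         markov_chain M states (\<lambda>n \<omega>. X (transition_time (\<lambda>\<omega>. - Y 0 \<omega>) X (Suc n) \<omega>) \<omega>)"
proof -
  interpret prob_space M by (rule prob)
  interpret transition_rates r lam lamt
    by unfold_locales (fact order lam_meas lam_nonneg A1 A2 lamt_meas lam_le_lamt lamt_le Lam_defined)+
  \<comment> \<open>The initial values serve as the information at time 0, and
    \<open>init_indep\<close> is the independence that \<open>poisson_process\<close> asks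
    for.\<close>
  define V where "V = vimage_algebra (space M) (\<lambda>\<omega>. (X 0 \<omega>, Y 0 \<omega>)) (count_space UNIV \<Otimes>\<^sub>M borel)"
  have complete: "complete_measure M" and FM: "\<And>t. 0 \<le> t \<Longrightarrow> subalgebra M (F t)"
    using filt by (auto simp: usual_filtration_def)
  have space_V: "space V = space M" by (simp add: V_def)
  interpret poisson_process M p V
    by (rule poisson_process.intro[OF prob poisson_process_axioms.intro[OF complete prm space_V]])
       (use init_indep in \<open>simp add: V_def\<close>)
  have X_meas: "X t \<in> measurable M (count_space UNIV)" if "0 \<le> t" for t
    using sol that measurable_from_subalg[OF FM[OF that]] by (auto simp: strong_solution_def)
  have sol_states: "X t \<omega> \<in> states" "0 \<le> Y t \<omega>" if "\<omega> \<in> space M" "0 \<le> t" for t \<omega>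
    using sol that by (auto simp: strong_solution_def)
  have init: "(\<lambda>\<omega>. (X 0 \<omega>, Y 0 \<omega>)) \<in> measurable (past 0) (count_space UNIV \<Otimes>\<^sub>M borel)"
  proof (rule measurable_mono[THEN subsetD])
    show "(\<lambda>\<omega>. (X 0 \<omega>, Y 0 \<omega>)) \<in> measurable V (count_space UNIV \<Otimes>\<^sub>M borel)"
      unfolding V_def by (rule measurable_vimage_algebra1) (auto simp: space_pair_measure)
    show "sets V \<subseteq> sets (past 0)" using V_past by blast
  qed (simp_all add: space_past space_V)
  have sol_paths: "AE \<omega> in M. rcll (\<lambda>t. X t \<omega>) \<and> rcll (\<lambda>t. Y t \<omega>) \<and> rcll (\<lambda>t. N t \<omega>)"
    using sol by (simp add: strong_solution_def)
  have sol_eq: "AE \<omega> in M. \<forall>t\<ge>0.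
        let D = {0<..t} \<times> UNIV;
            Xm = left_lim (\<lambda>s. X s \<omega>); Ym = left_lim (\<lambda>s. Y s \<omega>); Nm = left_lim (\<lambda>s. N s \<omega>);
            h = (\<lambda>(u, v). hLam r lam lamt (Xm u) (Ym u) (Nm u) v);
            g = (\<lambda>(u, v). gLam r lam lamt (Xm u) (Ym u) (Nm u) v);
            k = (\<lambda>(u, v). Ym u * gLam r lam lamt (Xm u) (Ym u) (Nm u) v)
        in set_integrable (p \<omega>) D h \<and> set_integrable (p \<omega>) D g \<and> set_integrable (p \<omega>) D k \<and>
           real (X t \<omega>) = real (X 0 \<omega>) + set_lebesgue_integral (p \<omega>) D h \<and>
           Y t \<omega> = Y 0 \<omega> + t - set_lebesgue_integral (p \<omega>) D k \<and>
           real (N t \<omega>) = set_lebesgue_integral (p \<omega>) D g"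
    using sol unfolding strong_solution_def by (elim conjE)
  have paths: "AE \<omega> in M. \<exists>m. solution_path r lam lamt m (\<lambda>t. X t \<omega>) (\<lambda>t. Y t \<omega>) (\<lambda>t. N t \<omega>) \<and>
      (\<forall>D\<in>sets borel. D \<subseteq> {0..} \<times> UNIV \<longrightarrow> emeasure (plane_measure \<omega>) D = emeasure m D)"
    using sol_paths sol_eq AE_atoms AE_plane_measure_eq AE_space
  proof eventually_elim
    case (elim \<omega>)
    have "solution_path r lam lamt (p \<omega>) (\<lambda>t. X t \<omega>) (\<lambda>t. Y t \<omega>) (\<lambda>t. N t \<omega>)"
    proof (rule solution_path.intro[OF transition_rates_axioms], rule solution_path_axioms.intro)
      show "sets (p \<omega>) = sets half_plane" by (rule sets_p[OF elim(5)])
      show "rcll (\<lambda>t. X t \<omega>)" "rcll (\<lambda>t. Y t \<omega>)" "rcll (\<lambda>t. N t \<omega>)" using elim(1) by auto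
      show "X t \<omega> \<in> states" "0 \<le> Y t \<omega>" if "0 \<le> t" for t using sol_states[OF elim(5) that] by auto
      show "emeasure (p \<omega>) ({u} \<times> C) \<in> {0, 1}" if "0 < u" "C \<in> sets borel" for u C
        using elim(3) that by blast
    qed (rule elim(2))
    with elim(4) show ?case by blast
  qed
  \<comment> \<open>The filtration is \<open>past\<close>, under which later atoms are independent
    of earlier information, and \<open>plane_measure\<close> plays the part of
    \<open>q\<close>.\<close>
  interpret semi_markov_process r lam lamt M past plane_measure X Y N
  proof (rule semi_markov_process.intro[OF transition_rates_axioms unit_intensity_plane_measure], rule semi_markov_process_axioms.intro)
    show "X 0 \<in> measurable (past 0) (count_space UNIV)"
      using measurable_compose[OF init measurable_fst] by simp
    show "Y 0 \<in> borel_measurable (past 0)"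
      using measurable_compose[OF init measurable_snd] by simp
  qed (use sol_states paths in auto)
  have "pure_semi_Markov M states X origin"
    using sol_paths AE_space sol_states by (intro pure_semi_Markov_process X_meas) auto
  moreover have "(\<lambda>n \<omega>. X (transition_time (\<lambda>\<omega>. - Y 0 \<omega>) X (Suc n) \<omega>) \<omega>) = (\<lambda>n. state (Suc n))"
    by (simp add: state_def embedded_def origin_def fun_eq_iff)
  ultimately show ?thesis
    using embedded_markov_chain by (simp add: origin_def)
qed

end
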